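(* Let $H(x)=\frac{|x|^2}{2}$ for $x=(x_1,x_2)\in\mathbb{R}^2$, and let $v$ be a stationary Gaussian noise whose covariance function $R(t)=\mathbb{E}[v(t)v(0)]$ is of the form $R(t)=L(t)/t^{\gamma}$ for some $\gamma\in(0,2)$ and some function $L$ that is slowly varying at infinity. If $\gamma\in(0,1]$, assume further that $L$ has the slow increase property $$\lim_{t\to\infty}\frac{L'(t)}{L(t)/t}=0 .$$ Let $X_0\in\mathbb{R}^2$ and, for $\epsilon>0$, let $X^\epsilon$ be the solution of $$\dot X^\epsilon_t=\frac1{\epsilon^2}\nabla^\perp H(X^\epsilon_t)+\frac1\epsilon\, v\Big(\frac{t}{\epsilon^2}\Big)e_2,\qquad X^\epsilon_0=X_0 .$$ Then, as $\epsilon\to0$, the family of processes $(H(X^\epsilon))_{\epsilon>0}$ converges in distribution to $H(W^D)$, where $W^D$ is a two-dimensional Brownian motion with $W^D_0=X_0$ and covariance matrix $D$ given by $$D_{11}=D_{22}=\lim_{x\to\infty}\int_0^x R(z)\cos(z)\,dz\qquad\text{and}\qquad D_{12}=D_{21}=0 .$$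
   Context: Notation: $\nabla^\perp=(\partial_{x_2},-\partial_{x_1})^T$ and $e_2=(0,1)^T$. The noise $v=(v(t))$ is a real-valued stationary Gaussian process with $R(t)=\mathbb{E}[v(t)v(0)]=\mathbb{E}[v(t+s)v(s)]$ (the process is centered); the formula $R(t)=L(t)/t^\gamma$ is for $t>0$. A function $L$ is slowly varying at infinity if for every $s>0$, $L(st)/L(t)\to1$ as $t\to\infty$. Brownian motion with covariance matrix $D$ means that $W^D_t-W^D_0$ is centered Gaussian with covariance matrix $tD$ and has independent stationary increments and continuous paths. Under the stated hypotheses the limit defining $D_{11}$ exists and is finite. Convergence in distribution is convergence in law of continuous processes (uniform convergence on compact time intervals). *)

theory Defs
  imports "HOL-Probability.Probability"
begin

section \<open>Gaussian variables, vectors and processes\<close>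

text \<open>Point masses count as (degenerate) Gaussian laws; \<open>normal_density\<close> covers only
  positive standard deviation.\<close>

definition normal_law :: "real \<Rightarrow> real \<Rightarrow> real measure" where
  "normal_law m \<sigma> = (if \<sigma> = 0 then return borel m else density lborel (normal_density m \<sigma>))"

definition gaussian_rv :: "'a measure \<Rightarrow> ('a \<Rightarrow> real) \<Rightarrow> bool" where
  "gaussian_rv M Y \<longleftrightarrow>
     Y \<in> borel_measurable M \<and> (\<exists>m \<sigma>. 0 \<le> \<sigma> \<and> distr M borel Y = normal_law m \<sigma>)"

definition centered_gaussian_vector :: "'a measure \<Rightarrow> ('a \<Rightarrow> real ^ 'n) \<Rightarrow> real ^ 'n ^ 'n \<Rightarrow> bool" where
  "centered_gaussian_vector M Y C \<longleftrightarrow>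
     Y \<in> borel_measurable M \<and>
     (\<forall>u. gaussian_rv M (\<lambda>\<omega>. u \<bullet> Y \<omega>)) \<and>
     (\<forall>i. prob_space.expectation M (\<lambda>\<omega>. Y \<omega> $ i) = 0) \<and>
     (\<forall>i j. prob_space.expectation M (\<lambda>\<omega>. Y \<omega> $ i * Y \<omega> $ j) = C $ i $ j)"

text \<open>All processes are indexed by times \<open>t \<ge> 0\<close>; their values at negative times are irrelevant.\<close>

definition gaussian_process :: "'a measure \<Rightarrow> (real \<Rightarrow> 'a \<Rightarrow> real) \<Rightarrow> bool" where
  "gaussian_process M v \<longleftrightarrow>
     (\<forall>J c. finite J \<and> J \<subseteq> {0..} \<longrightarrow> gaussian_rv M (\<lambda>\<omega>. \<Sum>t\<in>J. c t * v t \<omega>))"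

definition stationary_process :: "'a measure \<Rightarrow> (real \<Rightarrow> 'a \<Rightarrow> real) \<Rightarrow> bool" where
  "stationary_process M v \<longleftrightarrow>
     (\<forall>J h. finite J \<and> J \<subseteq> {0..} \<and> 0 \<le> h \<longrightarrow>
        distr M (\<Pi>\<^sub>M t\<in>J. borel) (\<lambda>\<omega>. \<lambda>t\<in>J. v (t + h) \<omega>) =
        distr M (\<Pi>\<^sub>M t\<in>J. borel) (\<lambda>\<omega>. \<lambda>t\<in>J. v t \<omega>))"

text \<open>Joint measurability in time and chance is what makes time integrals of the noise random
  variables. No continuity of paths is required.\<close>

definition measurable_process :: "'a measure \<Rightarrow> (real \<Rightarrow> 'a \<Rightarrow> real) \<Rightarrow> bool" where
  "measurable_process M v \<longleftrightarrow>
     (\<lambda>(t, \<omega>). v t \<omega>) \<in> borel_measurable (restrict_space borel {0..} \<Otimes>\<^sub>M M)"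

definition stationary_gaussian_noise :: "'a measure \<Rightarrow> (real \<Rightarrow> 'a \<Rightarrow> real) \<Rightarrow> bool" where
  "stationary_gaussian_noise M v \<longleftrightarrow>
     measurable_process M v \<and> gaussian_process M v \<and> stationary_process M v \<and>
     (\<forall>t\<ge>0. prob_space.expectation M (v t) = 0)"

definition autocovariance :: "'a measure \<Rightarrow> (real \<Rightarrow> 'a \<Rightarrow> real) \<Rightarrow> real \<Rightarrow> real" where
  "autocovariance M v t = prob_space.expectation M (\<lambda>\<omega>. v t \<omega> * v 0 \<omega>)"


section \<open>Slow variation and slow increase\<close>

text \<open>No sign condition: covariances that are eventually negative are allowed.\<close>

definition slowly_varying :: "(real \<Rightarrow> real) \<Rightarrow> bool" where
  "slowly_varying L \<longleftrightarrow> (\<forall>s>0. ((\<lambda>t. L (s * t) / L t) \<longlongrightarrow> 1) at_top)"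

definition slow_increase :: "(real \<Rightarrow> real) \<Rightarrow> bool" where
  "slow_increase L \<longleftrightarrow>
     (\<forall>\<^sub>F t in at_top. L field_differentiable (at t)) \<and>
     ((\<lambda>t. deriv L t / (L t / t)) \<longlongrightarrow> 0) at_top"


section \<open>The randomly perturbed Hamiltonian system\<close>

definition partial_deriv :: "2 \<Rightarrow> (real ^ 2 \<Rightarrow> real) \<Rightarrow> real ^ 2 \<Rightarrow> real" where
  "partial_deriv i f x = deriv (\<lambda>s. f (x + s *\<^sub>R axis i 1)) 0"

definition perp_grad :: "(real ^ 2 \<Rightarrow> real) \<Rightarrow> real ^ 2 \<Rightarrow> real ^ 2" where
  "perp_grad f x = vector [partial_deriv 2 f x, - partial_deriv 1 f x]"

definition H :: "real ^ 2 \<Rightarrow> real" where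
  "H x = (norm x)\<^sup>2 / 2"

definition continuous_process ::
    "'a measure \<Rightarrow> (real \<Rightarrow> 'a \<Rightarrow> 'b::{second_countable_topology, real_normed_vector}) \<Rightarrow> bool" where
  "continuous_process M Y \<longleftrightarrow>
     (\<forall>t\<ge>0. Y t \<in> borel_measurable M) \<and>
     (\<forall>\<omega>\<in>space M. continuous_on {0..} (\<lambda>t. Y t \<omega>))"

text \<open>The differential equation is read in integrated form, since the noise need not have
  continuous paths; where it has, this is the same as differentiability of \<open>X\<close> with the
  prescribed derivative at every time.\<close>

definition solves_perturbed_system ::
    "'a measure \<Rightarrow> (real \<Rightarrow> 'a \<Rightarrow> real) \<Rightarrow> real ^ 2 \<Rightarrow> real \<Rightarrow> (real \<Rightarrow> 'a \<Rightarrow> real ^ 2) \<Rightarrow> bool" where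
  "solves_perturbed_system M v X\<^sub>0 \<epsilon> X \<longleftrightarrow>
     continuous_process M X \<and>
     (AE \<omega> in M. X 0 \<omega> = X\<^sub>0 \<and>
        (\<forall>t\<ge>0. ((\<lambda>s. (1 / \<epsilon>\<^sup>2) *\<^sub>R perp_grad H (X s \<omega>) + ((1 / \<epsilon>) * v (s / \<epsilon>\<^sup>2) \<omega>) *\<^sub>R axis 2 1)
                 has_integral (X t \<omega> - X 0 \<omega>)) {0..t}))"


section \<open>Brownian motion with a given covariance matrix\<close>

definition brownian_motion ::
    "'a measure \<Rightarrow> real ^ 'n ^ 'n \<Rightarrow> real ^ 'n \<Rightarrow> (real \<Rightarrow> 'a \<Rightarrow> real ^ 'n) \<Rightarrow> bool" where
  "brownian_motion N D x W \<longleftrightarrow>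
     prob_space N \<and>
     continuous_process N W \<and>
     (AE \<omega> in N. W 0 \<omega> = x) \<and>
     (\<forall>t\<ge>0. centered_gaussian_vector N (\<lambda>\<omega>. W t \<omega> - W 0 \<omega>) (t *\<^sub>R D)) \<and>
     (\<forall>t\<ge>0. \<forall>h\<ge>0. distr N borel (\<lambda>\<omega>. W (t + h) \<omega> - W t \<omega>) = distr N borel (\<lambda>\<omega>. W h \<omega> - W 0 \<omega>)) \<and>
     (\<forall>(n::nat) \<tau>. 0 \<le> \<tau> 0 \<and> (\<forall>i<n. \<tau> i \<le> \<tau> (Suc i)) \<longrightarrow>
        prob_space.indep_vars N (\<lambda>_. borel) (\<lambda>i \<omega>. W (\<tau> (Suc i)) \<omega> - W (\<tau> i) \<omega>) {..<n})"


section \<open>Convergence in law of continuous processes\<close>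

definition continuous_paths :: "(real \<Rightarrow> real) set" where
  "continuous_paths = {f. continuous_on {0..} f}"

text \<open>Continuity is for the topology of uniform convergence on compact time intervals. In
  particular such a functional depends only on the restriction of a path to \<open>{0..}\<close>.\<close>

definition bounded_continuous_functional :: "((real \<Rightarrow> real) \<Rightarrow> real) \<Rightarrow> bool" where
  "bounded_continuous_functional \<Phi> \<longleftrightarrow>
     (\<exists>B. \<forall>f\<in>continuous_paths. \<bar>\<Phi> f\<bar> \<le> B) \<and>
     (\<forall>f\<in>continuous_paths. \<forall>e>0. \<exists>T \<delta>. 0 < \<delta> \<and>
        (\<forall>g\<in>continuous_paths. (\<forall>t\<in>{0..T}. \<bar>g t - f t\<bar> < \<delta>) \<longrightarrow> \<bar>\<Phi> g - \<Phi> f\<bar> < e))"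

definition converges_in_law_at_zero ::
    "'a measure \<Rightarrow> (real \<Rightarrow> real \<Rightarrow> 'a \<Rightarrow> real) \<Rightarrow> 'b measure \<Rightarrow> (real \<Rightarrow> 'b \<Rightarrow> real) \<Rightarrow> bool" where
  "converges_in_law_at_zero M Y N Z \<longleftrightarrow>
     (\<forall>\<Phi>. bounded_continuous_functional \<Phi> \<longrightarrow>
        ((\<lambda>\<epsilon>. prob_space.expectation M (\<lambda>\<omega>. \<Phi> (\<lambda>t. Y \<epsilon> t \<omega>)))
           \<longlongrightarrow> prob_space.expectation N (\<lambda>\<omega>. \<Phi> (\<lambda>t. Z t \<omega>))) (at_right 0))"

end

theory Submission imports Defs begin

text \<open>
  The flow of \<open>H\<close> is a rotation, which preserves \<open>H\<close>. Undoing it, \<open>Y\<^sub>t = rotate (t / \<epsilon>\<^sup>2) X\<^sub>t\<close> becomes the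
  Gaussian process \<open>X\<^sub>0 + \<epsilon> \<integral> v(s) (- sin s, cos s) ds\<close>, integrated up to \<open>t / \<epsilon>\<^sup>2\<close>, so that \<open>H(X) = H(Y)\<close>
  and everything reduces to covariances. These are expressed by \<open>\<integral>\<^sub>0\<^sup>x R(z) cos z dz\<close> and
  \<open>\<integral>\<^sub>0\<^sup>x R(z) sin z dz\<close>, which converge as \<open>x \<rightarrow> \<infinity>\<close>: absolutely if \<open>\<gamma> > 1\<close>, and because \<open>\<bar>R\<bar>\<close> eventually
  decreases to zero if \<open>\<gamma> \<le> 1\<close>; averaging the remaining oscillations leaves the covariance of
  Brownian motion. Tightness is replaced by Lipschitz regularisation of the test functional together
  with a fourth-moment chaining bound, uniform in \<open>\<epsilon>\<close>, on the error of piecewise linear interpolation.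
\<close>

section \<open>Centred Gaussian variables\<close>

text \<open>Since \<open>H\<close> is quadratic, every orbit turns with the same frequency, so the
  rotated process is exactly affine in the noise and no averaging over orbits remains. The obstacle
  is \<open>\<gamma> \<le> 1\<close>, where the covariance \<open>R\<close> need not be integrable
  and bounds by the integral of its absolute value are lost. Covariances are therefore expressed
  through the truncated integrals of \<open>R(z) cos z\<close> and \<open>R(z) sin z\<close>, which
  stay bounded; the addition formulas make this possible. The limit of the sine integrals need not
  vanish, but the two halves \<open>s < t\<close> and \<open>t < s\<close> of a covariance contain
  it with opposite signs for different components, and with coefficient 0 for equal ones. Hence the
  limit components are uncorrelated and only the cosine limit survives. A second obstacle is that
  neither paths nor covariance are assumed continuous: time integrals are shown to be Gaussian by
  sampling with an L2 error bound instead of Riemann sums. Gaussianity also turns variances into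
  fourth moments and reduces finite-dimensional convergence to covariances.\<close>

definition centred_gaussian :: "'a measure \<Rightarrow> ('a \<Rightarrow> real) \<Rightarrow> bool" where
  "centred_gaussian M U \<longleftrightarrow> U \<in> borel_measurable M \<and>
     (\<exists>\<sigma>\<ge>0. distr M borel U = distr std_normal_distribution borel (\<lambda>x. \<sigma> * x))"

lemma centred_gaussian_measurable[measurable_dest]:
  "centred_gaussian M U \<Longrightarrow> U \<in> borel_measurable M"
  by (simp add: centred_gaussian_def)

text \<open>An affine image of the standard normal law covers the point mass at
  \<open>\<sigma> = 0\<close> and the density case by one formula; \<open>centred_gaussian\<close>
  is built on this form to avoid case distinctions.\<close>

lemma normal_law_eq_distr:
  assumes "0 \<le> \<sigma>"
  shows "normal_law m \<sigma> = distr std_normal_distribution borel (\<lambda>x. m + \<sigma> * x)"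
proof (cases "\<sigma> = 0")
  case True
  interpret prob_space std_normal_distribution by (rule prob_space_normal_density) simp
  show ?thesis using True by (simp add: normal_law_def distr_const)
next
  case False
  interpret prob_space std_normal_distribution by (rule prob_space_normal_density) simp
  have "distributed std_normal_distribution lborel (\<lambda>x. x) std_normal_density"
    unfolding distributed_def by (auto simp: distr_id2)
  from normal_density_affine[OF this, of \<sigma> m] False assms
  have "distributed std_normal_distribution lborel (\<lambda>x. m + \<sigma> * x) (normal_density m \<sigma>)"
    by simp
  then have "distr std_normal_distribution lborel (\<lambda>x. m + \<sigma> * x) = density lborel (normal_density m \<sigma>)"
    unfolding distributed_def by simp
  moreover have "distr std_normal_distribution lborel (\<lambda>x. m + \<sigma> * x) = distr std_normal_distribution borel (\<lambda>x. m + \<sigma> * x)"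
    by (rule distr_cong) auto
  ultimately show ?thesis using False by (simp add: normal_law_def)
qed

lemma std_normal_distribution_moment:
  "integrable std_normal_distribution (\<lambda>x. x ^ k)"
  "(\<integral>x. x \<partial>std_normal_distribution) = 0"
  "(\<integral>x. x ^ 2 \<partial>std_normal_distribution) = 1"
  "(\<integral>x. x ^ 4 \<partial>std_normal_distribution) = 3"
proof -
  show "integrable std_normal_distribution (\<lambda>x. x ^ k)"
    using integrable_std_normal_moment[of k] by (subst integrable_density) auto
  show "(\<integral>x. x \<partial>std_normal_distribution) = 0"
    using integral_std_normal_moment_odd[of 0] by (subst integral_density) (auto simp: has_bochner_integral_iff)
  show "(\<integral>x. x ^ 2 \<partial>std_normal_distribution) = 1"
    using integral_std_normal_moment_even[of 1] by (subst integral_density) (auto simp: fact_numeral)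
  show "(\<integral>x. x ^ 4 \<partial>std_normal_distribution) = 3"
    using integral_std_normal_moment_even[of 2] by (subst integral_density) (auto simp: fact_numeral)
qed

lemma char_scaled_std_normal:
  "char (distr std_normal_distribution borel (\<lambda>x. \<sigma> * x)) r = complex_of_real (exp (- (r\<^sup>2 * \<sigma>\<^sup>2) / 2))"
proof -
  have "char (distr std_normal_distribution borel (\<lambda>x. \<sigma> * x)) r = (CLINT x|std_normal_distribution. iexp (r * (\<sigma> * x)))"
    unfolding char_def by (rule integral_distr) auto
  also have "\<dots> = char std_normal_distribution (r * \<sigma>)"
    by (simp add: char_def mult.assoc)
  also have "\<dots> = complex_of_real (exp (- (r * \<sigma>)\<^sup>2 / 2))"
    by (simp add: char_std_normal_distribution)
  finally show ?thesis by (simp add: power_mult_distrib)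
qed

context prob_space
begin

lemma centred_gaussian_expectation:
  fixes g :: "real \<Rightarrow> real"
  assumes [measurable]: "U \<in> borel_measurable M"
    and d: "distr M borel U = distr std_normal_distribution borel (\<lambda>x. \<sigma> * x)"
    and [measurable]: "g \<in> borel_measurable borel"
  shows "expectation (\<lambda>\<omega>. g (U \<omega>)) = (\<integral>x. g (\<sigma> * x) \<partial>std_normal_distribution)"
    and "integrable M (\<lambda>\<omega>. g (U \<omega>)) \<longleftrightarrow> integrable std_normal_distribution (\<lambda>x. g (\<sigma> * x))"
proof -
  have "expectation (\<lambda>\<omega>. g (U \<omega>)) = integral\<^sup>L (distr M borel U) g"
    by (simp add: integral_distr)
  also have "\<dots> = (\<integral>x. g (\<sigma> * x) \<partial>std_normal_distribution)"
    unfolding d by (rule integral_distr) auto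
  finally show "expectation (\<lambda>\<omega>. g (U \<omega>)) = (\<integral>x. g (\<sigma> * x) \<partial>std_normal_distribution)" .
  have "integrable M (\<lambda>\<omega>. g (U \<omega>)) \<longleftrightarrow> integrable (distr M borel U) g"
    by (rule integrable_distr_eq[symmetric]) auto
  also have "\<dots> \<longleftrightarrow> integrable std_normal_distribution (\<lambda>x. g (\<sigma> * x))"
    unfolding d by (rule integrable_distr_eq) auto
  finally show "integrable M (\<lambda>\<omega>. g (U \<omega>)) \<longleftrightarrow> integrable std_normal_distribution (\<lambda>x. g (\<sigma> * x))" .
qed

text \<open>The fourth moment is what chaining consumes: a variance linear in the length of a time
  interval becomes a fourth moment quadratic in it.\<close>

lemma centred_gaussian_moments:
  assumes "centred_gaussian M U"
  shows "integrable M U" "expectation U = 0" "integrable M (\<lambda>\<omega>. (U \<omega>)\<^sup>2)" "integrable M (\<lambda>\<omega>. (U \<omega>) ^ 4)"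
    "expectation (\<lambda>\<omega>. (U \<omega>) ^ 4) = 3 * (expectation (\<lambda>\<omega>. (U \<omega>)\<^sup>2))\<^sup>2"
proof -
  from assms obtain \<sigma> where [measurable]: "U \<in> borel_measurable M"
    and d: "distr M borel U = distr std_normal_distribution borel (\<lambda>x. \<sigma> * x)"
    by (auto simp: centred_gaussian_def)
  have e: "expectation (\<lambda>\<omega>. g (U \<omega>)) = (\<integral>x. g (\<sigma> * x) \<partial>std_normal_distribution)"
    "integrable M (\<lambda>\<omega>. g (U \<omega>)) \<longleftrightarrow> integrable std_normal_distribution (\<lambda>x. g (\<sigma> * x))"
    if "g \<in> borel_measurable borel" for g :: "real \<Rightarrow> real"
    using centred_gaussian_expectation[OF _ d that] by simp_all
  show "integrable M U" using e(2)[of "\<lambda>x. x"] std_normal_distribution_moment(1)[of 1] by simp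
  show "expectation U = 0" using e(1)[of "\<lambda>x. x"] std_normal_distribution_moment(2) by simp
  show "integrable M (\<lambda>\<omega>. (U \<omega>)\<^sup>2)"
    using e(2)[of "\<lambda>x. x\<^sup>2"] std_normal_distribution_moment(1)[of 2] by (simp add: power_mult_distrib)
  show "integrable M (\<lambda>\<omega>. (U \<omega>) ^ 4)"
    using e(2)[of "\<lambda>x. x^4"] std_normal_distribution_moment(1)[of 4] by (simp add: power_mult_distrib)
  have "expectation (\<lambda>\<omega>. (U \<omega>)\<^sup>2) = \<sigma>\<^sup>2"
    using e(1)[of "\<lambda>x. x\<^sup>2"] std_normal_distribution_moment(3) by (simp add: power_mult_distrib)
  moreover have "expectation (\<lambda>\<omega>. (U \<omega>)^4) = 3 * \<sigma>^4"
    using e(1)[of "\<lambda>x. x^4"] std_normal_distribution_moment(4) by (simp add: power_mult_distrib)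
  ultimately show "expectation (\<lambda>\<omega>. (U \<omega>) ^ 4) = 3 * (expectation (\<lambda>\<omega>. (U \<omega>)\<^sup>2))\<^sup>2"
    by (simp add: power_mult[symmetric])
qed

lemma centred_gaussian_char:
  assumes "centred_gaussian M U"
  shows "char (distr M borel U) r = complex_of_real (exp (- (r\<^sup>2 * expectation (\<lambda>\<omega>. (U \<omega>)\<^sup>2)) / 2))"
proof -
  from assms obtain \<sigma> where [measurable]: "U \<in> borel_measurable M"
    and d: "distr M borel U = distr std_normal_distribution borel (\<lambda>x. \<sigma> * x)"
    by (auto simp: centred_gaussian_def)
  have e: "expectation (\<lambda>\<omega>. g (U \<omega>)) = (\<integral>x. g (\<sigma> * x) \<partial>std_normal_distribution)"
    if "g \<in> borel_measurable borel" for g :: "real \<Rightarrow> real"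
    using centred_gaussian_expectation(1)[OF _ d that] by simp
  have "expectation (\<lambda>\<omega>. (U \<omega>)\<^sup>2) = \<sigma>\<^sup>2"
    using e[of "\<lambda>x. x\<^sup>2"] std_normal_distribution_moment(3) by (simp add: power_mult_distrib)
  then show ?thesis by (simp add: d char_scaled_std_normal)
qed

text \<open>Levy's uniqueness theorem turns a formula for the characteristic function into
  Gaussianity. It serves twice, for L2 limits and for sums of independent Brownian
  increments.\<close>

lemma centred_gaussianI_char:
  assumes [measurable]: "U \<in> borel_measurable M" and "0 \<le> s"
    and "\<And>r. char (distr M borel U) r = complex_of_real (exp (- (r\<^sup>2 * s) / 2))"
  shows "centred_gaussian M U"
proof -
  have "real_distribution (distr std_normal_distribution borel (\<lambda>x. sqrt s * x))"
    by (intro real_distribution.intro real_distribution_axioms.intro prob_space.prob_space_distr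
        prob_space_normal_density) auto
  moreover have "real_distribution (distr M borel U)" by simp
  ultimately have "distr M borel U = distr std_normal_distribution borel (\<lambda>x. sqrt s * x)"
    using assms by (intro Levy_uniqueness) (auto simp: fun_eq_iff char_scaled_std_normal)
  then show ?thesis unfolding centred_gaussian_def using assms
    by (auto intro!: exI[of _ "sqrt s"])
qed

text \<open>The shift in an affine image of a standard normal variable is its expectation, so a
  vanishing expectation leaves a pure scaling.\<close>

lemma gaussian_rv_centred:
  assumes "gaussian_rv M U" and "expectation U = 0"
  shows "centred_gaussian M U"
proof -
  interpret std: prob_space std_normal_distribution by (rule prob_space_normal_density) simp
  from assms obtain m \<sigma> where [measurable]: "U \<in> borel_measurable M"
    and "0 \<le> \<sigma>" and "distr M borel U = normal_law m \<sigma>" by (auto simp: gaussian_rv_def)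
  then have d: "distr M borel U = distr std_normal_distribution borel (\<lambda>x. m + \<sigma> * x)"
    using normal_law_eq_distr by simp
  have "expectation U = (\<integral>x. x \<partial>(distr M borel U))" by (simp add: integral_distr)
  also have "\<dots> = (\<integral>x. m + \<sigma> * x \<partial>std_normal_distribution)" by (simp add: d integral_distr)
  also have "\<dots> = m"
    using std_normal_distribution_moment(1)[of 1] std_normal_distribution_moment(2)
    by (subst Bochner_Integration.integral_add)
      (use std.prob_space in auto)
  finally have "m = 0" using assms by simp
  with d \<open>0 \<le> \<sigma>\<close> show ?thesis unfolding centred_gaussian_def by auto
qed

section \<open>Second-moment inequalities and L2 closure\<close>

lemma abs_expectation_le_sqrt:
  assumes [measurable]: "U \<in> borel_measurable M" and "integrable M (\<lambda>\<omega>. (U \<omega>)\<^sup>2)"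
  shows "integrable M U" "expectation (\<lambda>\<omega>. \<bar>U \<omega>\<bar>) \<le> sqrt (expectation (\<lambda>\<omega>. (U \<omega>)\<^sup>2))"
proof -
  show i: "integrable M U"
    by (rule square_integrable_imp_integrable) (use assms in auto)
  \<comment> \<open>Jensen's inequality for the square, read off from the nonnegative variance of
    \<open>|U|\<close>.\<close>
  have "(expectation (\<lambda>\<omega>. \<bar>U \<omega>\<bar>))\<^sup>2 \<le> expectation (\<lambda>\<omega>. \<bar>U \<omega>\<bar>\<^sup>2)"
    using variance_positive[of "\<lambda>\<omega>. \<bar>U \<omega>\<bar>"] i assms by (simp add: variance_eq)
  then show "expectation (\<lambda>\<omega>. \<bar>U \<omega>\<bar>) \<le> sqrt (expectation (\<lambda>\<omega>. (U \<omega>)\<^sup>2))"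
    by (simp add: real_le_rsqrt)
qed

lemma square_integrable_mult:
  fixes f g :: "'a \<Rightarrow> real"
  assumes [measurable]: "f \<in> borel_measurable M" "g \<in> borel_measurable M"
    and "integrable M (\<lambda>\<omega>. (f \<omega>)\<^sup>2)" "integrable M (\<lambda>\<omega>. (g \<omega>)\<^sup>2)"
  shows "integrable M (\<lambda>\<omega>. f \<omega> * g \<omega>)"
proof (rule Bochner_Integration.integrable_bound)
  show "integrable M (\<lambda>\<omega>. (f \<omega>)\<^sup>2 + (g \<omega>)\<^sup>2)" using assms by simp
  have "\<bar>a * b\<bar> \<le> \<bar>a\<^sup>2 + b\<^sup>2\<bar>" for a b :: real
  proof -
    have "0 \<le> \<bar>a\<bar> * \<bar>b\<bar>" by simp
    moreover have "2 * (\<bar>a\<bar> * \<bar>b\<bar>) \<le> a\<^sup>2 + b\<^sup>2"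
      using sum_squares_bound[of "\<bar>a\<bar>" "\<bar>b\<bar>"] by simp
    ultimately show ?thesis unfolding abs_mult by linarith
  qed
  then show "AE \<omega> in M. norm (f \<omega> * g \<omega>) \<le> norm ((f \<omega>)\<^sup>2 + (g \<omega>)\<^sup>2)" by simp
qed simp

lemma expectation_Cauchy_Schwarz:
  fixes f g :: "'a \<Rightarrow> real"
  assumes m: "f \<in> borel_measurable M" "g \<in> borel_measurable M"
    and i: "integrable M (\<lambda>\<omega>. (f \<omega>)\<^sup>2)" "integrable M (\<lambda>\<omega>. (g \<omega>)\<^sup>2)"
  shows "\<bar>expectation (\<lambda>\<omega>. f \<omega> * g \<omega>)\<bar> \<le> sqrt (expectation (\<lambda>\<omega>. (f \<omega>)\<^sup>2)) * sqrt (expectation (\<lambda>\<omega>. (g \<omega>)\<^sup>2))"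
proof -
  let ?a = "expectation (\<lambda>\<omega>. (f \<omega>)\<^sup>2)" and ?b = "expectation (\<lambda>\<omega>. (g \<omega>)\<^sup>2)"
  let ?c = "expectation (\<lambda>\<omega>. f \<omega> * g \<omega>)"
  note ifg = square_integrable_mult[OF m i]
  have "0 \<le> t\<^sup>2 * ?a - 2 * t * ?c + ?b" for t
  proof -
    have "0 \<le> expectation (\<lambda>\<omega>. (t * f \<omega> - g \<omega>)\<^sup>2)" by simp
    also have "(\<lambda>\<omega>. (t * f \<omega> - g \<omega>)\<^sup>2) = (\<lambda>\<omega>. t\<^sup>2 * (f \<omega>)\<^sup>2 - 2 * t * (f \<omega> * g \<omega>) + (g \<omega>)\<^sup>2)"
      by (auto simp: power2_eq_square algebra_simps)
    also have "expectation \<dots> = t\<^sup>2 * ?a - 2 * t * ?c + ?b" using i ifg by simp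
    finally show ?thesis .
  qed note pos = this
  have nn: "0 \<le> ?a" "0 \<le> ?b" by simp_all
  have "?c\<^sup>2 \<le> ?a * ?b"
  proof (cases "?a = 0")
    case True
    have "?c = 0"
    proof (rule ccontr)
      assume "?c \<noteq> 0"
      \<comment> \<open>For \<open>?a = 0\<close> the polynomial is affine in \<open>t\<close>; at
        this \<open>t\<close> it equals -1.\<close>
      with pos[of "(?b + 1) / (2 * ?c)"] True show False by simp
    qed
    then show ?thesis using True by simp
  next
    case False
    then have "0 < ?a" using nn by linarith
    \<comment> \<open>The polynomial is smallest at \<open>t = ?c / ?a\<close>, which gives the
      sharp inequality.\<close>
    moreover have "(?c / ?a)\<^sup>2 * ?a = ?c\<^sup>2 / ?a" "?c / ?a * ?c = ?c\<^sup>2 / ?a"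
      using False by (simp_all add: power2_eq_square)
    ultimately have "?c\<^sup>2 / ?a \<le> ?b" using pos[of "?c / ?a"] by (simp add: mult.assoc)
    then show ?thesis using \<open>0 < ?a\<close> by (simp add: pos_divide_le_eq mult.commute)
  qed
  then have "sqrt (?c\<^sup>2) \<le> sqrt (?a * ?b)" by (rule real_sqrt_le_mono)
  then show ?thesis by (simp add: real_sqrt_mult)
qed

text \<open>L2 convergence carries the variances along and, since \<open>exp (i r x)\<close> is
  Lipschitz in \<open>x\<close>, also the characteristic functions. The Gaussian formula therefore
  passes to the limit, even if the limit variance is zero.\<close>

lemma centred_gaussian_L2_limit:
  assumes g: "\<And>n. centred_gaussian M (S n)"
    and [measurable]: "U \<in> borel_measurable M" and iU: "integrable M (\<lambda>\<omega>. (U \<omega>)\<^sup>2)"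
    and lim: "(\<lambda>n. expectation (\<lambda>\<omega>. (U \<omega> - S n \<omega>)\<^sup>2)) \<longlonglongrightarrow> 0"
  shows "centred_gaussian M U"
proof (rule centred_gaussianI_char)
  have [measurable]: "S n \<in> borel_measurable M" for n using g by (rule centred_gaussian_measurable)
  have iS: "integrable M (\<lambda>\<omega>. (S n \<omega>)\<^sup>2)" for n using g by (rule centred_gaussian_moments)
  have iUS: "integrable M (\<lambda>\<omega>. U \<omega> * S n \<omega>)" for n
    by (rule square_integrable_mult) (use iU iS in auto)
  have iD: "integrable M (\<lambda>\<omega>. (U \<omega> - S n \<omega>)\<^sup>2)" for n
    using iU iS[of n] iUS[of n] by (simp add: power2_diff mult.assoc)
  let ?d = "\<lambda>n. expectation (\<lambda>\<omega>. (U \<omega> - S n \<omega>)\<^sup>2)"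
  let ?s = "expectation (\<lambda>\<omega>. (U \<omega>)\<^sup>2)"
  show "0 \<le> ?s" by simp
  have iDU: "integrable M (\<lambda>\<omega>. (U \<omega> - S n \<omega>) * U \<omega>)" for n
    by (rule square_integrable_mult) (use iU iD in auto)
  have cross: "(\<lambda>n. expectation (\<lambda>\<omega>. (U \<omega> - S n \<omega>) * U \<omega>)) \<longlonglongrightarrow> 0"
  proof (rule Lim_null_comparison)
    show "\<forall>\<^sub>F n in sequentially. norm (expectation (\<lambda>\<omega>. (U \<omega> - S n \<omega>) * U \<omega>)) \<le> sqrt (?d n) * sqrt ?s"
      using expectation_Cauchy_Schwarz[OF _ _ iD iU] by (intro always_eventually) auto
    show "(\<lambda>n. sqrt (?d n) * sqrt ?s) \<longlonglongrightarrow> 0"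
      by (rule tendsto_mult_left_zero) (use tendsto_real_sqrt[OF lim] in simp)
  qed
  \<comment> \<open>Expand \<open>S n = U - (U - S n)\<close>; both corrections vanish in the
    limit.\<close>
  have "expectation (\<lambda>\<omega>. (S n \<omega>)\<^sup>2) = ?s - 2 * expectation (\<lambda>\<omega>. (U \<omega> - S n \<omega>) * U \<omega>) + ?d n" for n
  proof -
    have "(S n \<omega>)\<^sup>2 = (U \<omega>)\<^sup>2 - 2 * ((U \<omega> - S n \<omega>) * U \<omega>) + (U \<omega> - S n \<omega>)\<^sup>2" for \<omega>
      by (simp add: power2_eq_square algebra_simps)
    then show ?thesis using iU iD[of n] iDU[of n] by simp
  qed
  then have sS: "(\<lambda>n. expectation (\<lambda>\<omega>. (S n \<omega>)\<^sup>2)) \<longlonglongrightarrow> ?s"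
    using tendsto_add[OF tendsto_diff[OF tendsto_const[of ?s] tendsto_mult_left[OF cross, of 2]] lim] by simp
  fix r
  have c1: "(\<lambda>n. char (distr M borel (S n)) r) \<longlonglongrightarrow> complex_of_real (exp (- (r\<^sup>2 * ?s) / 2))"
    unfolding centred_gaussian_char[OF g]
    by (intro tendsto_of_real tendsto_exp tendsto_divide tendsto_minus tendsto_mult sS) auto
  have "(\<lambda>n. char (distr M borel (S n)) r - char (distr M borel U) r) \<longlonglongrightarrow> 0"
  proof (rule Lim_null_comparison)
    show "\<forall>\<^sub>F n in sequentially. norm (char (distr M borel (S n)) r - char (distr M borel U) r) \<le> \<bar>r\<bar> * sqrt (?d n)"
    proof (intro always_eventually allI)
      fix n
      have ie: "integrable M (\<lambda>\<omega>. iexp (r * V \<omega>))" if [measurable]: "V \<in> borel_measurable M" for V :: "'a \<Rightarrow> real"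
        by (rule integrable_iexp) auto
      have "char (distr M borel (S n)) r - char (distr M borel U) r =
          (CLINT \<omega>|M. iexp (r * S n \<omega>)) - (CLINT \<omega>|M. iexp (r * U \<omega>))"
        unfolding char_def by (simp add: integral_distr)
      also have "\<dots> = (CLINT \<omega>|M. iexp (r * S n \<omega>) - iexp (r * U \<omega>))"
        by (rule Bochner_Integration.integral_diff[symmetric]; rule ie) auto
      also have "norm \<dots> \<le> (LINT \<omega>|M. \<bar>r\<bar> * \<bar>U \<omega> - S n \<omega>\<bar>)"
      proof (rule order_trans[OF integral_norm_bound integral_mono])
        show "integrable M (\<lambda>\<omega>. norm (iexp (r * S n \<omega>) - iexp (r * U \<omega>)))"
          by (intro integrable_norm Bochner_Integration.integrable_diff ie) auto
        show "integrable M (\<lambda>\<omega>. \<bar>r\<bar> * \<bar>U \<omega> - S n \<omega>\<bar>)"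
          using abs_expectation_le_sqrt(1)[OF _ iD[of n]] by auto
        fix \<omega>
        have "iexp (r * S n \<omega>) - iexp (r * U \<omega>) = iexp (r * U \<omega>) * (iexp (r * (S n \<omega> - U \<omega>)) - 1)"
          by (simp add: algebra_simps exp_add[symmetric])
        then have "cmod (iexp (r * S n \<omega>) - iexp (r * U \<omega>)) = cmod (iexp (r * (S n \<omega> - U \<omega>)) - 1)"
          by (simp add: norm_mult)
        also have "\<dots> \<le> \<bar>r * (S n \<omega> - U \<omega>)\<bar>"
          using iexp_approx1[of "r * (S n \<omega> - U \<omega>)" 0] by simp
        finally show "cmod (iexp (r * S n \<omega>) - iexp (r * U \<omega>)) \<le> \<bar>r\<bar> * \<bar>U \<omega> - S n \<omega>\<bar>"
          by (simp add: abs_mult abs_minus_commute)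
      qed
      also have "\<dots> \<le> \<bar>r\<bar> * sqrt (?d n)"
        using abs_expectation_le_sqrt(2)[OF _ iD[of n]] by (auto intro!: mult_left_mono)
      finally show "norm (char (distr M borel (S n)) r - char (distr M borel U) r) \<le> \<bar>r\<bar> * sqrt (?d n)" .
    qed
    show "(\<lambda>n. \<bar>r\<bar> * sqrt (?d n)) \<longlonglongrightarrow> 0"
      by (rule tendsto_mult_right_zero) (use tendsto_real_sqrt[OF lim] in simp)
  qed
  then have "(\<lambda>n. char (distr M borel (S n)) r) \<longlonglongrightarrow> char (distr M borel U) r"
    by (rule LIM_zero_cancel)
  from LIMSEQ_unique[OF this c1]
  show "char (distr M borel U) r = complex_of_real (exp (- (r\<^sup>2 * ?s) / 2))" .
qed simp

end

section \<open>Convergence of Gaussian families\<close>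

text \<open>Trigonometric polynomials in the coordinates in \<open>J\<close>; the phase
  \<open>d\<close> brings in sines. Their expectation under a centred Gaussian law is an explicit
  function of the covariance, and they form an algebra, as Stone-Weierstrass requires.\<close>

inductive_set trig_sums :: "'i set \<Rightarrow> (('i \<Rightarrow> real) \<Rightarrow> real) set" for J where
  cos: "(\<lambda>x. cos ((\<Sum>i\<in>J. c i * x i) + d)) \<in> trig_sums J"
| add: "f \<in> trig_sums J \<Longrightarrow> g \<in> trig_sums J \<Longrightarrow> (\<lambda>x. f x + g x) \<in> trig_sums J"
| scale: "f \<in> trig_sums J \<Longrightarrow> (\<lambda>x. k * f x) \<in> trig_sums J"

lemma trig_sums_const: "(\<lambda>x. k) \<in> trig_sums J"
  using trig_sums.scale[OF trig_sums.cos[of "\<lambda>_. 0" J 0], of k] by simp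

text \<open>Product-to-sum formula for a pair of cosines, extended by linearity in each factor in
  turn; hence the nested induction.\<close>

lemma trig_sums_mult:
  assumes "f \<in> trig_sums J" "g \<in> trig_sums J"
  shows "(\<lambda>x. f x * g x) \<in> trig_sums J"
  using assms(1)
proof induction
  case (cos c d)
  show ?case using assms(2)
  proof induction
    case (cos c' d')
    have e: "cos ((\<Sum>i\<in>J. c i * x i) + d) * cos ((\<Sum>i\<in>J. c' i * x i) + d') =
        1/2 * cos ((\<Sum>i\<in>J. (c i - c' i) * x i) + (d - d')) + 1/2 * cos ((\<Sum>i\<in>J. (c i + c' i) * x i) + (d + d'))"
      for x :: "'a \<Rightarrow> real"
      proof -
      have "(\<Sum>i\<in>J. (c i - c' i) * x i) + (d - d') = ((\<Sum>i\<in>J. c i * x i) + d) - ((\<Sum>i\<in>J. c' i * x i) + d')"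
        "(\<Sum>i\<in>J. (c i + c' i) * x i) + (d + d') = ((\<Sum>i\<in>J. c i * x i) + d) + ((\<Sum>i\<in>J. c' i * x i) + d')"
        by (simp_all add: sum.distrib sum_subtractf algebra_simps)
      then show ?thesis by (simp only: cos_times_cos) simp
    qed
    show ?case unfolding e
      by (intro trig_sums.add trig_sums.scale trig_sums.cos)
  next
    case (add f g)
    then show ?case by (simp add: distrib_left trig_sums.add)
  next
    case (scale f k)
    then show ?case using trig_sums.scale[OF scale.IH, of k] by (simp add: mult.left_commute)
  qed
next
  case (add f g)
  then show ?case by (simp add: distrib_right trig_sums.add)
next
  case (scale f k)
  then show ?case using trig_sums.scale[OF scale.IH, of k] by (simp add: mult.assoc)
qed

lemma trig_sums_continuous:
  fixes f :: "('i::countable \<Rightarrow> real) \<Rightarrow> real"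
  shows "f \<in> trig_sums J \<Longrightarrow> continuous_on UNIV f"
  by (induction rule: trig_sums.induct)
    (auto intro!: continuous_intros continuous_on_product_coordinates)

lemma trig_sums_bounded: "f \<in> trig_sums J \<Longrightarrow> \<exists>b. \<forall>x. \<bar>f x\<bar> \<le> b"
proof (induction rule: trig_sums.induct)
  case (cos c d)
  show ?case by (auto intro!: exI[of _ 1])
next
  case (add f g)
  then obtain b b' where "\<forall>x. \<bar>f x\<bar> \<le> b" "\<forall>x. \<bar>g x\<bar> \<le> b'" by auto
  then have "\<bar>f x + g x\<bar> \<le> b + b'" for x
    by (metis abs_triangle_ineq add_mono order_trans)
  then show ?case by blast
next
  case (scale f k)
  then obtain b where "\<forall>x. \<bar>f x\<bar> \<le> b" by auto
  then have "\<bar>k * f x\<bar> \<le> \<bar>k\<bar> * b" for x by (simp add: abs_mult mult_left_mono)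
  then show ?case by blast
qed

text \<open>The law is symmetric, so the sine part integrates to zero and the phase survives only as
  the factor \<open>cos d\<close>.\<close>

lemma (in prob_space) centred_gaussian_cos:
  assumes g: "centred_gaussian M U"
  shows "expectation (\<lambda>\<omega>. cos (U \<omega> + d)) = cos d * exp (- expectation (\<lambda>\<omega>. (U \<omega>)\<^sup>2) / 2)"
proof -
  have [measurable]: "U \<in> borel_measurable M" using g by (rule centred_gaussian_measurable)
  have "char (distr M borel U) 1 = (CLINT \<omega>|M. iexp (U \<omega>))"
    unfolding char_def by (simp add: integral_distr)
  then have c: "(CLINT \<omega>|M. iexp (U \<omega>)) = complex_of_real (exp (- expectation (\<lambda>\<omega>. (U \<omega>)\<^sup>2) / 2))"
    using centred_gaussian_char[OF g, of 1] by simp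
  have i: "integrable M (\<lambda>\<omega>. iexp (U \<omega>))" by (rule integrable_iexp) auto
  have "Re (CLINT \<omega>|M. iexp (U \<omega>)) = expectation (\<lambda>\<omega>. cos (U \<omega>))"
    using integral_Re[OF i] by (simp add: Re_exp)
  moreover have "Im (CLINT \<omega>|M. iexp (U \<omega>)) = expectation (\<lambda>\<omega>. sin (U \<omega>))"
    using integral_Im[OF i] by (simp add: Im_exp)
  ultimately have e: "expectation (\<lambda>\<omega>. cos (U \<omega>)) = exp (- expectation (\<lambda>\<omega>. (U \<omega>)\<^sup>2) / 2)"
      "expectation (\<lambda>\<omega>. sin (U \<omega>)) = 0"
    unfolding c by simp_all
  have "integrable M (\<lambda>\<omega>. cos (U \<omega>))" "integrable M (\<lambda>\<omega>. sin (U \<omega>))"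
    by (auto intro!: integrable_const_bound[of _ 1])
  then show ?thesis by (simp add: cos_add e)
qed

lemma (in prob_space) square_integrable_products:
  assumes "finite J" and g: "\<And>c. centred_gaussian M (\<lambda>\<omega>. \<Sum>i\<in>J. c i * A i \<omega>)"
  shows "i \<in> J \<Longrightarrow> centred_gaussian M (A i)"
    and "i \<in> J \<Longrightarrow> j \<in> J \<Longrightarrow> integrable M (\<lambda>\<omega>. A i \<omega> * A j \<omega>)"
    and "expectation (\<lambda>\<omega>. (\<Sum>i\<in>J. c i * A i \<omega>)\<^sup>2) =
      (\<Sum>i\<in>J. \<Sum>j\<in>J. c i * c j * expectation (\<lambda>\<omega>. A i \<omega> * A j \<omega>))"
proof -
  show A: "centred_gaussian M (A i)" if "i \<in> J" for i
  proof -
    have "(\<Sum>j\<in>J. (if j = i then 1 else 0) * A j \<omega>) = A i \<omega>" for \<omega>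
      using \<open>finite J\<close> that by (subst sum.remove[of _ i]) auto
    then show ?thesis using g[of "\<lambda>j. if j = i then 1 else 0"] by simp
  qed
  show i: "integrable M (\<lambda>\<omega>. A i \<omega> * A j \<omega>)" if "i \<in> J" "j \<in> J" for i j
    by (rule square_integrable_mult)
      (use A[OF that(1)] A[OF that(2)] in \<open>auto intro: centred_gaussian_moments centred_gaussian_measurable\<close>)
  have "(\<Sum>i\<in>J. c i * A i \<omega>)\<^sup>2 = (\<Sum>i\<in>J. \<Sum>j\<in>J. c i * c j * (A i \<omega> * A j \<omega>))" for \<omega>
    unfolding power2_eq_square sum_product by (intro sum.cong refl) (simp add: mult_ac)
  then show "expectation (\<lambda>\<omega>. (\<Sum>i\<in>J. c i * A i \<omega>)\<^sup>2) =
      (\<Sum>i\<in>J. \<Sum>j\<in>J. c i * c j * expectation (\<lambda>\<omega>. A i \<omega> * A j \<omega>))"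
    using i by (simp add: Bochner_Integration.integral_sum)
qed

text \<open>Clamping to \<open>[-K, K]\<close> by a continuous function of \<open>sin (\<pi> x / (2 K))\<close> turns Stone--Weierstrass
  on a compact cube into approximation by trigonometric sums on the whole space.\<close>

definition clamp_wave :: "real \<Rightarrow> real \<Rightarrow> real" where
  "clamp_wave K x = K * (2 / pi) * arcsin (sin (pi / (2 * K) * x))"

lemma clamp_wave_id: "0 < K \<Longrightarrow> \<bar>x\<bar> \<le> K \<Longrightarrow> clamp_wave K x = x"
proof -
  assume K: "0 < K" "\<bar>x\<bar> \<le> K"
  have "\<bar>pi / (2 * K) * x\<bar> \<le> pi / 2"
    using K by (simp add: abs_mult field_simps)
  then have "arcsin (sin (pi / (2 * K) * x)) = pi / (2 * K) * x"
    by (intro arcsin_sin) linarith+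
  then show ?thesis using K by (simp add: clamp_wave_def)
qed

text \<open>On the cube \<open>S\<close> of sine values, the algebra \<open>R\<close> consists of
  those continuous functions that become trigonometric sums under
  \<open>s i = sin (a * x i)\<close>. Stone-Weierstrass is applied there to \<open>G\<close>, which
  undoes the substitution by \<open>arcsin\<close>.\<close>

lemma clamp_wave_approx:
  fixes F :: "('i::countable \<Rightarrow> real) \<Rightarrow> real"
  assumes J: "finite J" and F: "continuous_on UNIV F" and "0 < \<eta>"
  shows "\<exists>h\<in>trig_sums J. \<forall>x. (\<forall>i. i \<notin> J \<longrightarrow> x i = 0) \<longrightarrow> \<bar>F (\<lambda>i. clamp_wave K (x i)) - h x\<bar> < \<eta>"
proof -
  \<comment> \<open>Coordinates outside \<open>J\<close> are pinned to 0, because trigonometric sums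
    over \<open>J\<close> cannot separate points that differ only there.\<close>
  define S where "S = Pi\<^sub>E UNIV (\<lambda>i::'i. if i \<in> J then {-1..1::real} else {0})"
  define a where "a = pi / (2 * K)"
  define R where "R = {h. continuous_on S h \<and> (\<lambda>x. h (\<lambda>i. sin (a * x i))) \<in> trig_sums J}"
  define G where "G = (\<lambda>s::'i \<Rightarrow> real. F (\<lambda>i. K * (2 / pi) * arcsin (s i)))"
  have Si: "s i \<in> {-1..1}" if "s \<in> S" for s i
    using that unfolding S_def by (cases "i \<in> J") (auto simp: PiE_iff split: if_splits dest!: spec[of _ i])
  have coord: "continuous_on S (\<lambda>s. s i)" for i
    by (rule continuous_on_subset[OF continuous_on_product_coordinates]) simp
  interpret function_ring_on R S
  proof
    have "compactin (product_topology (\<lambda>i. euclidean) UNIV) S"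
      unfolding S_def by (rule compactin_PiE[THEN iffD2]) auto
    then show "compact S" by (simp add: euclidean_product_topology)
    show "continuous_on S f" if "f \<in> R" for f using that by (simp add: R_def)
    show "(\<lambda>x. f x + g x) \<in> R" if "f \<in> R" "g \<in> R" for f g
      using that by (auto simp: R_def intro!: continuous_intros trig_sums.add)
    show "(\<lambda>x. f x * g x) \<in> R" if "f \<in> R" "g \<in> R" for f g
      using that by (auto simp: R_def intro!: continuous_intros trig_sums_mult)
    show "(\<lambda>_. c) \<in> R" for c by (simp add: R_def trig_sums_const)
    fix x y assume xy: "x \<in> S" "y \<in> S" "x \<noteq> y"
    then obtain i where i: "x i \<noteq> y i" by auto
    have "i \<in> J"
    proof (rule ccontr)
      assume "i \<notin> J"
      then have "x i \<in> {0}" "y i \<in> {0}" using xy(1,2) unfolding S_def PiE_iff by (metis UNIV_I)+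
      then show False using i by simp
    qed
    have "sin (a * x i) = cos ((\<Sum>j\<in>J. (if j = i then - a else 0) * x j) + pi / 2)" for x :: "'i \<Rightarrow> real"
    proof -
      have "(\<Sum>j\<in>J. (if j = i then - a else 0) * x j) = - a * x i"
        using J \<open>i \<in> J\<close> by (subst sum.remove[of _ i]) auto
      then show ?thesis unfolding sin_cos_eq[of "a * x i"] by simp
    qed
    then have "(\<lambda>s. s i) \<in> R" unfolding R_def
      using trig_sums.cos[of "\<lambda>j. if j = i then - a else 0" J "pi / 2"] coord by simp
    then show "\<exists>f\<in>R. f x \<noteq> f y" using i by (intro bexI[of _ "\<lambda>s. s i"]) auto
  qed
  have "continuous_on S G"
    unfolding G_def
  proof (rule continuous_on_compose2[OF F])
    show "continuous_on S (\<lambda>s i. K * (2 / pi) * arcsin (s i))"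
      using Si by (intro continuous_on_coordinatewise_then_product continuous_intros coord) auto
  qed simp
  from Stone_Weierstrass_basic[OF this \<open>0 < \<eta>\<close>] obtain g where
    g: "g \<in> R" "\<And>s. s \<in> S \<Longrightarrow> \<bar>G s - g s\<bar> < \<eta>" by auto
  show ?thesis
  proof (intro bexI[of _ "\<lambda>x. g (\<lambda>i. sin (a * x i))"] allI impI)
    show "(\<lambda>x. g (\<lambda>i. sin (a * x i))) \<in> trig_sums J" using g by (simp add: R_def)
    fix x :: "'i \<Rightarrow> real" assume "\<forall>i. i \<notin> J \<longrightarrow> x i = 0"
    then have "(\<lambda>i. sin (a * x i)) \<in> S" by (auto simp: S_def PiE_iff)
    from g(2)[OF this] show "\<bar>F (\<lambda>i. clamp_wave K (x i)) - g (\<lambda>i. sin (a * x i))\<bar> < \<eta>"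
      by (simp add: G_def clamp_wave_def a_def)
  qed
qed

text \<open>Chebyshev's bound in pointwise form: outside the cube some coordinate exceeds
  \<open>K\<close>, so the weighted sum of squares dominates the maximal oscillation
  \<open>2 * b\<close>; inside the cube nothing changes.\<close>

lemma clamp_wave_error:
  fixes F :: "('i::countable \<Rightarrow> real) \<Rightarrow> real"
  assumes "finite J" "0 < K" and b: "\<And>x. \<bar>F x\<bar> \<le> b" and x: "\<And>i. i \<notin> J \<Longrightarrow> x i = 0"
  shows "\<bar>F x - F (\<lambda>i. clamp_wave K (x i))\<bar> \<le> 2 * b / K\<^sup>2 * (\<Sum>i\<in>J. (x i)\<^sup>2)"
proof (cases "\<forall>i. \<bar>x i\<bar> \<le> K")
  case True
  have "0 \<le> b" using b[of x] abs_ge_zero order_trans by blast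
  moreover have "F x - F (\<lambda>i. clamp_wave K (x i)) = 0"
    using True \<open>0 < K\<close> by (simp add: clamp_wave_id)
  ultimately show ?thesis by (simp add: sum_nonneg)
next
  case False
  then obtain i where i: "K < \<bar>x i\<bar>" by (auto simp: not_le)
  then have "i \<in> J" using x[of i] \<open>0 < K\<close> by force
  have "0 \<le> b" using b[of x] abs_ge_zero order_trans by blast
  have "K\<^sup>2 \<le> \<bar>x i\<bar>\<^sup>2" using i \<open>0 < K\<close> by (intro power_mono) auto
  also have "\<bar>x i\<bar>\<^sup>2 \<le> (\<Sum>i\<in>J. (x i)\<^sup>2)"
    using member_le_sum[of i J "\<lambda>i. (x i)\<^sup>2"] \<open>i \<in> J\<close> \<open>finite J\<close> by simp
  finally have "1 \<le> (\<Sum>i\<in>J. (x i)\<^sup>2) / K\<^sup>2" using \<open>0 < K\<close> by simp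
  from mult_left_mono[OF this, of "2 * b"] \<open>0 \<le> b\<close>
  have "2 * b \<le> 2 * b / K\<^sup>2 * (\<Sum>i\<in>J. (x i)\<^sup>2)" by simp
  moreover have "\<bar>F x - F (\<lambda>i. clamp_wave K (x i))\<bar> \<le> b + b"
    using b by (intro order_trans[OF abs_triangle_ineq4] add_mono)
  ultimately show ?thesis by linarith
qed

text \<open>Only covariances have to converge: they determine the limit for trigonometric sums, and
  through the second moments they control the region outside a large cube, where the approximation
  of \<open>F\<close> fails. Since no densities appear, the limit covariance may be
  degenerate.\<close>

theorem gaussian_family_converges:
  fixes A :: "'e \<Rightarrow> 'i::countable \<Rightarrow> 'a \<Rightarrow> real" and B :: "'i \<Rightarrow> 'b \<Rightarrow> real"
    and F :: "('i \<Rightarrow> real) \<Rightarrow> real"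
  assumes "prob_space M" "prob_space N" and J: "finite J"
    and gA: "\<And>e c. centred_gaussian M (\<lambda>\<omega>. \<Sum>i\<in>J. c i * A e i \<omega>)"
    and gB: "\<And>c. centred_gaussian N (\<lambda>\<omega>. \<Sum>i\<in>J. c i * B i \<omega>)"
    and zA: "\<And>e i \<omega>. i \<notin> J \<Longrightarrow> A e i \<omega> = 0" and zB: "\<And>i \<omega>. i \<notin> J \<Longrightarrow> B i \<omega> = 0"
    and cov: "\<And>i j. i \<in> J \<Longrightarrow> j \<in> J \<Longrightarrow>
       ((\<lambda>e. LINT \<omega>|M. A e i \<omega> * A e j \<omega>) \<longlongrightarrow> (LINT \<omega>|N. B i \<omega> * B j \<omega>)) \<F>"
    and F: "continuous_on UNIV F" and b: "\<And>x. \<bar>F x\<bar> \<le> b"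
  shows "((\<lambda>e. LINT \<omega>|M. F (\<lambda>i. A e i \<omega>)) \<longlongrightarrow> (LINT \<omega>|N. F (\<lambda>i. B i \<omega>))) \<F>"
proof (rule tendstoI)
  fix \<eta> :: real assume "0 < \<eta>"
  interpret M: prob_space M by fact
  interpret N: prob_space N by fact
  note A = M.square_integrable_products[OF J gA]
  note B = N.square_integrable_products[OF J gB]
  have [measurable]: "A e i \<in> borel_measurable M" for e i
    using A(1)[of i e] zA[of i] by (cases "i \<in> J") (auto dest: centred_gaussian_measurable cong: measurable_cong)
  have [measurable]: "B i \<in> borel_measurable N" for i
    using B(1)[of i] zB[of i] by (cases "i \<in> J") (auto dest: centred_gaussian_measurable cong: measurable_cong)
  have vA[measurable]: "(\<lambda>\<omega> i. A e i \<omega>) \<in> borel_measurable M" for e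
    by (rule measurable_coordinatewise_then_product) simp
  have vB[measurable]: "(\<lambda>\<omega> i. B i \<omega>) \<in> borel_measurable N"
    by (rule measurable_coordinatewise_then_product) simp
  have "0 \<le> b" using b[of undefined] abs_ge_zero order_trans by blast
  \<comment> \<open>Strictly above the limiting second moment, so that the second moments along the
    family are eventually below \<open>V\<close> as well.\<close>
  define V where "V = (\<Sum>i\<in>J. LINT \<omega>|N. B i \<omega> * B i \<omega>) + 1"
  have "0 \<le> (\<Sum>i\<in>J. LINT \<omega>|N. B i \<omega> * B i \<omega>)" by (intro sum_nonneg) simp
  then have "0 < V" by (simp add: V_def)
  \<comment> \<open>Chosen to make both tail terms at most \<open>\<eta> / 8\<close>; adding 1 keeps
    \<open>K\<close> positive when \<open>b = 0\<close>.\<close>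
  define K where "K = sqrt (16 * b * V / \<eta>) + 1"
  have "0 < K" using \<open>0 \<le> b\<close> \<open>0 < V\<close> \<open>0 < \<eta>\<close> by (simp add: K_def add_nonneg_pos)
  have "(sqrt (16 * b * V / \<eta>))\<^sup>2 \<le> K\<^sup>2"
    unfolding K_def using \<open>0 \<le> b\<close> \<open>0 < V\<close> \<open>0 < \<eta>\<close> by (intro power_mono) auto
  then have "16 * b * V / \<eta> \<le> K\<^sup>2" using \<open>0 \<le> b\<close> \<open>0 < V\<close> \<open>0 < \<eta>\<close> by simp
  then have KV: "2 * b / K\<^sup>2 * V \<le> \<eta> / 8" using \<open>0 < K\<close> \<open>0 < \<eta>\<close> by (simp add: field_simps)
  obtain h where h: "h \<in> trig_sums J"
    and hF: "\<And>x. (\<And>i. i \<notin> J \<Longrightarrow> x i = 0) \<Longrightarrow> \<bar>F (\<lambda>i. clamp_wave K (x i)) - h x\<bar> < \<eta> / 8"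
    using clamp_wave_approx[OF J F, of "\<eta> / 8" K] \<open>0 < \<eta>\<close> by auto
  obtain bh where bh: "\<And>x. \<bar>h x\<bar> \<le> bh" using trig_sums_bounded[OF h] by auto
  have [measurable]: "F \<in> borel_measurable borel" "h \<in> borel_measurable borel"
    using F trig_sums_continuous[OF h] by (auto intro: borel_measurable_continuous_onI)
  have bound: "\<bar>F x - h x\<bar> \<le> \<eta> / 8 + 2 * b / K\<^sup>2 * (\<Sum>i\<in>J. x i * x i)"
    if "\<And>i. i \<notin> J \<Longrightarrow> x i = 0" for x
  proof -
    have "\<bar>F (\<lambda>i. clamp_wave K (x i)) - h x\<bar> < \<eta> / 8" by (rule hF) (rule that)
    moreover have "\<bar>F x - F (\<lambda>i. clamp_wave K (x i))\<bar> \<le> 2 * b / K\<^sup>2 * (\<Sum>i\<in>J. (x i)\<^sup>2)"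
      by (rule clamp_wave_error[OF J \<open>0 < K\<close> b that])
    ultimately show ?thesis unfolding power2_eq_square by linarith
  qed
  have EA: "\<bar>(LINT \<omega>|M. F (\<lambda>i. A e i \<omega>)) - (LINT \<omega>|M. h (\<lambda>i. A e i \<omega>))\<bar> \<le>
      \<eta> / 8 + 2 * b / K\<^sup>2 * (\<Sum>i\<in>J. LINT \<omega>|M. A e i \<omega> * A e i \<omega>)" for e
  proof -
    have i: "integrable M (\<lambda>\<omega>. F (\<lambda>i. A e i \<omega>))" "integrable M (\<lambda>\<omega>. h (\<lambda>i. A e i \<omega>))"
      by (auto intro!: M.integrable_const_bound[of _ "max b bh"] simp: b bh le_max_iff_disj)
    have i2: "integrable M (\<lambda>\<omega>. \<Sum>i\<in>J. A e i \<omega> * A e i \<omega>)" using A(2) by auto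
    have "(LINT \<omega>|M. F (\<lambda>i. A e i \<omega>)) - (LINT \<omega>|M. h (\<lambda>i. A e i \<omega>)) =
        (LINT \<omega>|M. F (\<lambda>i. A e i \<omega>) - h (\<lambda>i. A e i \<omega>))" using i by simp
    also have "\<bar>\<dots>\<bar> \<le> (LINT \<omega>|M. \<bar>F (\<lambda>i. A e i \<omega>) - h (\<lambda>i. A e i \<omega>)\<bar>)"
      by (rule integral_abs_bound)
    also have "\<dots> \<le> (LINT \<omega>|M. \<eta> / 8 + 2 * b / K\<^sup>2 * (\<Sum>i\<in>J. A e i \<omega> * A e i \<omega>))"
      using i i2 zA by (intro integral_mono bound) auto
    also have "\<dots> = \<eta> / 8 + 2 * b / K\<^sup>2 * (\<Sum>i\<in>J. LINT \<omega>|M. A e i \<omega> * A e i \<omega>)"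
      using i2 A(2) by (simp add: M.prob_space Bochner_Integration.integral_sum)
    finally show ?thesis .
  qed
  have EB: "\<bar>(LINT \<omega>|N. F (\<lambda>i. B i \<omega>)) - (LINT \<omega>|N. h (\<lambda>i. B i \<omega>))\<bar> \<le>
      \<eta> / 8 + 2 * b / K\<^sup>2 * (\<Sum>i\<in>J. LINT \<omega>|N. B i \<omega> * B i \<omega>)"
  proof -
    have i: "integrable N (\<lambda>\<omega>. F (\<lambda>i. B i \<omega>))" "integrable N (\<lambda>\<omega>. h (\<lambda>i. B i \<omega>))"
      by (auto intro!: N.integrable_const_bound[of _ "max b bh"] simp: b bh le_max_iff_disj)
    have i2: "integrable N (\<lambda>\<omega>. \<Sum>i\<in>J. B i \<omega> * B i \<omega>)" using B(2) by auto
    have "(LINT \<omega>|N. F (\<lambda>i. B i \<omega>)) - (LINT \<omega>|N. h (\<lambda>i. B i \<omega>)) =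
        (LINT \<omega>|N. F (\<lambda>i. B i \<omega>) - h (\<lambda>i. B i \<omega>))" using i by simp
    also have "\<bar>\<dots>\<bar> \<le> (LINT \<omega>|N. \<bar>F (\<lambda>i. B i \<omega>) - h (\<lambda>i. B i \<omega>)\<bar>)"
      by (rule integral_abs_bound)
    also have "\<dots> \<le> (LINT \<omega>|N. \<eta> / 8 + 2 * b / K\<^sup>2 * (\<Sum>i\<in>J. B i \<omega> * B i \<omega>))"
      using i i2 zB by (intro integral_mono bound) auto
    also have "\<dots> = \<eta> / 8 + 2 * b / K\<^sup>2 * (\<Sum>i\<in>J. LINT \<omega>|N. B i \<omega> * B i \<omega>)"
      using i2 B(2) by (simp add: N.prob_space Bochner_Integration.integral_sum)
    finally show ?thesis .
  qed
  have lim: "((\<lambda>e. LINT \<omega>|M. g (\<lambda>i. A e i \<omega>)) \<longlongrightarrow> (LINT \<omega>|N. g (\<lambda>i. B i \<omega>))) \<F>"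
    if "g \<in> trig_sums J" for g
    using that
  proof induction
    case (cos c d)
    show ?case
      unfolding M.centred_gaussian_cos[OF gA] N.centred_gaussian_cos[OF gB] A(3) B(3)
      by (intro tendsto_intros cov) auto
  next
    case (add f g)
    have i: "integrable M (\<lambda>\<omega>. f (\<lambda>i. A e i \<omega>)) \<and> integrable N (\<lambda>\<omega>. f (\<lambda>i. B i \<omega>))"
      if f: "f \<in> trig_sums J" for f e
    proof -
      have [measurable]: "f \<in> borel_measurable borel"
        using trig_sums_continuous[OF f] by (auto intro: borel_measurable_continuous_onI)
      obtain bf where "\<And>x. \<bar>f x\<bar> \<le> bf" using trig_sums_bounded[OF f] by auto
      then show ?thesis by (auto intro!: M.integrable_const_bound[of _ bf] N.integrable_const_bound[of _ bf])
    qed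
    show ?case using i[OF add(1)] i[OF add(2)] add(3,4) by (simp add: tendsto_add)
  next
    case (scale f k)
    then show ?case by (simp add: tendsto_mult_left)
  qed
  have "((\<lambda>e. \<Sum>i\<in>J. LINT \<omega>|M. A e i \<omega> * A e i \<omega>) \<longlongrightarrow> (\<Sum>i\<in>J. LINT \<omega>|N. B i \<omega> * B i \<omega>)) \<F>"
    by (intro tendsto_sum cov)
  then have "\<forall>\<^sub>F e in \<F>. (\<Sum>i\<in>J. LINT \<omega>|M. A e i \<omega> * A e i \<omega>) < V"
    by (rule order_tendstoD) (simp add: V_def)
  moreover have "\<forall>\<^sub>F e in \<F>. dist (LINT \<omega>|M. h (\<lambda>i. A e i \<omega>)) (LINT \<omega>|N. h (\<lambda>i. B i \<omega>)) < \<eta> / 8"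
    using lim[OF h] \<open>0 < \<eta>\<close> by (intro tendstoD) auto
  ultimately show "\<forall>\<^sub>F e in \<F>. dist (LINT \<omega>|M. F (\<lambda>i. A e i \<omega>)) (LINT \<omega>|N. F (\<lambda>i. B i \<omega>)) < \<eta>"
  proof eventually_elim
    case (elim e)
    have "2 * b / K\<^sup>2 * (\<Sum>i\<in>J. LINT \<omega>|M. A e i \<omega> * A e i \<omega>) \<le> 2 * b / K\<^sup>2 * V"
      using elim(1) \<open>0 \<le> b\<close> by (intro mult_left_mono) auto
    moreover have "2 * b / K\<^sup>2 * (\<Sum>i\<in>J. LINT \<omega>|N. B i \<omega> * B i \<omega>) \<le> 2 * b / K\<^sup>2 * V"
      using \<open>0 \<le> b\<close> by (intro mult_left_mono) (auto simp: V_def)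
    \<comment> \<open>Two errors of at most \<open>\<eta> / 4\<close> and one below
      \<open>\<eta> / 8\<close>.\<close>
    ultimately show ?case using EA[of e] EB KV elim(2) \<open>0 < \<eta>\<close> unfolding dist_real_def by linarith
  qed
qed

section \<open>Convergence in law of continuous processes\<close>

definition paths :: "(real \<Rightarrow> 'b::real_normed_vector) set" where
  "paths = {f. continuous_on {0..} f}"

text \<open>A metric for locally uniform convergence: \<open>path_dist f g < 1 / (1 + T)\<close> forces \<open>f\<close> and \<open>g\<close> to be
  uniformly that close on \<open>[0, T]\<close>.\<close>

definition path_dist :: "(real \<Rightarrow> 'b::real_normed_vector) \<Rightarrow> (real \<Rightarrow> 'b) \<Rightarrow> real" where
  "path_dist f g = (SUP t\<in>{0..}. min (norm (f t - g t)) (1 / (1 + t)))"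

text \<open>Vector-valued, so that convergence can be proved for the rotated process itself before
  \<open>H\<close> is applied; phrased by a metric because Lipschitz regularisation needs
  one.\<close>

definition path_functional :: "((real \<Rightarrow> 'b::real_normed_vector) \<Rightarrow> real) \<Rightarrow> bool" where
  "path_functional \<Psi> \<longleftrightarrow> (\<exists>b. \<forall>f\<in>paths. \<bar>\<Psi> f\<bar> \<le> b) \<and>
     (\<forall>f\<in>paths. \<forall>e>0. \<exists>\<delta>>0. \<forall>g\<in>paths. path_dist f g < \<delta> \<longrightarrow> \<bar>\<Psi> g - \<Psi> f\<bar> < e)"

lemma path_dist_bdd: "bdd_above ((\<lambda>t. min (norm (f t - g t)) (1 / (1 + t))) ` {0..})"
  by (rule bdd_aboveI[of _ 1]) (auto simp: min_le_iff_disj)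

lemma path_dist_upper: "0 \<le> t \<Longrightarrow> min (norm (f t - g t)) (1 / (1 + t)) \<le> path_dist f g"
  unfolding path_dist_def by (rule cSUP_upper[OF _ path_dist_bdd]) simp

lemma path_dist_least:
  "(\<And>t. 0 \<le> t \<Longrightarrow> min (norm (f t - g t)) (1 / (1 + t)) \<le> c) \<Longrightarrow> path_dist f g \<le> c"
  unfolding path_dist_def by (rule cSUP_least) auto

lemma path_dist_nonneg: "0 \<le> path_dist f g"
  using path_dist_upper[of 0 f g] by (rule order_trans[rotated]) (simp_all add: min_def)

lemma path_dist_self [simp]: "path_dist f f = 0"
  by (rule antisym[OF path_dist_least path_dist_nonneg]) simp

lemma path_dist_commute: "path_dist f g = path_dist g f"
  unfolding path_dist_def by (simp add: norm_minus_commute)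

lemma path_dist_triangle: "path_dist f h \<le> path_dist f g + path_dist g h"
proof (rule path_dist_least)
  fix t :: real assume t: "0 \<le> t"
  have "norm (f t - h t) \<le> norm (f t - g t) + norm (g t - h t)"
    by (rule norm_diff_triangle_ineq[of "f t" "g t" "g t" "h t", simplified])
  moreover have "0 \<le> norm (f t - g t)" "0 \<le> norm (g t - h t)" "0 \<le> 1 / (1 + t)" using t by auto
  ultimately have "min (norm (f t - h t)) (1 / (1 + t)) \<le>
      min (norm (f t - g t)) (1 / (1 + t)) + min (norm (g t - h t)) (1 / (1 + t))"
    by linarith
  also have "\<dots> \<le> path_dist f g + path_dist g h"
    using t by (intro add_mono path_dist_upper)
  finally show "min (norm (f t - h t)) (1 / (1 + t)) \<le> path_dist f g + path_dist g h" .
qed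

text \<open>The weight \<open>1 / (1 + t)\<close> caps whatever happens after time
  \<open>T\<close>.\<close>

lemma path_dist_le_uniform:
  assumes "0 \<le> T" "0 \<le> c" and "\<And>t. 0 \<le> t \<Longrightarrow> t \<le> T \<Longrightarrow> norm (f t - g t) \<le> c"
  shows "path_dist f g \<le> c + 1 / (1 + T)"
proof (rule path_dist_least)
  fix t :: real assume t: "0 \<le> t"
  show "min (norm (f t - g t)) (1 / (1 + t)) \<le> c + 1 / (1 + T)"
  proof (cases "t \<le> T")
    case True
    then show ?thesis using assms(3)[OF t] assms(1) by (simp add: min.coboundedI1 add_increasing2)
  next
    case False
    then have "1 / (1 + t) \<le> 1 / (1 + T)" using assms(1) by (intro divide_left_mono) auto
    then show ?thesis using assms(2) by (simp add: min.coboundedI2 add_increasing)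
  qed
qed

lemma path_dist_lessD:
  assumes "path_dist f g < min \<delta> (1 / (1 + T))" "0 \<le> t" "t \<le> T"
  shows "norm (f t - g t) < \<delta>"
proof -
  have "1 / (1 + T) \<le> 1 / (1 + t)" using assms by (intro divide_left_mono) auto
  moreover have "min (norm (f t - g t)) (1 / (1 + t)) < min \<delta> (1 / (1 + T))"
    using path_dist_upper[of t f g] assms by simp
  ultimately show ?thesis by auto
qed

lemma path_functionalI:
  assumes "\<And>f. f \<in> paths \<Longrightarrow> \<bar>\<Psi> f\<bar> \<le> b"
    and "\<And>f e. f \<in> paths \<Longrightarrow> 0 < e \<Longrightarrow> \<exists>T \<delta>. 0 < \<delta> \<and>
        (\<forall>g\<in>paths. (\<forall>t\<in>{0..T}. norm (g t - f t) < \<delta>) \<longrightarrow> \<bar>\<Psi> g - \<Psi> f\<bar> < e)"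
  shows "path_functional \<Psi>"
  unfolding path_functional_def
proof (intro conjI ballI allI impI)
  show "\<exists>b. \<forall>f\<in>paths. \<bar>\<Psi> f\<bar> \<le> b" using assms(1) by auto
  fix f :: "real \<Rightarrow> 'a" and e :: real assume f: "f \<in> paths" "0 < e"
  from assms(2)[OF this] obtain T \<delta> where "0 < \<delta>"
    and *: "\<And>g. g \<in> paths \<Longrightarrow> (\<forall>t\<in>{0..T}. norm (g t - f t) < \<delta>) \<Longrightarrow> \<bar>\<Psi> g - \<Psi> f\<bar> < e" by auto
  show "\<exists>\<delta>>0. \<forall>g\<in>paths. path_dist f g < \<delta> \<longrightarrow> \<bar>\<Psi> g - \<Psi> f\<bar> < e"
  \<comment> \<open>The cap \<open>1 / (1 + |T|)\<close> makes \<open>path_dist\<close> control all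
    of \<open>[0, T]\<close>; the absolute value covers a negative \<open>T\<close>.\<close>
  proof (intro exI[of _ "min \<delta> (1 / (1 + \<bar>T\<bar>))"] conjI ballI impI)
    show "0 < min \<delta> (1 / (1 + \<bar>T\<bar>))" using \<open>0 < \<delta>\<close> by simp
    fix g :: "real \<Rightarrow> 'a" assume g: "g \<in> paths" "path_dist f g < min \<delta> (1 / (1 + \<bar>T\<bar>))"
    show "\<bar>\<Psi> g - \<Psi> f\<bar> < e"
      using g(1)
    proof (rule *)
      show "\<forall>t\<in>{0..T}. norm (g t - f t) < \<delta>"
        using path_dist_lessD[OF g(2)] by (auto simp: norm_minus_commute)
    qed
  qed
qed

lemma path_functional_tendsto:
  assumes "path_functional \<Psi>" "f \<in> paths" "\<And>n. g n \<in> paths" "(\<lambda>n. path_dist f (g n)) \<longlonglongrightarrow> 0"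
  shows "(\<lambda>n. \<Psi> (g n)) \<longlonglongrightarrow> \<Psi> f"
proof (rule tendstoI)
  fix e :: real assume "0 < e"
  with assms obtain \<delta> where "0 < \<delta>" and *: "\<And>g. g \<in> paths \<Longrightarrow> path_dist f g < \<delta> \<Longrightarrow> \<bar>\<Psi> g - \<Psi> f\<bar> < e"
    unfolding path_functional_def by blast
  have "\<forall>\<^sub>F n in sequentially. path_dist f (g n) < \<delta>"
    using assms(4) \<open>0 < \<delta>\<close> by (rule order_tendstoD)
  then show "\<forall>\<^sub>F n in sequentially. dist (\<Psi> (g n)) (\<Psi> f) < e"
    by eventually_elim (use * assms(3) in \<open>auto simp: dist_real_def\<close>)
qed

lemma path_functional_uminus: "path_functional \<Psi> \<Longrightarrow> path_functional (\<lambda>f. - \<Psi> f)"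
  unfolding path_functional_def by (simp add: abs_minus_commute)

lemma lipschitz_path_functional:
  assumes "\<And>f. f \<in> paths \<Longrightarrow> \<bar>\<Psi> f\<bar> \<le> b" "0 \<le> K"
    and L: "\<And>f g. f \<in> paths \<Longrightarrow> g \<in> paths \<Longrightarrow> \<bar>\<Psi> f - \<Psi> g\<bar> \<le> K * path_dist f g"
  shows "path_functional \<Psi>"
  unfolding path_functional_def
proof (intro conjI ballI allI impI)
  show "\<exists>b. \<forall>f\<in>paths. \<bar>\<Psi> f\<bar> \<le> b" using assms(1) by auto
  fix f :: "real \<Rightarrow> 'a" and e :: real assume f: "f \<in> paths" and "0 < e"
  show "\<exists>\<delta>>0. \<forall>g\<in>paths. path_dist f g < \<delta> \<longrightarrow> \<bar>\<Psi> g - \<Psi> f\<bar> < e"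
  proof (intro exI[of _ "e / (K + 1)"] conjI ballI impI)
    show "0 < e / (K + 1)" using \<open>0 < e\<close> \<open>0 \<le> K\<close> by simp
    fix g :: "real \<Rightarrow> 'a" assume g: "g \<in> paths" "path_dist f g < e / (K + 1)"
    have "\<bar>\<Psi> g - \<Psi> f\<bar> \<le> K * path_dist f g" using L[OF f g(1)] by (simp add: abs_minus_commute)
    also have "\<dots> \<le> (K + 1) * path_dist f g" using path_dist_nonneg[of f g] by (simp add: distrib_right)
    also have "\<dots> < e" using g(2) \<open>0 \<le> K\<close> by (simp add: pos_less_divide_eq mult.commute)
    finally show "\<bar>\<Psi> g - \<Psi> f\<bar> < e" .
  qed
qed

section \<open>Piecewise linear interpolation on dyadic grids\<close>

definition hat :: "real \<Rightarrow> real" where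
  "hat x = max 0 (1 - \<bar>x\<bar>)"

text \<open>The sum of hat functions is cut off at \<open>n 2\<^sup>n\<close>, so it interpolates only on \<open>[0, n]\<close>.\<close>

definition interp_of :: "nat \<Rightarrow> (nat \<Rightarrow> 'b::real_normed_vector) \<Rightarrow> real \<Rightarrow> 'b" where
  "interp_of n x t = (\<Sum>j\<le>n * 2 ^ n. hat (t * 2 ^ n - real j) *\<^sub>R x j)"

definition interp :: "nat \<Rightarrow> (real \<Rightarrow> 'b::real_normed_vector) \<Rightarrow> real \<Rightarrow> 'b" where
  "interp n f = interp_of n (\<lambda>j. f (real j / 2 ^ n))"

lemma hat_nonneg [simp]: "0 \<le> hat x" by (simp add: hat_def)

lemma hat_le_1: "hat x \<le> 1" by (simp add: hat_def)

lemma hat_eq_0: "1 \<le> \<bar>x\<bar> \<Longrightarrow> hat x = 0" by (simp add: hat_def)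

lemma continuous_hat: "continuous_on A hat"
  unfolding hat_def by (intro continuous_intros)

text \<open>Hats centred at the integers form a partition of unity; beyond \<open>N\<close> only the
  last two of them are nonzero.\<close>

lemma sum_hat: "0 \<le> x \<Longrightarrow> x \<le> real N \<Longrightarrow> (\<Sum>j\<le>N. hat (x - real j)) = 1"
proof (induction N)
  case 0
  then show ?case by (simp add: hat_def)
next
  case (Suc N)
  show ?case
  proof (cases "x \<le> real N")
    case True
    then have "hat (x - real (Suc N)) = 0" by (intro hat_eq_0) auto
    then show ?thesis using Suc True by simp
  next
    case False
    have "(\<Sum>j<N. hat (x - real j)) = 0"
      using False by (intro sum.neutral ballI hat_eq_0) auto
    moreover have "hat (x - real N) + hat (x - real (Suc N)) = 1"
      using False Suc.prems by (simp add: hat_def)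
    ultimately show ?thesis by (simp add: lessThan_Suc_atMost[symmetric])
  qed
qed

lemma interp_of_paths: "interp_of n x \<in> paths"
  unfolding paths_def interp_of_def
  by (auto intro!: continuous_intros continuous_on_compose2[OF continuous_hat[of UNIV]])

lemma interp_paths: "interp n f \<in> paths"
  by (simp add: interp_def interp_of_paths)

text \<open>By the partition of unity the error is a convex combination of differences between
  \<open>f t\<close> and the values at grid points less than one mesh away.\<close>

lemma interp_error:
  assumes t: "0 \<le> t" "t \<le> real n"
    and c: "\<And>j. j \<le> n * 2 ^ n \<Longrightarrow> \<bar>t * 2 ^ n - real j\<bar> < 1 \<Longrightarrow> norm (f t - f (real j / 2 ^ n)) \<le> c"
  shows "norm (f t - interp n f t) \<le> c"
proof -
  have s: "(\<Sum>j\<le>n * 2 ^ n. hat (t * 2 ^ n - real j)) = 1"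
    using t by (intro sum_hat) auto
  then have "f t - interp n f t = (\<Sum>j\<le>n * 2 ^ n. hat (t * 2 ^ n - real j) *\<^sub>R (f t - f (real j / 2 ^ n)))"
    unfolding interp_def interp_of_def
    by (simp add: scaleR_diff_right sum_subtractf scaleR_sum_left[symmetric])
  also have "norm \<dots> \<le> (\<Sum>j\<le>n * 2 ^ n. hat (t * 2 ^ n - real j) * c)"
  proof (rule sum_norm_le)
    fix j assume j: "j \<in> {..n * 2 ^ n}"
    show "norm (hat (t * 2 ^ n - real j) *\<^sub>R (f t - f (real j / 2 ^ n))) \<le> hat (t * 2 ^ n - real j) * c"
    proof (cases "\<bar>t * 2 ^ n - real j\<bar> < 1")
      case True
      with c[of j] j show ?thesis by (simp add: mult_left_mono)
    next
      case False
      then show ?thesis by (simp add: hat_eq_0)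
    qed
  qed
  also have "\<dots> = c" using s by (simp add: sum_distrib_right[symmetric])
  finally show ?thesis .
qed

lemma interp_tendsto:
  assumes f: "f \<in> paths"
  shows "(\<lambda>n. path_dist f (interp n f)) \<longlonglongrightarrow> 0"
proof (rule tendstoI)
  fix e :: real assume e: "0 < e"
  obtain T :: nat where T: "2 / e < real T" using reals_Archimedean2 by blast
  have T': "1 / (1 + real T) < e / 2"
  proof -
    have "2 < real T * e" using T e by (simp add: pos_divide_less_eq)
    then have "2 < e * (1 + real T)" using e by (simp add: algebra_simps)
    then show ?thesis by (simp add: pos_divide_less_eq)
  qed
  \<comment> \<open>One unit beyond \<open>T\<close>, since the grid point to the right of
    \<open>t\<close> may exceed \<open>T\<close>.\<close>
  have "uniformly_continuous_on {0..real T + 1} f"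
    using f by (intro compact_uniformly_continuous) (auto simp: paths_def intro: continuous_on_subset)
  then obtain d where d: "0 < d" "\<And>x y. x \<in> {0..real T + 1} \<Longrightarrow> y \<in> {0..real T + 1} \<Longrightarrow> dist y x < d \<Longrightarrow> dist (f y) (f x) < e / 2"
    unfolding uniformly_continuous_on_def using e by (metis half_gt_zero)
  have "(\<lambda>n. (1 / 2) ^ n :: real) \<longlonglongrightarrow> 0" by (rule LIMSEQ_realpow_zero) auto
  then have "\<forall>\<^sub>F n in sequentially. (1 / 2) ^ n < d" using d(1) by (rule order_tendstoD)
  then show "\<forall>\<^sub>F n in sequentially. dist (path_dist f (interp n f)) 0 < e"
    using eventually_ge_at_top[of T]
  proof eventually_elim
    case (elim n)
    have "path_dist f (interp n f) \<le> e / 2 + 1 / (1 + real T)"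
    proof (rule path_dist_le_uniform)
      fix t :: real assume t: "0 \<le> t" "t \<le> real T"
      show "norm (f t - interp n f t) \<le> e / 2"
      proof (rule interp_error)
        show "0 \<le> t" "t \<le> real n" using t elim by auto
        fix j assume j: "j \<le> n * 2 ^ n" "\<bar>t * 2 ^ n - real j\<bar> < 1"
        have "\<bar>t - real j / 2 ^ n\<bar> = \<bar>t * 2 ^ n - real j\<bar> / 2 ^ n"
          by (simp add: diff_divide_distrib[symmetric] abs_divide[symmetric] diff_divide_eq_iff)
        also have "\<dots> < (1 / 2) ^ n" using j(2) by (simp add: field_simps power_divide)
        finally have a: "\<bar>t - real j / 2 ^ n\<bar> < (1 / 2) ^ n" .
        moreover have "(1 / 2 :: real) ^ n \<le> 1" by (simp add: power_le_one)
        ultimately have "real j / 2 ^ n \<in> {0..real T + 1}" using t by auto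
        then have "dist (f t) (f (real j / 2 ^ n)) < e / 2"
          using t a elim(1) by (intro d(2)) (auto simp: dist_real_def)
        then show "norm (f t - f (real j / 2 ^ n)) \<le> e / 2" by (simp add: dist_norm)
      qed
    qed (use e in auto)
    then show ?case using T' path_dist_nonneg[of f "interp n f"] by (simp add: dist_real_def)
  qed
qed

text \<open>Turns a functional of the path into a continuous function of grid values, the form that
  \<open>gaussian_family_converges\<close> takes. Each hat is at most 1, so \<open>path_dist\<close>
  is bounded by a finite sum of coordinate errors.\<close>

lemma interp_functional_continuous:
  fixes \<Psi> :: "(real \<Rightarrow> 'b::real_normed_vector) \<Rightarrow> real"
  assumes "path_functional \<Psi>"
  shows "continuous_on UNIV (\<lambda>x. \<Psi> (interp_of n x))"
proof (rule continuous_on_sequentiallyI)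
  fix u :: "nat \<Rightarrow> nat \<Rightarrow> 'b" and a :: "nat \<Rightarrow> 'b" assume u: "u \<longlonglongrightarrow> a"
  have uj: "(\<lambda>m. u m j) \<longlonglongrightarrow> a j" for j
    using continuous_on_tendsto_compose[OF continuous_on_product_coordinates u] by simp
  have uz: "(\<lambda>m. norm (a j - u m j)) \<longlonglongrightarrow> 0" for j
    using tendsto_norm[OF tendsto_diff[OF tendsto_const[of "a j"] uj[of j]]] by simp
  let ?s = "\<lambda>m. \<Sum>j\<le>n * 2 ^ n. norm (a j - u m j)"
  have "(\<lambda>m. path_dist (interp_of n a) (interp_of n (u m))) \<longlonglongrightarrow> 0"
  proof (rule Lim_null_comparison)
    show "?s \<longlonglongrightarrow> 0"
      by (rule tendsto_null_sum) (rule uz)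
    have "path_dist (interp_of n a) (interp_of n (u m)) \<le> ?s m" for m
    proof (rule path_dist_least)
      fix t :: real
      have "interp_of n a t - interp_of n (u m) t = (\<Sum>j\<le>n * 2 ^ n. hat (t * 2 ^ n - real j) *\<^sub>R (a j - u m j))"
        by (simp add: interp_of_def scaleR_diff_right sum_subtractf)
      also have "norm \<dots> \<le> ?s m"
        by (rule sum_norm_le) (simp add: hat_le_1 mult_left_le_one_le)
      finally show "min (norm (interp_of n a t - interp_of n (u m) t)) (1 / (1 + t)) \<le> ?s m"
        by simp
    qed
    then show "\<forall>\<^sub>F m in sequentially. norm (path_dist (interp_of n a) (interp_of n (u m))) \<le> ?s m"
      using path_dist_nonneg[of "interp_of n a"] by (intro always_eventually) simp
  qed
  from path_functional_tendsto[OF assms interp_of_paths interp_of_paths this]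
  show "(\<lambda>m. \<Psi> (interp_of n (u m))) \<longlonglongrightarrow> \<Psi> (interp_of n a)" .
qed

lemma measurable_path_functional_interp:
  fixes Y :: "real \<Rightarrow> 'a \<Rightarrow> 'b::euclidean_space"
  assumes "path_functional \<Psi>" "continuous_process M Y"
  shows "(\<lambda>\<omega>. \<Psi> (interp n (\<lambda>t. Y t \<omega>))) \<in> borel_measurable M"
proof -
  have [measurable]: "(\<lambda>x. \<Psi> (interp_of n x)) \<in> borel_measurable borel"
    by (intro borel_measurable_continuous_onI interp_functional_continuous assms)
  have [measurable]: "(\<lambda>\<omega> j. Y (real j / 2 ^ n) \<omega>) \<in> borel_measurable M"
    using assms(2) by (intro measurable_coordinatewise_then_product) (auto simp: continuous_process_def)
  show ?thesis unfolding interp_def by measurable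
qed

lemma continuous_process_paths:
  "continuous_process M Y \<Longrightarrow> \<omega> \<in> space M \<Longrightarrow> (\<lambda>t. Y t \<omega>) \<in> paths"
  by (auto simp: continuous_process_def paths_def)

text \<open>No sigma-algebra on path space is introduced: interpolated paths give continuous
  functions of countably many random variables, and these converge pointwise.\<close>

lemma measurable_path_functional:
  fixes Y :: "real \<Rightarrow> 'a \<Rightarrow> 'b::euclidean_space"
  assumes "path_functional \<Psi>" "continuous_process M Y"
  shows "(\<lambda>\<omega>. \<Psi> (\<lambda>t. Y t \<omega>)) \<in> borel_measurable M"
proof (rule borel_measurable_LIMSEQ_real)
  show "(\<lambda>\<omega>. \<Psi> (interp n (\<lambda>t. Y t \<omega>))) \<in> borel_measurable M" for n
    using assms by (rule measurable_path_functional_interp)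
  show "(\<lambda>n. \<Psi> (interp n (\<lambda>t. Y t \<omega>))) \<longlonglongrightarrow> \<Psi> (\<lambda>t. Y t \<omega>)" if "\<omega> \<in> space M" for \<omega>
    using continuous_process_paths[OF assms(2) that]
    by (intro path_functional_tendsto[OF assms(1)] interp_paths interp_tendsto)
qed

lemma path_functional_interp_integral_tendsto:
  fixes Y :: "real \<Rightarrow> 'a \<Rightarrow> 'b::euclidean_space"
  assumes "prob_space M" "path_functional \<Psi>" "continuous_process M Y"
  shows "(\<lambda>n. LINT \<omega>|M. \<Psi> (interp n (\<lambda>t. Y t \<omega>))) \<longlonglongrightarrow> (LINT \<omega>|M. \<Psi> (\<lambda>t. Y t \<omega>))"
proof -
  interpret prob_space M by fact
  obtain b where b: "\<And>f. f \<in> paths \<Longrightarrow> \<bar>\<Psi> f\<bar> \<le> b" using assms(2) unfolding path_functional_def by blast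
  show ?thesis
  proof (rule integral_dominated_convergence[where w = "\<lambda>_. b"])
    show "AE \<omega> in M. (\<lambda>n. \<Psi> (interp n (\<lambda>t. Y t \<omega>))) \<longlonglongrightarrow> \<Psi> (\<lambda>t. Y t \<omega>)"
      using continuous_process_paths[OF assms(3)]
      by (intro AE_I2 path_functional_tendsto[OF assms(2)] interp_paths interp_tendsto)
  qed (use b interp_paths measurable_path_functional_interp measurable_path_functional assms in auto)
qed

text \<open>Every bounded continuous functional is the increasing limit of its Lipschitz regularisations, which
  gives the lower bound in the portmanteau theorem without any compactness; applied to \<open>\<Psi>\<close> and \<open>- \<Psi>\<close> it
  yields convergence.\<close>

definition lip_reg :: "((real \<Rightarrow> 'b::real_normed_vector) \<Rightarrow> real) \<Rightarrow> real \<Rightarrow> (real \<Rightarrow> 'b) \<Rightarrow> real" where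
  "lip_reg \<Psi> k f = (INF g\<in>paths. \<Psi> g + k * path_dist f g)"

context
  fixes \<Psi> :: "(real \<Rightarrow> 'b::real_normed_vector) \<Rightarrow> real" and b k :: real
  assumes b: "\<And>f. f \<in> paths \<Longrightarrow> \<bar>\<Psi> f\<bar> \<le> b" and k: "0 \<le> k"
begin

lemma lip_reg_bdd: "bdd_below ((\<lambda>g. \<Psi> g + k * path_dist f g) ` paths)"
proof (rule bdd_belowI2)
  fix g :: "real \<Rightarrow> 'b" assume "g \<in> paths"
  then show "- b \<le> \<Psi> g + k * path_dist f g"
    using b[of g] mult_nonneg_nonneg[OF k path_dist_nonneg[of f g]] by linarith
qed

lemma lip_reg_lower: "g \<in> paths \<Longrightarrow> lip_reg \<Psi> k f \<le> \<Psi> g + k * path_dist f g"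
  unfolding lip_reg_def by (rule cINF_lower[OF lip_reg_bdd])

lemma lip_reg_greatest:
  assumes "\<And>g. g \<in> paths \<Longrightarrow> c \<le> \<Psi> g + k * path_dist f g"
  shows "c \<le> lip_reg \<Psi> k f"
proof -
  have "(\<lambda>_. 0) \<in> (paths :: (real \<Rightarrow> 'b) set)" by (simp add: paths_def)
  then show ?thesis unfolding lip_reg_def using assms by (intro cINF_greatest) auto
qed

lemma lip_reg_le: "f \<in> paths \<Longrightarrow> lip_reg \<Psi> k f \<le> \<Psi> f"
  using lip_reg_lower[of f f] by simp

lemma lip_reg_bounded: "f \<in> paths \<Longrightarrow> \<bar>lip_reg \<Psi> k f\<bar> \<le> b"
proof -
  assume f: "f \<in> paths"
  have "- b \<le> lip_reg \<Psi> k f"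
  proof (rule lip_reg_greatest)
    fix g :: "real \<Rightarrow> 'b" assume "g \<in> paths"
    then show "- b \<le> \<Psi> g + k * path_dist f g"
      using b[of g] mult_nonneg_nonneg[OF k path_dist_nonneg[of f g]] by linarith
  qed
  then show ?thesis using lip_reg_le[OF f] b[OF f] by simp
qed

lemma lip_reg_lipschitz: "\<bar>lip_reg \<Psi> k f - lip_reg \<Psi> k g\<bar> \<le> k * path_dist f g"
proof -
  have "lip_reg \<Psi> k f - k * path_dist f g \<le> lip_reg \<Psi> k g" for f g
  proof (rule lip_reg_greatest)
    fix h :: "real \<Rightarrow> 'b" assume "h \<in> paths"
    then have "lip_reg \<Psi> k f \<le> \<Psi> h + k * path_dist f h" by (rule lip_reg_lower)
    also have "\<dots> \<le> \<Psi> h + k * (path_dist f g + path_dist g h)"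
      using path_dist_triangle k by (intro add_left_mono mult_left_mono) auto
    finally show "lip_reg \<Psi> k f - k * path_dist f g \<le> \<Psi> h + k * path_dist g h"
      by (simp add: distrib_left)
  qed
  from this[of f g] this[of g f] show ?thesis by (simp add: path_dist_commute)
qed

end

text \<open>In the infimum, paths at distance \<open>\<delta>\<close> or more from \<open>f\<close>
  are too expensive once \<open>k * \<delta> \<ge> 2 * b\<close>, and nearer ones change
  \<open>\<Psi>\<close> by less than \<open>e / 2\<close>.\<close>

lemma lip_reg_tendsto:
  assumes \<Psi>: "path_functional \<Psi>" and f: "f \<in> paths"
  shows "(\<lambda>k. lip_reg \<Psi> (real k) f) \<longlonglongrightarrow> \<Psi> f"
proof (rule tendstoI)
  fix e :: real assume "0 < e"
  obtain b where b: "\<And>f. f \<in> paths \<Longrightarrow> \<bar>\<Psi> f\<bar> \<le> b" using \<Psi> unfolding path_functional_def by blast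
  from \<Psi> f \<open>0 < e\<close> obtain \<delta> where \<delta>: "0 < \<delta>" "\<And>g. g \<in> paths \<Longrightarrow> path_dist f g < \<delta> \<Longrightarrow> \<bar>\<Psi> g - \<Psi> f\<bar> < e / 2"
    unfolding path_functional_def by (meson half_gt_zero)
  obtain k0 :: nat where k0: "2 * b / \<delta> < real k0" using reals_Archimedean2 by blast
  show "\<forall>\<^sub>F k in sequentially. dist (lip_reg \<Psi> (real k) f) (\<Psi> f) < e"
    using eventually_ge_at_top[of k0]
  proof eventually_elim
    case (elim k)
    have "\<Psi> f - e / 2 \<le> lip_reg \<Psi> (real k) f"
    proof (rule lip_reg_greatest[OF b])
      fix g :: "real \<Rightarrow> 'a" assume g: "g \<in> paths"
      have nn: "0 \<le> real k * path_dist f g" using path_dist_nonneg[of f g] by simp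
      show "\<Psi> f - e / 2 \<le> \<Psi> g + real k * path_dist f g"
      proof (cases "path_dist f g < \<delta>")
        case True
        from \<delta>(2)[OF g True] nn show ?thesis by linarith
      next
        case False
        have "2 * b \<le> real k0 * \<delta>" using k0 \<delta>(1) by (simp add: field_simps)
        also have "\<dots> \<le> real k * path_dist f g" using False elim \<delta>(1) by (intro mult_mono) auto
        finally show ?thesis using b[OF f] b[OF g] \<open>0 < e\<close> by (simp add: abs_le_iff)
      qed
    qed auto
    moreover have "lip_reg \<Psi> (real k) f \<le> \<Psi> f" using lip_reg_le[OF b _ f, where k = "real k"] by simp
    ultimately show ?case using \<open>0 < e\<close> by (simp add: dist_real_def)
  qed
qed

section \<open>Chaining along dyadic times\<close>

lemma norm_diff_trans: "norm (x - y) \<le> a \<Longrightarrow> norm (y - z) \<le> b \<Longrightarrow> norm (x - z) \<le> a + b"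
  for x y z :: "'b::real_normed_vector"
  using norm_triangle_ineq[of "x - y" "y - z"] by simp

text \<open>Approximate \<open>t\<close> from below by dyadic points. Each refinement moves by at
  most one fine mesh, so the tail of \<open>a\<close> pays for the way from level \<open>n\<close>
  to \<open>t\<close>, and the head \<open>a n\<close> for the last step to a neighbouring grid
  point of level \<open>n\<close>.\<close>

lemma chaining_bound:
  fixes f :: "real \<Rightarrow> 'b::real_normed_vector"
  assumes f: "f \<in> paths" and a: "summable (\<lambda>k. a (n + k))" "\<And>k. 0 \<le> a k"
    and inc: "\<And>k j. n \<le> k \<Longrightarrow> j < n * 2 ^ k \<Longrightarrow> norm (f (real (Suc j) / 2 ^ k) - f (real j / 2 ^ k)) \<le> a k"
    and t: "0 \<le> t" "t \<le> real n"
  shows "norm (f t - interp n f t) \<le> (\<Sum>k. a (n + k))"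
proof -
  define q where "q k = nat \<lfloor>t * 2 ^ k\<rfloor>" for k
  have q: "real (q k) \<le> t * 2 ^ k" "t * 2 ^ k < real (q k) + 1" for k
    using t by (auto simp: q_def of_nat_nat)
  have qn: "real (q k) \<le> real n * 2 ^ k" for k
    using order_trans[OF q(1)[of k] mult_right_mono[OF t(2), of "2 ^ k"]] by simp
  then have qn': "q k \<le> n * 2 ^ k" for k
    by (metis of_nat_le_iff of_nat_mult of_nat_numeral of_nat_power)
  have step: "norm (f (real (q (Suc k)) / 2 ^ Suc k) - f (real (q k) / 2 ^ k)) \<le> a (Suc k)" if "n \<le> k" for k
  proof -
    \<comment> \<open>Refining the level appends one binary digit to the floor.\<close>
    have "q (Suc k) = 2 * q k \<or> q (Suc k) = Suc (2 * q k)"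
    proof -
      have "real (q (Suc k)) < 2 * real (q k) + 2" "2 * real (q k) < real (q (Suc k)) + 1"
        using q[of k] q[of "Suc k"] by auto
      then have "real (q (Suc k)) < real (2 * q k + 2)" "real (2 * q k) < real (q (Suc k) + 1)" by simp_all
      then show ?thesis unfolding of_nat_less_iff by linarith
    qed
    then show ?thesis
    proof
      assume "q (Suc k) = 2 * q k"
      then show ?thesis using a(2) by simp
    next
      assume e: "q (Suc k) = Suc (2 * q k)"
      have "2 * q k < n * 2 ^ Suc k" using qn'[of "Suc k"] e by simp
      from inc[OF _ this] that have "norm (f (real (q (Suc k)) / 2 ^ Suc k) - f (real (2 * q k) / 2 ^ Suc k)) \<le> a (Suc k)"
        by (simp add: e)
      then show ?thesis by simp
    qed
  qed
  have chain: "norm (f (real (q (n + m)) / 2 ^ (n + m)) - f (real (q n) / 2 ^ n)) \<le> (\<Sum>k<m. a (n + Suc k))" for m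
  proof (induction m)
    case (Suc m)
    from norm_diff_trans[OF step[of "n + m"] Suc] show ?case by (simp add: add.commute)
  qed simp
  have lim: "(\<lambda>m. f (real (q (n + m)) / 2 ^ (n + m))) \<longlonglongrightarrow> f t"
  proof (rule continuous_on_tendsto_compose[of "{0..}" f])
    show "continuous_on {0..} f" using f by (simp add: paths_def)
    have "(\<lambda>k. real (q k) / 2 ^ k) \<longlonglongrightarrow> t"
    proof (rule tendsto_sandwich)
      show "\<forall>\<^sub>F k in sequentially. t - (1 / 2) ^ k \<le> real (q k) / 2 ^ k"
      proof (intro always_eventually allI)
        fix k
        have "t \<le> (real (q k) + 1) / 2 ^ k" using q(2)[of k] by (simp add: pos_le_divide_eq less_imp_le)
        then show "t - (1 / 2) ^ k \<le> real (q k) / 2 ^ k"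
          by (simp add: add_divide_distrib power_one_over)
      qed
      show "\<forall>\<^sub>F k in sequentially. real (q k) / 2 ^ k \<le> t"
        using q(1) by (intro always_eventually allI) (simp add: field_simps)
      show "(\<lambda>k. t - (1 / 2) ^ k) \<longlonglongrightarrow> t"
        using tendsto_diff[OF tendsto_const LIMSEQ_realpow_zero[of "1/2"], of t] by simp
    qed simp
    then show "(\<lambda>m. real (q (n + m)) / 2 ^ (n + m)) \<longlonglongrightarrow> t"
      using LIMSEQ_ignore_initial_segment[of _ t n] by (simp add: add.commute)
  qed (use t in auto)
  have sum: "(\<Sum>k. a (n + k)) = a n + (\<Sum>k. a (n + Suc k))"
    using suminf_split_head[OF a(1)] by simp
  have base: "norm (f t - f (real (q n) / 2 ^ n)) \<le> (\<Sum>k. a (n + Suc k))"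
  proof (rule LIMSEQ_le_const2)
    show "(\<lambda>m. norm (f (real (q (n + m)) / 2 ^ (n + m)) - f (real (q n) / 2 ^ n))) \<longlonglongrightarrow> norm (f t - f (real (q n) / 2 ^ n))"
      by (intro tendsto_intros lim)
    have s: "summable (\<lambda>k. a (n + Suc k))" using summable_ignore_initial_segment[OF a(1), of 1] by simp
    show "\<exists>N. \<forall>m\<ge>N. norm (f (real (q (n + m)) / 2 ^ (n + m)) - f (real (q n) / 2 ^ n)) \<le> (\<Sum>k. a (n + Suc k))"
      using order_trans[OF chain sum_le_suminf[OF s]] a(2) by blast
  qed
  show ?thesis
  proof (rule interp_error[OF t])
    fix j assume j: "j \<le> n * 2 ^ n" "\<bar>t * 2 ^ n - real j\<bar> < 1"
    have "real j < real (q n + 2)" "real (q n) < real (j + 1)" using j(2) q[of n] by auto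
    then have "j = q n \<or> j = Suc (q n)" unfolding of_nat_less_iff by linarith
    then have "norm (f (real (q n) / 2 ^ n) - f (real j / 2 ^ n)) \<le> a n"
    proof
      assume "j = q n" then show ?thesis using a(2) by simp
    next
      assume e: "j = Suc (q n)"
      then show ?thesis using inc[of n "q n"] j(1) by (simp add: norm_minus_commute)
    qed
    from norm_diff_trans[OF base this] show "norm (f t - f (real j / 2 ^ n)) \<le> (\<Sum>k. a (n + k))"
      unfolding sum by simp
  qed
qed

text \<open>Trades an increment for a small threshold plus its fourth power; applied to all
  increments of a level at once, it replaces a maximal inequality.\<close>

lemma le_add_fourth_power: "0 < \<delta> \<Longrightarrow> 0 \<le> x \<Longrightarrow> x \<le> \<delta> + x ^ 4 / \<delta> ^ 3" for x \<delta> :: real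
proof -
  assume d: "0 < \<delta>" "0 \<le> x"
  show ?thesis
  proof (cases "x \<le> \<delta>")
    case True
    then show ?thesis using d by (simp add: add_increasing2)
  next
    case False
    then have "x * \<delta> ^ 3 \<le> x * x ^ 3" using d by (intro mult_left_mono power_mono) auto
    then have "x * \<delta> ^ 3 \<le> x ^ 4" by (simp add: power_numeral_reduce)
    then have "x \<le> x ^ 4 / \<delta> ^ 3" using d by (simp add: pos_le_divide_eq)
    then show ?thesis using d by simp
  qed
qed

text \<open>The bound sees the process only through \<open>C\<close>, hence is uniform over a family
  sharing it. Level \<open>k\<close> has \<open>n * 2 ^ k\<close> increments with fourth moment at
  most \<open>C / 4 ^ k\<close>; division by the cube of the threshold \<open>r ^ k\<close> still
  leaves a geometric series. The term \<open>1 / (1 + real n)\<close> is the price of ignoring times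
  after \<open>n\<close>.\<close>

lemma chaining_expectation:
  fixes Y :: "real \<Rightarrow> 'a \<Rightarrow> 'b::euclidean_space"
  assumes M: "prob_space M" and Y: "continuous_process M Y" and "0 \<le> C"
    and mom: "\<And>s t. 0 \<le> s \<Longrightarrow> s \<le> t \<Longrightarrow> integrable M (\<lambda>\<omega>. norm (Y t \<omega> - Y s \<omega>) ^ 4)"
      "\<And>s t. 0 \<le> s \<Longrightarrow> s \<le> t \<Longrightarrow> (LINT \<omega>|M. norm (Y t \<omega> - Y s \<omega>) ^ 4) \<le> C * (t - s)\<^sup>2"
    and b: "\<And>f. f \<in> paths \<Longrightarrow> \<bar>\<Psi> f\<bar> \<le> b" and "0 \<le> K"
    and L: "\<And>f g. f \<in> paths \<Longrightarrow> g \<in> paths \<Longrightarrow> \<bar>\<Psi> f - \<Psi> g\<bar> \<le> K * path_dist f g"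
  shows "\<bar>(LINT \<omega>|M. \<Psi> (\<lambda>t. Y t \<omega>)) - (LINT \<omega>|M. \<Psi> (interp n (\<lambda>t. Y t \<omega>)))\<bar> \<le>
     K * (10 * (1 + real n * C) * (9 / 10) ^ n + 1 / (1 + real n))"
proof -
  interpret prob_space M by fact
  have \<Psi>: "path_functional \<Psi>" using b \<open>0 \<le> K\<close> L by (rule lipschitz_path_functional)
  have [measurable]: "Y t \<in> borel_measurable M" if "0 \<le> t" for t
    using Y that by (simp add: continuous_process_def)
  note m1[measurable] = measurable_path_functional[OF \<Psi> Y]
  note m2[measurable] = measurable_path_functional_interp[OF \<Psi> Y, of n]
  \<comment> \<open>Any \<open>r < 1\<close> with \<open>1 / (2 r\<^sup>3) \<le> r\<close> would do.\<close>
  define r :: real where "r = 9 / 10"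
  have r: "0 < r" "r < 1" by (auto simp: r_def)
  define D where "D k j \<omega> = norm (Y (real (Suc j) / 2 ^ k) \<omega> - Y (real j / 2 ^ k) \<omega>)" for k j \<omega>
  have [measurable]: "D k j \<in> borel_measurable M" for k j unfolding D_def by measurable
  \<comment> \<open>One random majorant for all increments of level \<open>k\<close>, from
    \<open>le_add_fourth_power\<close> with threshold \<open>r ^ k\<close>.\<close>
  define a where "a k \<omega> = r ^ k + (\<Sum>j<n * 2 ^ k. D k j \<omega> ^ 4) / (r ^ k) ^ 3" for k \<omega>
  have a_nn: "0 \<le> a k \<omega>" for k \<omega> using r by (simp add: a_def sum_nonneg add_nonneg_nonneg)
  have [measurable]: "a k \<in> borel_measurable M" for k unfolding a_def by measurable
  have D_int: "integrable M (\<lambda>\<omega>. D k j \<omega> ^ 4)" for k j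
    unfolding D_def by (rule mom(1)) (auto simp: divide_right_mono)
  have D_exp: "(LINT \<omega>|M. D k j \<omega> ^ 4) \<le> C * ((1 / 2) ^ k)\<^sup>2" for k j
  proof -
    have "(LINT \<omega>|M. D k j \<omega> ^ 4) \<le> C * (real (Suc j) / 2 ^ k - real j / 2 ^ k)\<^sup>2"
      unfolding D_def by (rule mom(2)) (auto simp: divide_right_mono)
    also have "real (Suc j) / 2 ^ k - real j / 2 ^ k = (1 / 2) ^ k"
      by (simp add: diff_divide_distrib[symmetric] power_one_over)
    finally show ?thesis .
  qed
  have a_int: "integrable M (a k)" for k unfolding a_def using D_int by simp
  have a_exp: "(LINT \<omega>|M. a k \<omega>) \<le> (1 + real n * C) * r ^ k" for k
  proof -
    have "(LINT \<omega>|M. a k \<omega>) = r ^ k + (\<Sum>j<n * 2 ^ k. LINT \<omega>|M. D k j \<omega> ^ 4) / (r ^ k) ^ 3"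
      unfolding a_def using D_int by (simp add: prob_space Bochner_Integration.integral_sum)
    also have "\<dots> \<le> r ^ k + (\<Sum>j<n * 2 ^ k. C * ((1 / 2) ^ k)\<^sup>2) / (r ^ k) ^ 3"
      using r by (intro add_left_mono divide_right_mono sum_mono D_exp) auto
    also have "(\<Sum>j<n * 2 ^ k. C * ((1 / 2) ^ k)\<^sup>2) / (r ^ k) ^ 3 = real n * C * (1 / (2 * r ^ 3)) ^ k"
    proof -
      have e1: "(r ^ 3) ^ k = (r ^ k) ^ 3" by (metis mult.commute power_mult)
      have e2: "2 ^ k * ((1 / 2) ^ k)\<^sup>2 = (1 / 2 :: real) ^ k" by (simp add: power2_eq_square power_divide)
      have "(\<Sum>j<n * 2 ^ k. C * ((1 / 2) ^ k)\<^sup>2) = real n * C * (2 ^ k * ((1 / 2) ^ k)\<^sup>2)" by simp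
      then show ?thesis unfolding e2 by (simp add: power_divide power_mult_distrib e1)
    qed
    also have "\<dots> \<le> real n * C * r ^ k"
      using \<open>0 \<le> C\<close> by (intro mult_left_mono power_mono) (auto simp: r_def power_divide)
    finally show ?thesis by (simp add: distrib_right)
  qed
  have g: "(\<lambda>k. r ^ k) sums 10"
  proof -
    have "norm r < 1" "1 / (1 - r) = 10" by (simp_all add: r_def)
    with geometric_sums[of r] show ?thesis by metis
  qed
  have geo: "(\<lambda>k. (1 + real n * C) * r ^ (n + k)) sums ((1 + real n * C) * r ^ n * 10)"
    using sums_mult[OF g, of "(1 + real n * C) * r ^ n"] by (simp only: power_add mult.assoc)
  \<comment> \<open>In extended reals the bound holds on every path, also where the series diverges,
    so that expectations can be taken before summability is known.\<close>
  have pw: "ennreal \<bar>\<Psi> (\<lambda>t. Y t \<omega>) - \<Psi> (interp n (\<lambda>t. Y t \<omega>))\<bar> \<le>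
      ennreal K * ((\<Sum>k. ennreal (a (n + k) \<omega>)) + ennreal (1 / (1 + real n)))" if \<omega>: "\<omega> \<in> space M" for \<omega>
  proof (cases "summable (\<lambda>k. a (n + k) \<omega>)")
    case True
    have p: "(\<lambda>t. Y t \<omega>) \<in> paths" using continuous_process_paths[OF Y \<omega>] .
    have "path_dist (\<lambda>t. Y t \<omega>) (interp n (\<lambda>t. Y t \<omega>)) \<le> (\<Sum>k. a (n + k) \<omega>) + 1 / (1 + real n)"
    proof (rule path_dist_le_uniform)
      fix t assume t: "0 \<le> t" "t \<le> real n"
      show "norm (Y t \<omega> - interp n (\<lambda>t. Y t \<omega>) t) \<le> (\<Sum>k. a (n + k) \<omega>)"
      proof (rule chaining_bound[where a = "\<lambda>k. a k \<omega>", OF p True a_nn _ t])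
        fix k j assume j: "j < n * 2 ^ k"
        have "D k j \<omega> \<le> r ^ k + D k j \<omega> ^ 4 / (r ^ k) ^ 3"
          using r by (intro le_add_fourth_power) (auto simp: D_def)
        also have "\<dots> \<le> a k \<omega>"
          unfolding a_def using r j
          by (intro add_left_mono divide_right_mono member_le_sum[of j _ "\<lambda>j. D k j \<omega> ^ 4"]) auto
        finally show "norm (Y (real (Suc j) / 2 ^ k) \<omega> - Y (real j / 2 ^ k) \<omega>) \<le> a k \<omega>"
          by (simp add: D_def)
      qed
    qed (use True a_nn in \<open>auto intro: suminf_nonneg\<close>)
    then have "\<bar>\<Psi> (\<lambda>t. Y t \<omega>) - \<Psi> (interp n (\<lambda>t. Y t \<omega>))\<bar> \<le> K * ((\<Sum>k. a (n + k) \<omega>) + 1 / (1 + real n))"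
      using order_trans[OF L[OF p interp_paths] mult_left_mono[OF _ \<open>0 \<le> K\<close>]] by simp
    then have "ennreal \<bar>\<Psi> (\<lambda>t. Y t \<omega>) - \<Psi> (interp n (\<lambda>t. Y t \<omega>))\<bar> \<le> ennreal (K * ((\<Sum>k. a (n + k) \<omega>) + 1 / (1 + real n)))"
      by (rule ennreal_leI)
    also have "\<dots> = ennreal K * ((\<Sum>k. ennreal (a (n + k) \<omega>)) + ennreal (1 / (1 + real n)))"
      using True a_nn \<open>0 \<le> K\<close> by (simp add: ennreal_mult suminf_ennreal2 ennreal_plus suminf_nonneg)
    finally show ?thesis .
  next
    case False
    then have top: "(\<Sum>k. ennreal (a (n + k) \<omega>)) = top"
      using summable_suminf_not_top[of "\<lambda>k. a (n + k) \<omega>", OF a_nn] by blast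
    \<comment> \<open>A divergent series makes the bound infinite only for \<open>K > 0\<close>; for
      \<open>K = 0\<close> the left-hand side vanishes.\<close>
    show ?thesis
    proof (cases "K = 0")
      case True
      have "\<bar>\<Psi> (\<lambda>t. Y t \<omega>) - \<Psi> (interp n (\<lambda>t. Y t \<omega>))\<bar> \<le> 0"
        using L[OF continuous_process_paths[OF Y \<omega>] interp_paths] True by simp
      then show ?thesis by simp
    next
      case False
      then show ?thesis using \<open>0 \<le> K\<close> unfolding top by (simp add: ennreal_mult_top)
    qed
  qed
  have "(\<integral>\<^sup>+\<omega>. ennreal \<bar>\<Psi> (\<lambda>t. Y t \<omega>) - \<Psi> (interp n (\<lambda>t. Y t \<omega>))\<bar> \<partial>M) \<le>
      (\<integral>\<^sup>+\<omega>. ennreal K * ((\<Sum>k. ennreal (a (n + k) \<omega>)) + ennreal (1 / (1 + real n))) \<partial>M)"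
    by (rule nn_integral_mono) (rule pw)
  also have "\<dots> = ennreal K * ((\<Sum>k. \<integral>\<^sup>+\<omega>. ennreal (a (n + k) \<omega>) \<partial>M) + ennreal (1 / (1 + real n)))"
    by (simp add: nn_integral_cmult nn_integral_add nn_integral_suminf emeasure_space_1)
  also have "(\<Sum>k. \<integral>\<^sup>+\<omega>. ennreal (a (n + k) \<omega>) \<partial>M) \<le> (\<Sum>k. ennreal ((1 + real n * C) * r ^ (n + k)))"
    using a_exp a_nn a_int by (intro suminf_le) (auto simp: nn_integral_eq_integral intro: ennreal_leI)
  also have "\<dots> = ennreal ((1 + real n * C) * r ^ n * 10)"
    using geo r \<open>0 \<le> C\<close> by (subst suminf_ennreal2) (auto simp: sums_iff)
  finally have nn: "(\<integral>\<^sup>+\<omega>. ennreal \<bar>\<Psi> (\<lambda>t. Y t \<omega>) - \<Psi> (interp n (\<lambda>t. Y t \<omega>))\<bar> \<partial>M) \<le>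
      ennreal K * (ennreal ((1 + real n * C) * r ^ n * 10) + ennreal (1 / (1 + real n)))"
    by (simp add: mult_left_mono add_right_mono)
  have i: "integrable M (\<lambda>\<omega>. \<Psi> (\<lambda>t. Y t \<omega>))" "integrable M (\<lambda>\<omega>. \<Psi> (interp n (\<lambda>t. Y t \<omega>)))"
    by (auto intro!: integrable_const_bound[of _ b] AE_I2 b continuous_process_paths[OF Y] interp_paths)
  have "(LINT \<omega>|M. \<Psi> (\<lambda>t. Y t \<omega>)) - (LINT \<omega>|M. \<Psi> (interp n (\<lambda>t. Y t \<omega>))) =
      (LINT \<omega>|M. \<Psi> (\<lambda>t. Y t \<omega>) - \<Psi> (interp n (\<lambda>t. Y t \<omega>)))" using i by simp
  also have "\<bar>\<dots>\<bar> \<le> (LINT \<omega>|M. \<bar>\<Psi> (\<lambda>t. Y t \<omega>) - \<Psi> (interp n (\<lambda>t. Y t \<omega>))\<bar>)"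
    by (rule integral_abs_bound)
  finally have le: "\<bar>(LINT \<omega>|M. \<Psi> (\<lambda>t. Y t \<omega>)) - (LINT \<omega>|M. \<Psi> (interp n (\<lambda>t. Y t \<omega>)))\<bar> \<le>
      (LINT \<omega>|M. \<bar>\<Psi> (\<lambda>t. Y t \<omega>) - \<Psi> (interp n (\<lambda>t. Y t \<omega>))\<bar>)" .
  have "ennreal (LINT \<omega>|M. \<bar>\<Psi> (\<lambda>t. Y t \<omega>) - \<Psi> (interp n (\<lambda>t. Y t \<omega>))\<bar>) =
      (\<integral>\<^sup>+\<omega>. ennreal \<bar>\<Psi> (\<lambda>t. Y t \<omega>) - \<Psi> (interp n (\<lambda>t. Y t \<omega>))\<bar> \<partial>M)"
    using i by (subst nn_integral_eq_integral) auto
  also note nn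
  also have "ennreal K * (ennreal ((1 + real n * C) * r ^ n * 10) + ennreal (1 / (1 + real n))) =
      ennreal (K * ((1 + real n * C) * r ^ n * 10 + 1 / (1 + real n)))"
    using \<open>0 \<le> K\<close> \<open>0 \<le> C\<close> r by (simp add: ennreal_mult ennreal_plus)
  finally have "(LINT \<omega>|M. \<bar>\<Psi> (\<lambda>t. Y t \<omega>) - \<Psi> (interp n (\<lambda>t. Y t \<omega>))\<bar>) \<le>
      K * ((1 + real n * C) * r ^ n * 10 + 1 / (1 + real n))"
    using \<open>0 \<le> K\<close> \<open>0 \<le> C\<close> r by (subst (asm) ennreal_le_iff) auto
  moreover have "K * ((1 + real n * C) * r ^ n * 10 + 1 / (1 + real n)) = K * (10 * (1 + real n * C) * (9 / 10) ^ n + 1 / (1 + real n))"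
    by (simp only: r_def mult.assoc mult.commute mult.left_commute)
  ultimately show ?thesis using le by linarith
qed

text \<open>For a Lipschitz functional there are three errors: from the process to its
  interpolation, uniformly in \<open>e\<close> by chaining; between the interpolated expectations,
  by \<open>fd\<close>; and from the interpolated limit back to the limit, by dominated convergence.
  The level \<open>n\<close> is fixed before \<open>e\<close> moves.\<close>

theorem weak_convergence_criterion:
  fixes Y :: "'e \<Rightarrow> real \<Rightarrow> 'a \<Rightarrow> 'b::euclidean_space" and Z :: "real \<Rightarrow> 'c \<Rightarrow> 'b"
  assumes M: "prob_space M" and N: "prob_space N"
    and Y: "\<And>e. continuous_process M (Y e)" and Z: "continuous_process N Z"
    and mom: "\<And>e s t. 0 \<le> s \<Longrightarrow> s \<le> t \<Longrightarrow> integrable M (\<lambda>\<omega>. norm (Y e t \<omega> - Y e s \<omega>) ^ 4)"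
      "\<And>e s t. 0 \<le> s \<Longrightarrow> s \<le> t \<Longrightarrow> (LINT \<omega>|M. norm (Y e t \<omega> - Y e s \<omega>) ^ 4) \<le> C * (t - s)\<^sup>2"
    and fd: "\<And>n \<Psi>. path_functional \<Psi> \<Longrightarrow>
       ((\<lambda>e. LINT \<omega>|M. \<Psi> (interp n (\<lambda>t. Y e t \<omega>))) \<longlongrightarrow> (LINT \<omega>|N. \<Psi> (interp n (\<lambda>t. Z t \<omega>)))) \<F>"
    and \<Phi>: "path_functional \<Phi>"
  shows "((\<lambda>e. LINT \<omega>|M. \<Phi> (\<lambda>t. Y e t \<omega>)) \<longlongrightarrow> (LINT \<omega>|N. \<Phi> (\<lambda>t. Z t \<omega>))) \<F>"
proof -
  interpret M: prob_space M by fact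
  interpret N: prob_space N by fact
  define C' where "C' = \<bar>C\<bar>"
  have "0 \<le> C'" by (simp add: C'_def)
  have mom': "(LINT \<omega>|M. norm (Y e t \<omega> - Y e s \<omega>) ^ 4) \<le> C' * (t - s)\<^sup>2" if "0 \<le> s" "s \<le> t" for e s t
    by (rule order_trans[OF mom(2)[OF that] mult_right_mono]) (auto simp: C'_def)
  have lip: "((\<lambda>e. LINT \<omega>|M. \<Psi> (\<lambda>t. Y e t \<omega>)) \<longlongrightarrow> (LINT \<omega>|N. \<Psi> (\<lambda>t. Z t \<omega>))) \<F>"
    if b: "\<And>f. f \<in> paths \<Longrightarrow> \<bar>\<Psi> f\<bar> \<le> b" and "0 \<le> K"
      and L: "\<And>f g. f \<in> paths \<Longrightarrow> g \<in> paths \<Longrightarrow> \<bar>\<Psi> f - \<Psi> g\<bar> \<le> K * path_dist f g" for \<Psi> b K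
  proof (rule tendstoI)
    fix \<eta> :: real assume "0 < \<eta>"
    have \<Psi>: "path_functional \<Psi>" using b \<open>0 \<le> K\<close> L by (rule lipschitz_path_functional)
    let ?\<beta> = "\<lambda>n. K * (10 * (1 + real n * C') * (9 / 10) ^ n + 1 / (1 + real n))"
    \<comment> \<open>The factor \<open>real n\<close>, from the number of increments on
      \<open>[0, n]\<close>, is beaten by the geometric decay.\<close>
    have "(\<lambda>n. K * (10 * (9 / 10) ^ n + 10 * C' * (real n * (9 / 10) ^ n) + inverse (real (Suc n)))) \<longlonglongrightarrow>
        K * (10 * 0 + 10 * C' * 0 + 0)"
      by (intro tendsto_intros LIMSEQ_realpow_zero powser_times_n_limit_0 LIMSEQ_inverse_real_of_nat) auto
    moreover have "(\<lambda>n. K * (10 * (9 / 10) ^ n + 10 * C' * (real n * (9 / 10) ^ n) + inverse (real (Suc n)))) = ?\<beta>"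
      by (simp add: fun_eq_iff inverse_eq_divide distrib_left distrib_right)
    ultimately have "?\<beta> \<longlonglongrightarrow> 0" by simp
    then have "\<forall>\<^sub>F n in sequentially. ?\<beta> n < \<eta> / 3" using \<open>0 < \<eta>\<close> by (intro order_tendstoD) auto
    moreover have "\<forall>\<^sub>F n in sequentially. dist (LINT \<omega>|N. \<Psi> (interp n (\<lambda>t. Z t \<omega>))) (LINT \<omega>|N. \<Psi> (\<lambda>t. Z t \<omega>)) < \<eta> / 3"
      using path_functional_interp_integral_tendsto[OF N \<Psi> Z] \<open>0 < \<eta>\<close> by (intro tendstoD) auto
    ultimately have "\<forall>\<^sub>F n in sequentially. ?\<beta> n < \<eta> / 3 \<and>
        dist (LINT \<omega>|N. \<Psi> (interp n (\<lambda>t. Z t \<omega>))) (LINT \<omega>|N. \<Psi> (\<lambda>t. Z t \<omega>)) < \<eta> / 3"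
      by (rule eventually_conj)
    then obtain n where n: "?\<beta> n < \<eta> / 3"
        "dist (LINT \<omega>|N. \<Psi> (interp n (\<lambda>t. Z t \<omega>))) (LINT \<omega>|N. \<Psi> (\<lambda>t. Z t \<omega>)) < \<eta> / 3"
      by (auto dest: eventually_happens'[OF sequentially_bot])
    have "\<forall>\<^sub>F e in \<F>. dist (LINT \<omega>|M. \<Psi> (interp n (\<lambda>t. Y e t \<omega>))) (LINT \<omega>|N. \<Psi> (interp n (\<lambda>t. Z t \<omega>))) < \<eta> / 3"
      using fd[OF \<Psi>] \<open>0 < \<eta>\<close> by (intro tendstoD) auto
    then show "\<forall>\<^sub>F e in \<F>. dist (LINT \<omega>|M. \<Psi> (\<lambda>t. Y e t \<omega>)) (LINT \<omega>|N. \<Psi> (\<lambda>t. Z t \<omega>)) < \<eta>"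
    proof eventually_elim
      case (elim e)
      have "\<bar>(LINT \<omega>|M. \<Psi> (\<lambda>t. Y e t \<omega>)) - (LINT \<omega>|M. \<Psi> (interp n (\<lambda>t. Y e t \<omega>)))\<bar> \<le> ?\<beta> n"
        by (rule chaining_expectation[OF M Y \<open>0 \<le> C'\<close> mom(1) mom' b \<open>0 \<le> K\<close> L])
      then show ?case using elim n unfolding dist_real_def by linarith
    qed
  qed
  have lower: "\<forall>\<^sub>F e in \<F>. (LINT \<omega>|N. \<Psi> (\<lambda>t. Z t \<omega>)) - \<eta> < (LINT \<omega>|M. \<Psi> (\<lambda>t. Y e t \<omega>))"
    if \<Psi>: "path_functional \<Psi>" and "0 < \<eta>" for \<Psi> \<eta>
  proof -
    obtain b where b: "\<And>f. f \<in> paths \<Longrightarrow> \<bar>\<Psi> f\<bar> \<le> b" using \<Psi> unfolding path_functional_def by blast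
    have pf: "path_functional (lip_reg \<Psi> (real k))" for k
      by (rule lipschitz_path_functional[OF lip_reg_bounded[OF b] _ lip_reg_lipschitz[OF b]]) auto
    have "(\<lambda>k. LINT \<omega>|N. lip_reg \<Psi> (real k) (\<lambda>t. Z t \<omega>)) \<longlonglongrightarrow> (LINT \<omega>|N. \<Psi> (\<lambda>t. Z t \<omega>))"
    proof (rule integral_dominated_convergence[where w = "\<lambda>_. b"])
      show "AE \<omega> in N. (\<lambda>k. lip_reg \<Psi> (real k) (\<lambda>t. Z t \<omega>)) \<longlonglongrightarrow> \<Psi> (\<lambda>t. Z t \<omega>)"
        by (intro AE_I2 lip_reg_tendsto[OF \<Psi>] continuous_process_paths[OF Z])
      show "AE \<omega> in N. norm (lip_reg \<Psi> (real k) (\<lambda>t. Z t \<omega>)) \<le> b" for k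
        using lip_reg_bounded[OF b _ continuous_process_paths[OF Z]] by (intro AE_I2) simp
    qed (use measurable_path_functional[OF \<Psi> Z] measurable_path_functional[OF pf Z] in auto)
    then have "\<forall>\<^sub>F k in sequentially. (LINT \<omega>|N. \<Psi> (\<lambda>t. Z t \<omega>)) - \<eta> < (LINT \<omega>|N. lip_reg \<Psi> (real k) (\<lambda>t. Z t \<omega>))"
      using \<open>0 < \<eta>\<close> by (intro order_tendstoD) auto
    then obtain k where k: "(LINT \<omega>|N. \<Psi> (\<lambda>t. Z t \<omega>)) - \<eta> < (LINT \<omega>|N. lip_reg \<Psi> (real k) (\<lambda>t. Z t \<omega>))"
      by (auto dest: eventually_happens'[OF sequentially_bot])
    have "((\<lambda>e. LINT \<omega>|M. lip_reg \<Psi> (real k) (\<lambda>t. Y e t \<omega>)) \<longlongrightarrow> (LINT \<omega>|N. lip_reg \<Psi> (real k) (\<lambda>t. Z t \<omega>))) \<F>"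
      by (rule lip[OF lip_reg_bounded[OF b] _ lip_reg_lipschitz[OF b]]) auto
    then have "\<forall>\<^sub>F e in \<F>. (LINT \<omega>|N. \<Psi> (\<lambda>t. Z t \<omega>)) - \<eta> < (LINT \<omega>|M. lip_reg \<Psi> (real k) (\<lambda>t. Y e t \<omega>))"
      using k by (rule order_tendstoD)
    then show ?thesis
    proof eventually_elim
      case (elim e)
      have "(LINT \<omega>|M. lip_reg \<Psi> (real k) (\<lambda>t. Y e t \<omega>)) \<le> (LINT \<omega>|M. \<Psi> (\<lambda>t. Y e t \<omega>))"
      proof (rule integral_mono)
        show "integrable M (\<lambda>\<omega>. lip_reg \<Psi> (real k) (\<lambda>t. Y e t \<omega>))"
          using measurable_path_functional[OF pf Y] lip_reg_bounded[OF b _ continuous_process_paths[OF Y]]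
          by (intro M.integrable_const_bound[of _ b]) auto
        show "integrable M (\<lambda>\<omega>. \<Psi> (\<lambda>t. Y e t \<omega>))"
          using measurable_path_functional[OF \<Psi> Y] b[OF continuous_process_paths[OF Y]]
          by (intro M.integrable_const_bound[of _ b]) auto
        show "lip_reg \<Psi> (real k) (\<lambda>t. Y e t \<omega>) \<le> \<Psi> (\<lambda>t. Y e t \<omega>)" if "\<omega> \<in> space M" for \<omega>
          by (rule lip_reg_le[OF b _ continuous_process_paths[OF Y that]]) auto
      qed
      with elim show ?case by simp
    qed
  qed
  show ?thesis
  proof (rule tendstoI)
    fix \<eta> :: real assume "0 < \<eta>"
    show "\<forall>\<^sub>F e in \<F>. dist (LINT \<omega>|M. \<Phi> (\<lambda>t. Y e t \<omega>)) (LINT \<omega>|N. \<Phi> (\<lambda>t. Z t \<omega>)) < \<eta>"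
      using lower[OF \<Phi> \<open>0 < \<eta>\<close>] lower[OF path_functional_uminus[OF \<Phi>] \<open>0 < \<eta>\<close>]
      by eventually_elim (simp add: dist_real_def abs_less_iff)
  qed
qed

section \<open>Slowly varying covariances\<close>

text \<open>The integer points provide the limit, and the Cauchy condition extends it to all real
  arguments.\<close>

lemma tendsto_at_top_Cauchy:
  fixes F :: "real \<Rightarrow> real"
  assumes C: "\<And>e. 0 < e \<Longrightarrow> \<exists>T. \<forall>x y. T \<le> x \<longrightarrow> x \<le> y \<longrightarrow> \<bar>F y - F x\<bar> \<le> e"
  shows "\<exists>l. (F \<longlongrightarrow> l) at_top"
proof -
  have "Cauchy (\<lambda>n. F (real n))"
  proof (rule CauchyI')
    fix e :: real assume "0 < e"
    then obtain T where T: "\<And>x y. T \<le> x \<Longrightarrow> x \<le> y \<Longrightarrow> \<bar>F y - F x\<bar> \<le> e / 2" using C[of "e / 2"] by auto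
    obtain n0 :: nat where "T \<le> real n0" using real_arch_simple by blast
    then have "dist (F (real m)) (F (real n)) < e" if "n0 \<le> m" "m < n" for m n
      using T[of "real m" "real n"] that \<open>0 < e\<close> by (simp add: dist_real_def abs_minus_commute)
    then show "\<exists>M. \<forall>m\<ge>M. \<forall>n>m. dist (F (real m)) (F (real n)) < e" by blast
  qed
  then obtain l where l: "(\<lambda>n. F (real n)) \<longlonglongrightarrow> l"
    using Cauchy_convergent convergent_def by blast
  have "(F \<longlongrightarrow> l) at_top"
  proof (rule tendstoI)
    fix e :: real assume "0 < e"
    then obtain T where T: "\<And>x y. T \<le> x \<Longrightarrow> x \<le> y \<Longrightarrow> \<bar>F y - F x\<bar> \<le> e / 2" using C[of "e / 2"] by auto
    have "\<bar>l - F x\<bar> \<le> e / 2" if "T \<le> x" for x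
    proof (rule LIMSEQ_le_const2)
      show "(\<lambda>n. \<bar>F (real n) - F x\<bar>) \<longlonglongrightarrow> \<bar>l - F x\<bar>" by (intro tendsto_intros l)
      obtain n0 :: nat where "x \<le> real n0" using real_arch_simple by blast
      then show "\<exists>N. \<forall>n\<ge>N. \<bar>F (real n) - F x\<bar> \<le> e / 2"
        using T[OF that] by (intro exI[of _ n0]) auto
    qed
    then show "\<forall>\<^sub>F x in at_top. dist (F x) l < e"
      using \<open>0 < e\<close> unfolding eventually_at_top_linorder
      by (intro exI[of _ T]) (fastforce simp: dist_real_def abs_minus_commute)
  qed
  then show ?thesis by blast
qed

text \<open>Division by zero yields 0, so a quotient tending to 1 must eventually have a nonzero
  denominator.\<close>

lemma slowly_varying_nonzero:
  assumes "slowly_varying L"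
  shows "\<forall>\<^sub>F t in at_top. L t \<noteq> 0"
proof -
  have "((\<lambda>t. L (2 * t) / L t) \<longlongrightarrow> 1) at_top" using assms by (simp add: slowly_varying_def)
  then have "\<forall>\<^sub>F t in at_top. 0 < L (2 * t) / L t" by (rule order_tendstoD) simp
  then show ?thesis by eventually_elim auto
qed

text \<open>Karamata's uniform convergence theorem. If it failed along \<open>x\<^sub>n\<close>, \<open>u\<^sub>n\<close>, the shifts that behave well at \<open>x\<^sub>n\<close> and
  those that behave well at \<open>x\<^sub>n + u\<^sub>n\<close> would be two subsets of \<open>[0, 3]\<close>, each of measure above \<open>3/2\<close>, and a
  common point is contradictory.\<close>

lemma measurable_additive_uniform:
  fixes h :: "real \<Rightarrow> real"
  assumes [measurable]: "h \<in> borel_measurable borel"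
    and lim: "\<And>u. ((\<lambda>x. h (x + u) - h x) \<longlongrightarrow> 0) at_top" and "0 < \<epsilon>"
  shows "\<exists>X. \<forall>x\<ge>X. \<forall>u\<in>{0..1}. \<bar>h (x + u) - h x\<bar> < \<epsilon>"
proof (rule ccontr)
  assume "\<not> ?thesis"
  then have "\<forall>n::nat. \<exists>x u. real n \<le> x \<and> u \<in> {0..1} \<and> \<epsilon> \<le> \<bar>h (x + u) - h x\<bar>"
    by (meson linorder_not_le)
  then obtain x u where x: "\<And>n. real n \<le> x n" and u: "\<And>n. u n \<in> {0..1}"
    and far: "\<And>n::nat. \<epsilon> \<le> \<bar>h (x n + u n) - h (x n)\<bar>" by metis
  \<comment> \<open>Pointwise convergence makes the sets of good shifts increase to
    \<open>[0, 2]\<close>, so their measure eventually exceeds \<open>3 / 2\<close>. The lower bound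
    \<open>N\<close> on the index permits a common index for both sequences.\<close>
  have big: "\<exists>n. 3 / 2 < measure lborel {s \<in> {0..2}. \<forall>m\<ge>n. \<bar>h (y m + s) - h (y m)\<bar> < \<epsilon> / 2} \<and> N \<le> n"
    if y: "\<And>n. real n \<le> y n" for y :: "nat \<Rightarrow> real" and N
  proof -
    define V where "V n = {s \<in> {0..2::real}. \<forall>m\<ge>n. \<bar>h (y m + s) - h (y m)\<bar> < \<epsilon> / 2}" for n :: nat
    have V: "V n \<in> sets lborel" for n unfolding V_def by measurable
    have "filterlim y at_top sequentially"
      by (rule filterlim_at_top_mono[OF filterlim_real_sequentially]) (simp add: y)
    then have lim0: "(\<lambda>m. h (y m + s) - h (y m)) \<longlonglongrightarrow> 0" for s
      by (rule filterlim_compose[OF lim])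
    have ev: "\<forall>\<^sub>F m in sequentially. \<bar>h (y m + s) - h (y m)\<bar> < \<epsilon> / 2" for s
      using tendstoD[OF lim0[of s], of "\<epsilon> / 2"] \<open>0 < \<epsilon>\<close> by (simp add: dist_real_def)
    have U: "(\<Union>n. V n) = {0..2}"
      using ev unfolding V_def eventually_sequentially by blast
    have "(\<lambda>n. measure lborel (V n)) \<longlonglongrightarrow> measure lborel (\<Union>n. V n)"
    proof (rule Lim_measure_incseq)
      show "range V \<subseteq> sets lborel" using V by auto
      show "incseq V" unfolding V_def incseq_def by auto
      show "emeasure lborel (\<Union>n. V n) \<noteq> \<infinity>" unfolding U by simp
    qed
    then have "(\<lambda>n. measure lborel (V n)) \<longlonglongrightarrow> 2" unfolding U by simp
    then have "\<forall>\<^sub>F n in sequentially. 3 / 2 < measure lborel (V n)" by (rule order_tendstoD) simp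
    then have "\<forall>\<^sub>F n in sequentially. 3 / 2 < measure lborel (V n) \<and> N \<le> n"
      using eventually_ge_at_top by (rule eventually_conj)
    then show ?thesis unfolding V_def by (auto dest: eventually_happens'[OF sequentially_bot])
  qed
  have mono: "measure lborel {s \<in> {0..2}. \<forall>m\<ge>n. \<bar>h (y m + s) - h (y m)\<bar> < \<epsilon> / 2} \<le>
      measure lborel {s \<in> {0..2}. \<bar>h (y k + s) - h (y k)\<bar> < \<epsilon> / 2}" if "n \<le> k" for n k :: nat and y
  proof (rule measure_mono_fmeasurable)
    show "{s \<in> {0..2}. \<bar>h (y k + s) - h (y k)\<bar> < \<epsilon> / 2} \<in> fmeasurable lborel"
    proof (rule fmeasurableI2)
      show "{0..2::real} \<in> fmeasurable lborel" by (intro fmeasurableI) auto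
      show "{s \<in> {0..2}. \<bar>h (y k + s) - h (y k)\<bar> < \<epsilon> / 2} \<in> sets lborel" by measurable
    qed auto
    show "{s \<in> {0..2}. \<forall>m\<ge>n. \<bar>h (y m + s) - h (y m)\<bar> < \<epsilon> / 2} \<in> sets lborel" by measurable
  qed (use that in auto)
  from big[of x 0, OF x] obtain n1 where n1: "3 / 2 < measure lborel {s \<in> {0..2}. \<forall>m\<ge>n1. \<bar>h (x m + s) - h (x m)\<bar> < \<epsilon> / 2}" by auto
  have "real n \<le> x n + u n" for n using x[of n] u[of n] by simp
  from big[of "\<lambda>n. x n + u n" n1, OF this] obtain n where n: "n1 \<le> n"
    "3 / 2 < measure lborel {s \<in> {0..2}. \<forall>m\<ge>n. \<bar>h (x m + u m + s) - h (x m + u m)\<bar> < \<epsilon> / 2}" by auto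
  define V where "V = {s \<in> {0..2}. \<bar>h (x n + s) - h (x n)\<bar> < \<epsilon> / 2}"
  define W where "W = {s \<in> {0..2}. \<bar>h (x n + u n + s) - h (x n + u n)\<bar> < \<epsilon> / 2}"
  have VW: "3 / 2 < measure lborel V" "3 / 2 < measure lborel W"
    using mono[of n1 n x] mono[of n n "\<lambda>n. x n + u n"] n1 n unfolding V_def W_def by auto
  have [measurable]: "V \<in> sets borel" "W \<in> sets borel" unfolding V_def W_def by measurable
  \<comment> \<open>Shifts that are good at \<open>x n + u n\<close>, now measured from
    \<open>x n\<close>; translation preserves their measure.\<close>
  define W' where "W' = {s. s - u n \<in> W}"
  have [measurable]: "W' \<in> sets borel" unfolding W'_def by measurable
  have "emeasure lborel W' = emeasure (distr lborel borel ((+) (u n))) W'"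
    by (simp add: lborel_distr_plus)
  also have "\<dots> = emeasure lborel W"
    by (subst emeasure_distr) (auto simp: W'_def vimage_def)
  finally have eW: "measure lborel W' = measure lborel W" by (simp add: measure_def)
  have sub: "V \<subseteq> {0..3}" "W' \<subseteq> {0..3}"
    using u[of n] unfolding V_def W'_def W_def by auto
  have fm: "V \<in> fmeasurable lborel" "W' \<in> fmeasurable lborel"
  proof -
    have "{0..3::real} \<in> fmeasurable lborel" by (intro fmeasurableI) auto
    then show "V \<in> fmeasurable lborel" "W' \<in> fmeasurable lborel"
      using sub by (auto intro: fmeasurableI2)
  qed
  have "V \<inter> W' \<noteq> {}"
  proof
    assume "V \<inter> W' = {}"
    then have "measure lborel (V \<union> W') = measure lborel V + measure lborel W'"
      using fm by (intro measure_Un3[THEN trans]) auto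
    moreover have "measure lborel (V \<union> W') \<le> measure lborel {0..3::real}"
      using sub fm by (intro measure_mono_fmeasurable) (auto intro!: fmeasurableI)
    ultimately show False using VW eW by simp
  qed
  then obtain s where s: "s \<in> V" "s - u n \<in> W" by (auto simp: W'_def)
  then have "\<bar>h (x n + s) - h (x n)\<bar> < \<epsilon> / 2" "\<bar>h (x n + s) - h (x n + u n)\<bar> < \<epsilon> / 2"
    by (auto simp: V_def W_def)
  then show False using far[of n] by linarith
qed

text \<open>A Potter-type bound. On the logarithmic scale slow variation is additive, and uniform
  convergence lets \<open>h\<close> grow by at most \<open>\<epsilon>\<close> per unit step;
  exponentiating gives the power. Measurability is stated for positive arguments of
  \<open>L\<close>, the only ones on which a formula for the covariance at positive times gives
  information.\<close>

lemma slowly_varying_bound: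
  assumes L: "slowly_varying L" and m: "(\<lambda>x. L (exp x)) \<in> borel_measurable borel" and "0 < \<epsilon>"
  shows "\<exists>T>0. \<exists>C. \<forall>t\<ge>T. \<bar>L t\<bar> \<le> C * t powr \<epsilon>"
proof -
  define h where "h x = ln \<bar>L (exp x)\<bar>" for x
  have hm: "h \<in> borel_measurable borel" unfolding h_def using m by measurable
  have lim: "((\<lambda>x. h (x + u) - h x) \<longlongrightarrow> 0) at_top" for u
  proof -
    have "((\<lambda>t. L (exp u * t) / L t) \<longlongrightarrow> 1) at_top" using L by (simp add: slowly_varying_def)
    from filterlim_compose[OF this exp_at_top]
    have "((\<lambda>x. L (exp (x + u)) / L (exp x)) \<longlongrightarrow> 1) at_top" by (simp add: exp_add mult.commute)
    from tendsto_ln[OF tendsto_rabs[OF this]]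
    have "((\<lambda>x. ln \<bar>L (exp (x + u)) / L (exp x)\<bar>) \<longlongrightarrow> 0) at_top" by simp
    moreover have "\<forall>\<^sub>F x in at_top. ln \<bar>L (exp (x + u)) / L (exp x)\<bar> = h (x + u) - h x"
    proof -
      have e: "\<forall>\<^sub>F x in at_top. L (exp x) \<noteq> 0"
        using slowly_varying_nonzero[OF L] exp_at_top by (rule eventually_compose_filterlim)
      have "filterlim (\<lambda>x. x + u) at_top at_top"
        by (rule filterlim_tendsto_add_at_top[OF tendsto_const filterlim_ident, of u, simplified add.commute])
      from eventually_compose_filterlim[OF e this] e show ?thesis
        by eventually_elim (simp add: h_def abs_divide ln_div)
    qed
    ultimately show ?thesis by (rule Lim_transform_eventually)
  qed
  from measurable_additive_uniform[OF hm lim \<open>0 < \<epsilon>\<close>]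
  obtain X where X: "\<And>x u. X \<le> x \<Longrightarrow> u \<in> {0..1} \<Longrightarrow> \<bar>h (x + u) - h x\<bar> < \<epsilon>" by blast
  have step: "h (X + real k) \<le> h X + \<epsilon> * real k" for k
  proof (induction k)
    case (Suc k)
    have "h (X + real k + 1) \<le> h (X + real k) + \<epsilon>" using X[of "X + real k" 1] by auto
    with Suc show ?case by (simp add: algebra_simps)
  qed simp
  have hb: "h x \<le> h X + \<epsilon> * (x - X + 1)" if "X \<le> x" for x
  proof -
    define k where "k = nat \<lfloor>x - X\<rfloor>"
    have k: "real k \<le> x - X" "x - X < real k + 1" using that by (auto simp: k_def of_nat_nat)
    have "h (X + real k + (x - X - real k)) \<le> h (X + real k) + \<epsilon>"
      using X[of "X + real k" "x - X - real k"] k by auto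
    moreover have "\<epsilon> * real k \<le> \<epsilon> * (x - X)" using k \<open>0 < \<epsilon>\<close> by simp
    ultimately show ?thesis using step[of k] by (simp add: algebra_simps)
  qed
  have "\<bar>L t\<bar> \<le> exp (h X + \<epsilon> * (1 - X)) * t powr \<epsilon>" if t: "exp X \<le> t" for t
  proof -
    have "0 < t" using t by (rule less_le_trans[OF exp_gt_zero])
    then have "X \<le> ln t" using t by (simp add: ln_ge_iff)
    from hb[OF this] have *: "ln \<bar>L t\<bar> \<le> h X + \<epsilon> * (1 - X) + \<epsilon> * ln t"
      using \<open>0 < t\<close> by (simp add: h_def algebra_simps)
    show ?thesis
    proof (cases "L t = 0")
      case False
      then have "\<bar>L t\<bar> = exp (ln \<bar>L t\<bar>)" by simp
      also have "\<dots> \<le> exp (h X + \<epsilon> * (1 - X) + \<epsilon> * ln t)" using * by simp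
      also have "\<dots> = exp (h X + \<epsilon> * (1 - X)) * t powr \<epsilon>"
        using \<open>0 < t\<close> by (simp add: exp_add powr_def)
      finally show ?thesis .
    qed simp
  qed
  then show ?thesis using exp_gt_zero[of X] by blast
qed

lemma integrable_of_powr_bound:
  fixes R :: "real \<Rightarrow> real"
  assumes [measurable]: "R \<in> borel_measurable borel" and b: "\<And>t. \<bar>R t\<bar> \<le> b"
    and "0 < T" "p < -1" and tail: "\<And>t. T \<le> t \<Longrightarrow> \<bar>R t\<bar> \<le> C * t powr p"
  shows "set_integrable lborel {0..} R"
proof -
  have "(\<lambda>x. x powr p) absolutely_integrable_on {T..}"
    using has_integral_powr_to_inf[OF \<open>p < -1\<close> \<open>0 < T\<close>]
    by (intro nonnegative_absolutely_integrable_1) auto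
  then have "integrable lborel (\<lambda>x. indicator {T..} x *\<^sub>R x powr p)"
    unfolding set_integrable_def by (subst (asm) integrable_completion) auto
  then have "set_integrable lborel {T..} (\<lambda>x. C * x powr p)" unfolding set_integrable_def
    using integrable_mult_right[of C lborel "\<lambda>x. indicator {T..} x *\<^sub>R x powr p"] by (simp add: mult_ac)
  then have "set_integrable lborel {T..} R"
  proof (rule set_integrable_bound)
    show "set_borel_measurable lborel {T..} R" unfolding set_borel_measurable_def by measurable
    show "AE x in lborel. x \<in> {T..} \<longrightarrow> norm (R x) \<le> norm (C * x powr p)"
      using tail by (intro AE_I2) (fastforce intro: order_trans[OF _ abs_ge_self])
  qed
  moreover have "set_integrable lborel {0..<T} R"
  proof (rule set_integrable_bound)
    show "set_integrable lborel {0..<T} (\<lambda>_. b)" unfolding set_integrable_def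
      by (simp, rule disjI2, rule integrable_real_indicator) (use \<open>0 < T\<close> in auto)
    show "set_borel_measurable lborel {0..<T} R" unfolding set_borel_measurable_def by measurable
    show "AE x in lborel. x \<in> {0..<T} \<longrightarrow> norm (R x) \<le> norm b"
      using b by (intro AE_I2) (auto intro: order_trans[OF _ abs_ge_self])
  qed
  ultimately have "set_integrable lborel ({0..<T} \<union> {T..}) R" by (intro set_integrable_Un) auto
  moreover have "{0..<T} \<union> {T..} = {0..}" using \<open>0 < T\<close> by auto
  ultimately show ?thesis by simp
qed

lemma regularly_varying_integrable:
  fixes R :: "real \<Rightarrow> real"
  assumes Rm[measurable]: "R \<in> borel_measurable borel" and b: "\<And>t. \<bar>R t\<bar> \<le> b"
    and L: "slowly_varying L" and RL: "\<And>t. 0 < t \<Longrightarrow> R t = L t / t powr \<gamma>" and "1 < \<gamma>"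
  shows "set_integrable lborel {0..} R"
proof -
  have "L (exp x) = R (exp x) * exp x powr \<gamma>" for x using RL[of "exp x"] by simp
  then have m: "(\<lambda>x. L (exp x)) \<in> borel_measurable borel" by simp
  \<comment> \<open>Half of the excess of \<open>\<gamma>\<close> over 1 goes to \<open>L\<close>;
    the exponent \<open>(\<gamma> - 1) / 2 - \<gamma>\<close> is still below -1.\<close>
  have "0 < (\<gamma> - 1) / 2" using \<open>1 < \<gamma>\<close> by simp
  from slowly_varying_bound[OF L m this] obtain T C
    where T: "0 < T" "\<And>t. T \<le> t \<Longrightarrow> \<bar>L t\<bar> \<le> C * t powr ((\<gamma> - 1) / 2)" by blast
  show ?thesis
  proof (rule integrable_of_powr_bound[OF Rm b \<open>0 < T\<close>, where C = C])
    show "(\<gamma> - 1) / 2 - \<gamma> < -1" using \<open>1 < \<gamma>\<close> by (simp add: field_simps)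
    fix t assume t: "T \<le> t"
    then have "\<bar>R t\<bar> = \<bar>L t\<bar> / t powr \<gamma>" using RL[of t] \<open>0 < T\<close> by (simp add: abs_divide)
    also have "\<dots> \<le> C * t powr ((\<gamma> - 1) / 2) / t powr \<gamma>"
      using T(2)[OF t] by (intro divide_right_mono) auto
    also have "\<dots> = C * t powr ((\<gamma> - 1) / 2 - \<gamma>)" by (simp add: powr_diff)
    finally show "\<bar>R t\<bar> \<le> C * t powr ((\<gamma> - 1) / 2 - \<gamma>)" .
  qed
qed

text \<open>Slow increase makes \<open>t L'(t) / L(t) - \<gamma>\<close>, which is \<open>t\<close>
  times the logarithmic derivative of \<open>R\<close>, eventually negative, while \<open>L\<close>,
  continuous and nonzero, keeps a fixed sign \<open>s\<close>. So \<open>s * R\<close> decreases to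
  a limit, and this must be 0 because \<open>R(2 t) / R(t)\<close> tends to
  \<open>2 powr (- \<gamma>)\<close> and not to 1.\<close>

lemma slow_increase_decreasing:
  fixes R :: "real \<Rightarrow> real"
  assumes L: "slowly_varying L" and SI: "slow_increase L" and "0 < \<gamma>"
    and RL: "\<And>t. 0 < t \<Longrightarrow> R t = L t / t powr \<gamma>"
  shows "\<exists>s T. \<bar>s\<bar> = 1 \<and> 0 < T \<and> (\<forall>x y. T \<le> x \<longrightarrow> x \<le> y \<longrightarrow> s * R y \<le> s * R x) \<and> (\<forall>x\<ge>T. 0 \<le> s * R x)
     \<and> ((\<lambda>t. s * R t) \<longlongrightarrow> 0) at_top"
proof -
  have "\<forall>\<^sub>F t in at_top. \<bar>deriv L t / (L t / t)\<bar> < \<gamma>"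
  proof -
    have "((\<lambda>t. deriv L t / (L t / t)) \<longlongrightarrow> 0) at_top" using SI by (simp add: slow_increase_def)
    from tendstoD[OF this \<open>0 < \<gamma>\<close>] show ?thesis by (simp add: dist_real_def)
  qed
  moreover have "\<forall>\<^sub>F t in at_top. L field_differentiable (at t)" using SI by (simp add: slow_increase_def)
  ultimately have "\<forall>\<^sub>F t in at_top. \<bar>deriv L t / (L t / t)\<bar> < \<gamma> \<and> L field_differentiable (at t) \<and> L t \<noteq> 0 \<and> 0 < t"
    using slowly_varying_nonzero[OF L] eventually_gt_at_top[of 0] by eventually_elim auto
  then obtain T0 where T0: "\<And>t. T0 \<le> t \<Longrightarrow> \<bar>deriv L t / (L t / t)\<bar> < \<gamma> \<and> L field_differentiable (at t) \<and> L t \<noteq> 0 \<and> 0 < t"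
    unfolding eventually_at_top_linorder by blast
  define T where "T = max T0 1"
  have T: "0 < T" and der: "\<And>t. T \<le> t \<Longrightarrow> \<bar>deriv L t / (L t / t)\<bar> < \<gamma>"
    and dif: "\<And>t. T \<le> t \<Longrightarrow> (L has_real_derivative deriv L t) (at t)"
    and nz: "\<And>t. T \<le> t \<Longrightarrow> L t \<noteq> 0"
    using T0 by (auto simp: T_def field_differentiable_derivI)
  define s where "s = sgn (L T)"
  have s: "\<bar>s\<bar> = 1" using nz[of T] by (simp add: s_def abs_sgn_eq)
  have cont: "continuous_on {T..} L"
    using dif by (intro continuous_at_imp_continuous_on ballI) (auto intro: DERIV_isCont)
  have pos: "0 < s * L t" if t: "T \<le> t" for t
  proof (rule ccontr)
    assume "\<not> 0 < s * L t"
    then have "s * L t \<le> 0" by simp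
    moreover have "0 \<le> s * L T" by (simp add: s_def mult_sgn_abs sgn_mult_abs abs_sgn[symmetric] mult.commute)
    moreover have "continuous_on {T..t} (\<lambda>t. s * L t)"
      by (intro continuous_intros continuous_on_subset[OF cont]) auto
    ultimately obtain x where "T \<le> x" "x \<le> t" "s * L x = 0"
      using IVT2'[of "\<lambda>t. s * L t" t 0 T] t by auto
    then show False using nz[of x] s by auto
  qed
  have dR: "\<exists>d. ((\<lambda>t. s * R t) has_real_derivative d) (at t) \<and> d \<le> 0" if t: "T \<le> t" for t
  proof -
    have t0: "0 < t" using t T by simp
    have "((\<lambda>t. s * (L t * t powr (- \<gamma>))) has_real_derivative
        s * (deriv L t * t powr (- \<gamma>) + L t * (- \<gamma> * t powr (- \<gamma> - 1)))) (at t)"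
      using t t0 by (auto intro!: derivative_eq_intros dif)
    then have "((\<lambda>t. s * R t) has_real_derivative
        s * (deriv L t * t powr (- \<gamma>) + L t * (- \<gamma> * t powr (- \<gamma> - 1)))) (at t)"
    proof (rule has_field_derivative_transform_within_open[of _ _ _ "{0<..}"])
      show "s * (L x * x powr - \<gamma>) = s * R x" if "x \<in> {0<..}" for x
        using that RL[of x] by (simp add: powr_minus_divide)
    qed (use t0 in auto)
    moreover have "s * (deriv L t * t powr (- \<gamma>) + L t * (- \<gamma> * t powr (- \<gamma> - 1))) =
        s * L t * t powr (- \<gamma> - 1) * (deriv L t / (L t / t) - \<gamma>)"
      using t0 nz[of t] t by (simp add: powr_diff field_simps)
    moreover have "\<dots> \<le> 0"
    proof (intro mult_nonneg_nonpos)
      show "0 \<le> s * L t * t powr (- \<gamma> - 1)" using pos[of t] t by simp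
      show "deriv L t / (L t / t) - \<gamma> \<le> 0" using der[of t] t by linarith
    qed
    ultimately show ?thesis by auto
  qed
  have mono: "s * R y \<le> s * R x" if "T \<le> x" "x \<le> y" for x y
    using \<open>x \<le> y\<close>
  proof (rule DERIV_nonpos_imp_nonincreasing)
    show "\<exists>d. ((\<lambda>t. s * R t) has_real_derivative d) (at t) \<and> d \<le> 0" if "x \<le> t" "t \<le> y" for t
      using dR[of t] that \<open>T \<le> x\<close> by auto
  qed
  have nn: "0 \<le> s * R x" if "T \<le> x" for x
    using pos[OF that] RL[of x] that T by simp
  have lim0: "((\<lambda>t. s * R t) \<longlongrightarrow> 0) at_top"
  proof -
    have "\<exists>l. ((\<lambda>t. s * R t) \<longlongrightarrow> l) at_top"
    proof (rule tendsto_at_top_Cauchy)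
      fix e :: real assume "0 < e"
      have dec: "decseq (\<lambda>n. s * R (T + real n))" by (rule decseq_SucI, rule mono) auto
      have "\<And>n. 0 \<le> s * R (T + real n)" by (rule nn) simp
      then obtain l where l: "(\<lambda>n. s * R (T + real n)) \<longlonglongrightarrow> l" "\<And>n. l \<le> s * R (T + real n)"
        using decseq_convergent[OF dec] by blast
      have "\<forall>\<^sub>F n in sequentially. s * R (T + real n) < l + e"
        using l(1) \<open>0 < e\<close> by (intro order_tendstoD) auto
      then obtain n where n: "s * R (T + real n) < l + e"
        by (auto dest: eventually_happens'[OF sequentially_bot])
      show "\<exists>X. \<forall>x y. X \<le> x \<longrightarrow> x \<le> y \<longrightarrow> \<bar>s * R y - s * R x\<bar> \<le> e"
      proof (intro exI[of _ "T + real n"] allI impI)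
        fix x y assume xy: "T + real n \<le> x" "x \<le> y"
        obtain m :: nat where "y - T \<le> real m" using real_arch_simple by blast
        then have "l \<le> s * R y" using order_trans[OF l(2)[of m] mono[of y "T + real m"]] xy by auto
        moreover have "s * R x \<le> s * R (T + real n)" using mono[of "T + real n" x] xy by auto
        moreover have "s * R y \<le> s * R x" using mono[of x y] xy by auto
        ultimately show "\<bar>s * R y - s * R x\<bar> \<le> e" using n by linarith
      qed
    qed
    then obtain l where l: "((\<lambda>t. s * R t) \<longlongrightarrow> l) at_top" by blast
    have "l = 0"
    proof (rule ccontr)
      assume "l \<noteq> 0"
      have "filterlim (\<lambda>t::real. 2 * t) at_top at_top"
        by (rule filterlim_tendsto_pos_mult_at_top[OF tendsto_const _ filterlim_ident]) simp
      from filterlim_compose[OF l this] have "((\<lambda>t. s * R (2 * t)) \<longlongrightarrow> l) at_top" .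
      from tendsto_divide[OF this l \<open>l \<noteq> 0\<close>]
      have "((\<lambda>t. s * R (2 * t) / (s * R t)) \<longlongrightarrow> 1) at_top" using \<open>l \<noteq> 0\<close> by simp
      moreover have "((\<lambda>t. L (2 * t) / L t * 2 powr (- \<gamma>)) \<longlongrightarrow> 1 * 2 powr (- \<gamma>)) at_top"
        using L by (intro tendsto_mult tendsto_const) (simp add: slowly_varying_def)
      moreover have "\<forall>\<^sub>F t in at_top. L (2 * t) / L t * 2 powr (- \<gamma>) = s * R (2 * t) / (s * R t)"
        using eventually_ge_at_top[of T]
      proof eventually_elim
        case (elim t)
        then show ?case using T s RL[of t] RL[of "2 * t"]
          by (auto simp: powr_mult powr_minus_divide)
      qed
      ultimately have "((\<lambda>t. s * R (2 * t) / (s * R t)) \<longlongrightarrow> 1 * 2 powr (- \<gamma>)) at_top"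
        by (blast intro: Lim_transform_eventually)
      from tendsto_unique[OF _ this \<open>((\<lambda>t. s * R (2 * t) / (s * R t)) \<longlongrightarrow> 1) at_top\<close>]
      have "2 powr (- \<gamma>) = (1::real)" by simp
      then show False using \<open>0 < \<gamma>\<close> by simp
    qed
    with l show ?thesis by simp
  qed
  show ?thesis using s T mono nn lim0 by blast
qed

text \<open>Absolute convergence for \<open>\<gamma> > 1\<close>; otherwise Dirichlet's test, a
  monotone factor tending to 0 against one with bounded integrals. A general \<open>g\<close> lets
  cosine and sine share the proof.\<close>

lemma oscillating_integral_converges:
  fixes R g :: "real \<Rightarrow> real"
  assumes Rm[measurable]: "R \<in> borel_measurable borel" and b: "\<And>t. \<bar>R t\<bar> \<le> b"
    and L: "slowly_varying L" and RL: "\<And>t. 0 < t \<Longrightarrow> R t = L t / t powr \<gamma>" and "0 < \<gamma>"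
    and SI: "\<gamma> \<le> 1 \<Longrightarrow> slow_increase L"
    and gc: "continuous_on UNIV g" and g1: "\<And>t. \<bar>g t\<bar> \<le> 1" and gI: "\<And>x y. x \<le> y \<Longrightarrow> \<bar>integral {x..y} g\<bar> \<le> 2"
  shows "\<exists>l. ((\<lambda>x. LBINT z:{0..x}. R z * g z) \<longlongrightarrow> l) at_top"
proof -
  have [measurable]: "g \<in> borel_measurable borel" using gc by (rule borel_measurable_continuous_onI)
  show ?thesis
  proof (cases "\<gamma> \<le> 1")
    case False
    then have i: "set_integrable lborel {0..} R"
      using regularly_varying_integrable[OF Rm b L RL] by simp
    have "set_integrable lborel {0..} (\<lambda>z. R z * g z)"
    proof (rule set_integrable_bound[OF i])
      show "set_borel_measurable lborel {0..} (\<lambda>z. R z * g z)" unfolding set_borel_measurable_def by measurable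
      show "AE x in lborel. x \<in> {0..} \<longrightarrow> norm (R x * g x) \<le> norm (R x)"
        using g1 by (intro AE_I2) (auto simp: abs_mult intro: mult_right_le_one_le)
    qed
    then show ?thesis using tendsto_set_lebesgue_integral_at_top[of 0 lborel "\<lambda>z. R z * g z"] by auto
  next
    case True
    from slow_increase_decreasing[OF L SI[OF True] \<open>0 < \<gamma>\<close> RL] obtain s T where s: "\<bar>s\<bar> = 1" and "0 < T"
      and mono: "\<And>x y. T \<le> x \<Longrightarrow> x \<le> y \<Longrightarrow> s * R y \<le> s * R x"
      and nn: "\<And>x. T \<le> x \<Longrightarrow> 0 \<le> s * R x" and lim: "((\<lambda>t. s * R t) \<longlongrightarrow> 0) at_top"
      by blast
    have si: "set_integrable lborel A (\<lambda>z. R z * g z)" if A: "A \<in> sets borel" "emeasure lborel A < \<infinity>" for A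
    proof (rule set_integrable_bound)
      show "set_integrable lborel A (\<lambda>_. b)" unfolding set_integrable_def using A by simp
      show "set_borel_measurable lborel A (\<lambda>z. R z * g z)" unfolding set_borel_measurable_def using A(1) by measurable
      have "\<bar>R x * g x\<bar> \<le> \<bar>b\<bar>" for x
        using mult_mono[OF b[of x] g1[of x]] b[of x] by (auto simp: abs_mult)
      then show "AE x in lborel. x \<in> A \<longrightarrow> norm (R x * g x) \<le> norm b" by (intro AE_I2) auto
    qed
    show ?thesis
    proof (rule tendsto_at_top_Cauchy)
      fix e :: real assume "0 < e"
      \<comment> \<open>Each of the two terms of the second mean value theorem carries an integral
        of \<open>g\<close> bounded by 2, whence \<open>e / 4\<close>.\<close>
      then have "\<forall>\<^sub>F t in at_top. s * R t < e / 4" using lim by (intro order_tendstoD) auto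
      then obtain X0 where X0: "\<And>t. X0 \<le> t \<Longrightarrow> s * R t < e / 4" unfolding eventually_at_top_linorder by blast
      show "\<exists>X. \<forall>x y. X \<le> x \<longrightarrow> x \<le> y \<longrightarrow> \<bar>(LBINT z:{0..y}. R z * g z) - (LBINT z:{0..x}. R z * g z)\<bar> \<le> e"
      proof (intro exI[of _ "max X0 T"] allI impI)
        fix x y assume xy: "max X0 T \<le> x" "x \<le> y"
        have "{0..y} = {0..x} \<union> {x<..y}" using xy \<open>0 < T\<close> by auto
        then have "(LBINT z:{0..y}. R z * g z) = (LBINT z:{0..x}. R z * g z) + (LBINT z:{x<..y}. R z * g z)"
          by (simp, intro set_integral_Un) (use xy \<open>0 < T\<close> in \<open>auto intro!: si\<close>)
        moreover have "(LBINT z:{x<..y}. R z * g z) = integral {x..y} (\<lambda>z. R z * g z)"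
        proof -
          have "(LBINT z:{x<..y}. R z * g z) = (LBINT z:{x..y}. R z * g z)"
          proof (rule set_integral_cong_set)
            show "set_borel_measurable lborel {x<..y} (\<lambda>z. R z * g z)" "set_borel_measurable lborel {x..y} (\<lambda>z. R z * g z)"
              unfolding set_borel_measurable_def by measurable
            show "AE z in lborel. (z \<in> {x..y}) = (z \<in> {x<..y})"
              using AE_lborel_singleton[of x] by eventually_elim auto
          qed
          moreover have "set_integrable lborel {x..y} (\<lambda>z. R z * g z)" by (rule si) (use xy in auto)
          ultimately show ?thesis by (simp add: set_borel_integral_eq_integral)
        qed
        moreover have "\<bar>integral {x..y} (\<lambda>z. R z * g z)\<bar> \<le> e"
        proof -
          have gi: "g integrable_on {x..y}" for x y
            by (rule integrable_continuous_real) (rule continuous_on_subset[OF gc], simp)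
          \<comment> \<open>The second mean value theorem is applied to an increasing factor, hence
            the minus sign.\<close>
          obtain c where c: "c \<in> {x..y}" "integral {x..y} (\<lambda>z. - (s * R z) * g z) =
              - (s * R x) * integral {x..c} g + - (s * R y) * integral {c..y} g"
            by (rule second_mean_value_theorem[OF gi, of x y "\<lambda>z. - (s * R z)"]) (use mono xy in auto)
          have "integral {x..y} (\<lambda>z. - (s * R z) * g z) = - s * integral {x..y} (\<lambda>z. R z * g z)"
            by (subst integral_mult_right[symmetric]) (simp add: mult_ac)
          then have "\<bar>integral {x..y} (\<lambda>z. R z * g z)\<bar> = \<bar>(s * R x) * integral {x..c} g + (s * R y) * integral {c..y} g\<bar>"
            using c(2) s by (simp add: abs_mult[symmetric]) (smt (verit) abs_minus_cancel abs_mult mult_cancel_right1 mult_minus_left)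
          also have "\<dots> \<le> (s * R x) * 2 + (s * R y) * 2"
          proof (rule order_trans[OF abs_triangle_ineq add_mono])
            show "\<bar>s * R x * integral {x..c} g\<bar> \<le> s * R x * 2"
              using nn[of x] gI[of x c] c xy by (simp add: abs_mult[of "s * R x"] mult_left_mono)
            show "\<bar>s * R y * integral {c..y} g\<bar> \<le> s * R y * 2"
              using nn[of y] gI[of c y] c xy by (simp add: abs_mult[of "s * R y"] mult_left_mono)
          qed
          also have "\<dots> \<le> e" using X0[of x] X0[of y] xy by simp
          finally show ?thesis .
        qed
        ultimately show "\<bar>(LBINT z:{0..y}. R z * g z) - (LBINT z:{0..x}. R z * g z)\<bar> \<le> e" by simp
      qed
    qed
  qed
qed

lemma integral_sin_cos_bounded:
  fixes x y :: real
  assumes "x \<le> y"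
  shows "\<bar>integral {x..y} cos\<bar> \<le> 2" "\<bar>integral {x..y} sin\<bar> \<le> 2"
proof -
  have "(cos has_integral sin y - sin x) {x..y}"
    using assms by (intro fundamental_theorem_of_calculus)
      (auto intro!: derivative_eq_intros simp: has_real_derivative_iff_has_vector_derivative[symmetric])
  moreover have "(sin has_integral - cos y - - cos x) {x..y}"
    using assms by (intro fundamental_theorem_of_calculus)
      (auto intro!: derivative_eq_intros simp: has_real_derivative_iff_has_vector_derivative[symmetric])
  ultimately have e: "integral {x..y} cos = sin y - sin x" "integral {x..y} sin = - cos y - - cos x"
    by (simp_all only: integral_unique)
  show "\<bar>integral {x..y} cos\<bar> \<le> 2" "\<bar>integral {x..y} sin\<bar> \<le> 2"
    unfolding e using sin_le_one[of x] sin_le_one[of y] cos_le_one[of x] cos_le_one[of y]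
      sin_ge_minus_one[of x] sin_ge_minus_one[of y] cos_ge_minus_one[of x] cos_ge_minus_one[of y]
    by linarith+
qed

section \<open>Covariance of filtered stationary noise\<close>

text \<open>Bounded with bounded support in \<open>[0, \<infinity>)\<close>: enough to make time
  integrals of the noise square integrable, and stable under linear combinations.\<close>

definition admissible :: "(real \<Rightarrow> real) \<Rightarrow> bool" where
  "admissible f \<longleftrightarrow> f \<in> borel_measurable borel \<and> (\<exists>B T. \<forall>s. \<bar>f s\<bar> \<le> B * indicator {0..T} s)"

lemma admissible_measurable[measurable_dest]: "admissible f \<Longrightarrow> f \<in> borel_measurable borel"
  by (simp add: admissible_def)

lemma admissible_bounds:
  assumes "admissible f"
  shows "\<exists>B T. 0 \<le> B \<and> 0 \<le> T \<and> (\<forall>s. \<bar>f s\<bar> \<le> B * indicator {0..T} s)"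
proof -
  from assms obtain B T where b: "\<And>s. \<bar>f s\<bar> \<le> B * indicator {0..T} s" by (auto simp: admissible_def)
  have "\<bar>f s\<bar> \<le> \<bar>B\<bar> * indicator {0..\<bar>T\<bar>} s" for s
    using b[of s] by (cases "s \<in> {0..T}") auto
  then show ?thesis by (intro exI[of _ "\<bar>B\<bar>"] exI[of _ "\<bar>T\<bar>"]) auto
qed

lemma admissible_indicator:
  assumes "\<phi> \<in> borel_measurable borel" "\<And>s. \<bar>\<phi> s\<bar> \<le> b" "0 \<le> a"
  shows "admissible (\<lambda>s. indicator {a..x} s * \<phi> s)"
proof -
  have "0 \<le> b" using assms(2)[of 0] by simp
  then have "\<bar>indicator {a..x} s * \<phi> s\<bar> \<le> b * indicator {0..x} s" for s
    using assms(2)[of s] \<open>0 \<le> a\<close> by (auto simp: indicator_def)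
  then show ?thesis unfolding admissible_def using assms(1) by auto
qed

lemma admissible_add: "admissible f \<Longrightarrow> admissible g \<Longrightarrow> admissible (\<lambda>s. f s + g s)"
proof -
  assume f: "admissible f" and g: "admissible g"
  obtain B T where f': "0 \<le> B" "0 \<le> T" "\<And>s. \<bar>f s\<bar> \<le> B * indicator {0..T} s" using admissible_bounds[OF f] by blast
  obtain B' T' where g': "0 \<le> B'" "0 \<le> T'" "\<And>s. \<bar>g s\<bar> \<le> B' * indicator {0..T'} s" using admissible_bounds[OF g] by blast
  have "\<bar>f s + g s\<bar> \<le> (B + B') * indicator {0..max T T'} s" for s
  proof -
    have "\<bar>f s + g s\<bar> \<le> B * indicator {0..T} s + B' * indicator {0..T'} s"
      using f'(3)[of s] g'(3)[of s] by linarith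
    also have "\<dots> \<le> B * indicator {0..max T T'} s + B' * indicator {0..max T T'} s"
      using f'(1) g'(1) by (intro add_mono mult_left_mono) (auto simp: indicator_def)
    finally show ?thesis by (simp add: distrib_right)
  qed
  then show "admissible (\<lambda>s. f s + g s)"
    using f g unfolding admissible_def
    by (intro conjI exI[of _ "B + B'"] exI[of _ "max T T'"] allI) auto
qed

lemma admissible_cmult: "admissible f \<Longrightarrow> admissible (\<lambda>s. c * f s)"
proof -
  assume f: "admissible f"
  obtain B T where f': "0 \<le> B" "0 \<le> T" "\<And>s. \<bar>f s\<bar> \<le> B * indicator {0..T} s" using admissible_bounds[OF f] by blast
  have "\<bar>c * f s\<bar> \<le> (\<bar>c\<bar> * B) * indicator {0..T} s" for s
    using mult_left_mono[OF f'(3)[of s], of "\<bar>c\<bar>"] by (simp add: abs_mult mult.assoc)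
  then show "admissible (\<lambda>s. c * f s)"
    using f unfolding admissible_def by (intro conjI exI[of _ "\<bar>c\<bar> * B"] exI[of _ T] allI) auto
qed

lemma admissible_sum: "finite J \<Longrightarrow> (\<And>i. i \<in> J \<Longrightarrow> admissible (f i)) \<Longrightarrow> admissible (\<lambda>s. \<Sum>i\<in>J. f i s)"
proof (induction J rule: finite_induct)
  case empty
  then show ?case by (auto simp: admissible_def intro!: exI[of _ 0])
next
  case (insert i J)
  then show ?case by (simp add: admissible_add)
qed

text \<open>For \<open>\<rho>\<close> vanishing on negative arguments this is the double integral of
  \<open>f(s) g(t) \<rho>(t - s)\<close> over \<open>s \<le> t\<close>, with the lag
  \<open>z = t - s\<close> as inner variable so that trigonometric \<open>g\<close> can be expanded
  in it.\<close>

definition lag_form :: "(real \<Rightarrow> real) \<Rightarrow> (real \<Rightarrow> real) \<Rightarrow> (real \<Rightarrow> real) \<Rightarrow> real" where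
  "lag_form \<rho> f g = (LBINT s. f s * (LBINT z. g (s + z) * \<rho> z))"

lemma integrable_bounded_support:
  fixes f :: "real \<Rightarrow> real"
  assumes "f \<in> borel_measurable borel" "\<And>s. \<bar>f s\<bar> \<le> B * indicator {c..d} s"
  shows "integrable lborel f"
proof (rule Bochner_Integration.integrable_bound)
  show "integrable lborel (\<lambda>s. B * indicator {c..d} s)"
    by (intro integrable_mult_right integrable_real_indicator) (auto simp: emeasure_lborel_Icc_eq)
  show "AE s in lborel. norm (f s) \<le> norm (B * indicator {c..d} s)"
    using assms(2) by (intro AE_I2) (auto intro: order_trans[OF _ abs_ge_self])
qed (use assms in auto)

section \<open>Double integrals against a kernel supported on nonnegative lags\<close>

context
  fixes \<rho> :: "real \<Rightarrow> real" and b :: real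
  assumes \<rho>m[measurable]: "\<rho> \<in> borel_measurable borel" and \<rho>b: "\<And>z. \<bar>\<rho> z\<bar> \<le> b"
    and \<rho>0: "\<And>z. z < 0 \<Longrightarrow> \<rho> z = 0"
begin

lemma lag_inner_integrable:
  assumes f: "admissible f"
  shows "integrable lborel (\<lambda>t. f t * \<rho> (t - s))" "integrable lborel (\<lambda>t. f t * \<rho> (s - t))"
proof -
  obtain B T where B: "0 \<le> B" "\<And>s. \<bar>f s\<bar> \<le> B * indicator {0..T} s" using admissible_bounds[OF f] by blast
  have [measurable]: "f \<in> borel_measurable borel" using f by (rule admissible_measurable)
  have "\<bar>f t * \<rho> y\<bar> \<le> (B * b) * indicator {0..T} t" for t y
  proof -
    have "\<bar>f t * \<rho> y\<bar> \<le> (B * indicator {0..T} t) * b"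
      unfolding abs_mult using B \<rho>b[of y] by (intro mult_mono) auto
    then show ?thesis by (simp add: mult_ac)
  qed
  then show "integrable lborel (\<lambda>t. f t * \<rho> (t - s))" "integrable lborel (\<lambda>t. f t * \<rho> (s - t))"
    by (auto intro!: integrable_bounded_support[of _ "B * b" 0 T])
qed

text \<open>The plane is split along the diagonal, a null set on which both halves would count
  \<open>\<rho> 0\<close>. By Fubini the half \<open>t < s\<close> is a lag form with the two
  functions exchanged.\<close>

lemma lag_form_double:
  assumes f: "admissible f" and g: "admissible g"
  shows "(LBINT s. f s * (LBINT t. g t * \<rho> \<bar>t - s\<bar>)) = lag_form \<rho> f g + lag_form \<rho> g f"
proof -
  obtain Bf Tf where Bf: "0 \<le> Bf" "0 \<le> Tf" "\<And>s. \<bar>f s\<bar> \<le> Bf * indicator {0..Tf} s" using admissible_bounds[OF f] by blast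
  obtain Bg Tg where Bg: "0 \<le> Bg" "0 \<le> Tg" "\<And>s. \<bar>g s\<bar> \<le> Bg * indicator {0..Tg} s" using admissible_bounds[OF g] by blast
  have [measurable]: "f \<in> borel_measurable borel" "g \<in> borel_measurable borel"
    using f g by (auto dest: admissible_measurable)
  have shift: "(LBINT t. h t * \<rho> (t - s)) = (LBINT z. h (s + z) * \<rho> z)" for h :: "real \<Rightarrow> real" and s
    using lborel_integral_real_affine[of 1 "\<lambda>t. h t * \<rho> (t - s)" s] by simp
  have "0 \<le> b" using \<rho>b[of 0] by simp
  have pairint: "integrable (lborel \<Otimes>\<^sub>M lborel) (\<lambda>(s, t). f s * (g t * k s t))"
    if [measurable]: "(\<lambda>(s, t). k s t) \<in> borel_measurable (borel \<Otimes>\<^sub>M borel)"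
      and k: "\<And>s t. \<bar>k s t\<bar> \<le> b" for k
  proof (rule Bochner_Integration.integrable_bound)
    show "integrable (lborel \<Otimes>\<^sub>M lborel) (\<lambda>p. (Bf * Bg * b) * indicator ({0..Tf} \<times> {0..Tg}) p)"
      using Bf Bg by (intro integrable_mult_right integrable_real_indicator)
        (auto simp: lborel.emeasure_pair_measure_Times ennreal_mult_less_top)
    have "\<bar>f s * (g t * k s t)\<bar> \<le> (Bf * Bg * b) * indicator ({0..Tf} \<times> {0..Tg}) (s, t)" for s t
    proof -
      have "\<bar>g t * k s t\<bar> \<le> (Bg * indicator {0..Tg} t) * b"
        unfolding abs_mult using Bg k[of s t] by (intro mult_mono) auto
      then have "\<bar>f s * (g t * k s t)\<bar> \<le> (Bf * indicator {0..Tf} s) * ((Bg * indicator {0..Tg} t) * b)"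
        unfolding abs_mult[of "f s"] using Bf by (intro mult_mono) auto
      then show ?thesis by (simp add: indicator_times mult_ac)
    qed
    then show "AE x in lborel \<Otimes>\<^sub>M lborel. norm (case x of (s, t) \<Rightarrow> f s * (g t * k s t))
        \<le> norm ((Bf * Bg * b) * indicator ({0..Tf} \<times> {0..Tg}) x)"
      by (intro AE_I2) (auto intro: order_trans[OF _ abs_ge_self])
  qed measurable
  have i1: "integrable (lborel \<Otimes>\<^sub>M lborel) (\<lambda>(s, t). f s * (g t * \<rho> (t - s)))"
    by (rule pairint) (auto simp: \<rho>b)
  have i2: "integrable (lborel \<Otimes>\<^sub>M lborel) (\<lambda>(s, t). f s * (g t * \<rho> (s - t)))"
    by (rule pairint) (auto simp: \<rho>b)
  have "(LBINT t. g t * \<rho> \<bar>t - s\<bar>) = (LBINT t. g t * \<rho> (t - s)) + (LBINT t. g t * \<rho> (s - t))" for s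
  proof -
    have "(LBINT t. g t * \<rho> \<bar>t - s\<bar>) = (LBINT t. g t * \<rho> (t - s) + g t * \<rho> (s - t))"
    proof (rule integral_cong_AE)
      show "AE t in lborel. g t * \<rho> \<bar>t - s\<bar> = g t * \<rho> (t - s) + g t * \<rho> (s - t)"
        using AE_lborel_singleton[of s]
      proof eventually_elim
        case (elim t)
        then show ?case using \<rho>0[of "t - s"] \<rho>0[of "s - t"] by (cases "s < t") auto
      qed
    qed auto
    then show ?thesis using lag_inner_integrable[OF g] by simp
  qed
  then have "(LBINT s. f s * (LBINT t. g t * \<rho> \<bar>t - s\<bar>)) =
      (LBINT s. (LBINT t. f s * (g t * \<rho> (t - s))) + (LBINT t. f s * (g t * \<rho> (s - t))))"
    by (simp add: distrib_left)
  also have "\<dots> = (LBINT s. LBINT t. f s * (g t * \<rho> (t - s))) + (LBINT s. LBINT t. f s * (g t * \<rho> (s - t)))"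
    using lborel_pair.integrable_fst'[OF i1] lborel_pair.integrable_fst'[OF i2] by simp
  also have "(LBINT s. LBINT t. f s * (g t * \<rho> (t - s))) = lag_form \<rho> f g"
    unfolding lag_form_def by (simp add: shift)
  also have "(LBINT s. LBINT t. f s * (g t * \<rho> (s - t))) = (LBINT t. LBINT s. f s * (g t * \<rho> (s - t)))"
    using lborel_pair.Fubini_integral[OF i2] by simp
  also have "\<dots> = (LBINT t. g t * (LBINT s. f s * \<rho> (s - t)))"
    by (subst integral_mult_right_zero[symmetric]) (simp add: mult_ac)
  also have "\<dots> = lag_form \<rho> g f"
    unfolding lag_form_def by (simp add: shift)
  finally show ?thesis .
qed

text \<open>When \<open>\<rho>\<close> is not integrable, this truncated integral is the quantity
  that can still be bounded; covariances are expressed through it and its sine counterpart.\<close>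

definition cosine_integral :: "real \<Rightarrow> real" where
  "cosine_integral u = (LBINT z:{0..u}. \<rho> z * cos z)"

definition sine_integral :: "real \<Rightarrow> real" where
  "sine_integral u = (LBINT z:{0..u}. \<rho> z * sin z)"

lemma trig_integrand_integrable:
  "set_integrable lborel {0..u} (\<lambda>z. \<rho> z * cos z)" "set_integrable lborel {0..u} (\<lambda>z. \<rho> z * sin z)"
proof -
  have "\<bar>indicator {0..u} z * (\<rho> z * y)\<bar> \<le> b * indicator {0..u} z" if "\<bar>y\<bar> \<le> 1" for z y
    using mult_mono[OF \<rho>b[of z] that] \<rho>b[of z] by (auto simp: indicator_def abs_mult)
  then show "set_integrable lborel {0..u} (\<lambda>z. \<rho> z * cos z)" "set_integrable lborel {0..u} (\<lambda>z. \<rho> z * sin z)"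
    unfolding set_integrable_def by (auto intro!: integrable_bounded_support[of _ b 0 u])
qed

lemma measurable_trig_integral:
  "cosine_integral \<in> borel_measurable borel" "sine_integral \<in> borel_measurable borel"
proof -
  have "cosine_integral = (\<lambda>u. LBINT z. if 0 \<le> z \<and> z \<le> u then \<rho> z * cos z else 0)"
    "sine_integral = (\<lambda>u. LBINT z. if 0 \<le> z \<and> z \<le> u then \<rho> z * sin z else 0)"
    by (auto simp: fun_eq_iff cosine_integral_def sine_integral_def set_lebesgue_integral_def
        intro!: Bochner_Integration.integral_cong)
  moreover have "(\<lambda>u. LBINT z. if 0 \<le> z \<and> z \<le> u then \<rho> z * cos z else 0) \<in> borel_measurable borel"
    "(\<lambda>u. LBINT z. if 0 \<le> z \<and> z \<le> u then \<rho> z * sin z else 0) \<in> borel_measurable borel"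
    by (rule lborel.borel_measurable_lebesgue_integral; measurable)+
  ultimately show "cosine_integral \<in> borel_measurable borel" "sine_integral \<in> borel_measurable borel"
    by simp_all
qed

text \<open>The addition formula separates the time \<open>s\<close> from the lag \<open>z\<close>,
  and the indicator of \<open>[a, y]\<close> cuts the lag integral at \<open>y - s\<close>.\<close>

lemma lag_form_trig:
  assumes add: "\<And>s z. \<psi> (s + z) = \<psi> s * cos z + \<psi>' s * sin z"
  shows "lag_form \<rho> (\<lambda>s. indicator {a..x} s * \<phi> s) (\<lambda>s. indicator {a..y} s * \<psi> s) =
    (LBINT s:{a..min x y}. \<phi> s * (\<psi> s * cosine_integral (y - s) + \<psi>' s * sine_integral (y - s)))"
  unfolding lag_form_def set_lebesgue_integral_def
proof (rule Bochner_Integration.integral_cong[OF refl])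
  fix s
  show "indicator {a..x} s * \<phi> s * (LBINT z. indicator {a..y} (s + z) * \<psi> (s + z) * \<rho> z) =
      indicator {a..min x y} s *\<^sub>R (\<phi> s * (\<psi> s * cosine_integral (y - s) + \<psi>' s * sine_integral (y - s)))"
  proof (cases "a \<le> s \<and> s \<le> x")
    case True
    have "(LBINT z. indicator {a..y} (s + z) * \<psi> (s + z) * \<rho> z) =
        (LBINT z. \<psi> s * (indicator {0..y - s} z *\<^sub>R (\<rho> z * cos z)) + \<psi>' s * (indicator {0..y - s} z *\<^sub>R (\<rho> z * sin z)))"
    proof (rule Bochner_Integration.integral_cong[OF refl])
      fix z
      show "indicator {a..y} (s + z) * \<psi> (s + z) * \<rho> z =
          \<psi> s * (indicator {0..y - s} z *\<^sub>R (\<rho> z * cos z)) + \<psi>' s * (indicator {0..y - s} z *\<^sub>R (\<rho> z * sin z))"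
        using True \<rho>0[of z] by (cases "z < 0") (auto simp: indicator_def add algebra_simps)
    qed
    also have "\<dots> = \<psi> s * cosine_integral (y - s) + \<psi>' s * sine_integral (y - s)"
      using trig_integrand_integrable[of "y - s"]
      unfolding cosine_integral_def sine_integral_def set_lebesgue_integral_def set_integrable_def by simp
    finally have e: "(LBINT z. indicator {a..y} (s + z) * \<psi> (s + z) * \<rho> z) =
        \<psi> s * cosine_integral (y - s) + \<psi>' s * sine_integral (y - s)" .
    \<comment> \<open>For \<open>s > y\<close> the lag interval is empty, which produces the upper
      limit \<open>min x y\<close>.\<close>
    show ?thesis
    proof (cases "s \<le> y")
      case False
      then have "cosine_integral (y - s) = 0" "sine_integral (y - s) = 0"
        by (auto simp: cosine_integral_def sine_integral_def set_lebesgue_integral_def)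
      then show ?thesis unfolding e by simp
    qed (use True e in \<open>auto simp: indicator_def\<close>)
  qed (auto simp: indicator_def)
qed

end

text \<open>\<open>G (\<beta> * T - s)\<close> is close to \<open>l\<close> except near
  \<open>s = \<beta> * T\<close>, a range negligible after division by \<open>T\<close>. Scaling
  \<open>s = T * u\<close> turns this into dominated convergence for \<open>G - l\<close>; the
  constant \<open>l\<close> then meets only the mean \<open>\<kappa>\<close> of
  \<open>\<theta>\<close>.\<close>

lemma averaging_limit:
  fixes \<theta> G :: "real \<Rightarrow> real"
  assumes [measurable]: "\<theta> \<in> borel_measurable borel" "G \<in> borel_measurable borel"
    and \<theta>1: "\<And>s. \<bar>\<theta> s\<bar> \<le> 1" and Gb: "\<And>u. \<bar>G u\<bar> \<le> C" and lim: "(G \<longlongrightarrow> l) at_top"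
    and mean: "\<And>m. 0 \<le> m \<Longrightarrow> \<bar>(LBINT s:{0..m}. \<theta> s) - \<kappa> * m\<bar> \<le> c"
    and \<mu>: "0 \<le> \<mu>" "\<mu> \<le> \<beta>"
  shows "((\<lambda>T. (1 / T) * (LBINT s:{0..\<mu> * T}. \<theta> s * G (\<beta> * T - s))) \<longlongrightarrow> \<mu> * \<kappa> * l) at_top"
proof -
  have "0 \<le> C" using Gb[of 0] by simp
  have i\<theta>: "integrable lborel (\<lambda>s. indicator {0..m} s * (\<theta> s * k s))"
    if [measurable]: "k \<in> borel_measurable borel" and k: "\<And>s. \<bar>k s\<bar> \<le> d" for m d k
  proof (rule integrable_bounded_support)
    show "\<bar>indicator {0..m} s * (\<theta> s * k s)\<bar> \<le> d * indicator {0..m} s" for s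
      using mult_mono[OF \<theta>1[of s] k[of s]] by (auto simp: indicator_def abs_mult)
  qed simp
  have step: "(1 / T) * (LBINT s:{0..\<mu> * T}. \<theta> s * G (\<beta> * T - s)) =
      (LBINT u. indicator {0..\<mu>} u * (\<theta> (T * u) * (G (T * (\<beta> - u)) - l))) + l * ((1 / T) * (LBINT s:{0..\<mu> * T}. \<theta> s))"
    if "0 < T" for T
  proof -
    have "(LBINT s:{0..\<mu> * T}. \<theta> s * G (\<beta> * T - s)) =
        (LBINT s. indicator {0..\<mu> * T} s * (\<theta> s * (G (\<beta> * T - s) - l)) + l * (indicator {0..\<mu> * T} s * (\<theta> s * 1)))"
      unfolding set_lebesgue_integral_def
      by (rule Bochner_Integration.integral_cong) (auto simp: algebra_simps)
    also have "\<dots> = (LBINT s. indicator {0..\<mu> * T} s * (\<theta> s * (G (\<beta> * T - s) - l))) + l * (LBINT s:{0..\<mu> * T}. \<theta> s)"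
    proof (subst Bochner_Integration.integral_add)
      have "\<bar>G (\<beta> * T - s) - l\<bar> \<le> C + \<bar>l\<bar>" for s
        by (rule order_trans[OF abs_triangle_ineq4]) (simp add: Gb)
      then show "integrable lborel (\<lambda>s. indicator {0..\<mu> * T} s * (\<theta> s * (G (\<beta> * T - s) - l)))"
        by (intro i\<theta>) auto
      show "integrable lborel (\<lambda>s. l * (indicator {0..\<mu> * T} s * (\<theta> s * 1)))"
        by (intro integrable_mult_right i\<theta>[of "\<lambda>_. 1" 1]) auto
    qed (simp add: set_lebesgue_integral_def)
    also have "(LBINT s. indicator {0..\<mu> * T} s * (\<theta> s * (G (\<beta> * T - s) - l))) =
        T * (LBINT u. indicator {0..\<mu> * T} (T * u) * (\<theta> (T * u) * (G (\<beta> * T - T * u) - l)))"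
      using that lborel_integral_real_affine[of T "\<lambda>s. indicator {0..\<mu> * T} s * (\<theta> s * (G (\<beta> * T - s) - l))" 0] by simp
    also have "(\<lambda>u. indicator {0..\<mu> * T} (T * u) * (\<theta> (T * u) * (G (\<beta> * T - T * u) - l))) =
        (\<lambda>u. indicator {0..\<mu>} u * (\<theta> (T * u) * (G (T * (\<beta> - u)) - l)))"
      using that by (auto simp: fun_eq_iff indicator_def algebra_simps zero_le_mult_iff)
    finally show ?thesis using that by (simp add: field_simps)
  qed
  have l1: "((\<lambda>T. LBINT u. indicator {0..\<mu>} u * (\<theta> (T * u) * (G (T * (\<beta> - u)) - l))) \<longlongrightarrow> (LBINT u::real. 0)) at_top"
  proof (rule integral_dominated_convergence_at_top[where w = "\<lambda>u. (C + \<bar>l\<bar>) * indicator {0..\<mu>} u"])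
    show "integrable lborel (\<lambda>u. (C + \<bar>l\<bar>) * indicator {0..\<mu>} u)"
      using \<open>0 \<le> C\<close> by (intro integrable_bounded_support[of _ "C + \<bar>l\<bar>" 0 \<mu>]) auto
    have "\<bar>indicator {0..\<mu>} u * (\<theta> (T * u) * (G (T * (\<beta> - u)) - l))\<bar> \<le> (C + \<bar>l\<bar>) * indicator {0..\<mu>} u" for T u
    proof -
      have "\<bar>G (T * (\<beta> - u)) - l\<bar> \<le> C + \<bar>l\<bar>"
        by (rule order_trans[OF abs_triangle_ineq4]) (simp add: Gb)
      from mult_mono[OF \<theta>1[of "T * u"] this] show ?thesis by (auto simp: indicator_def abs_mult)
    qed
    then show "\<forall>\<^sub>F T in at_top. AE u in lborel. norm (indicator {0..\<mu>} u * (\<theta> (T * u) * (G (T * (\<beta> - u)) - l))) \<le> (C + \<bar>l\<bar>) * indicator {0..\<mu>} u"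
      by simp
    \<comment> \<open>On the support, only at \<open>u = \<beta>\<close>, possible when
      \<open>\<mu> = \<beta>\<close>, does the argument of \<open>G\<close> fail to grow.\<close>
    show "AE u in lborel. ((\<lambda>T. indicator {0..\<mu>} u * (\<theta> (T * u) * (G (T * (\<beta> - u)) - l))) \<longlongrightarrow> 0) at_top"
      using AE_lborel_singleton[of \<beta>]
    proof eventually_elim
      case (elim u)
      show ?case
      proof (cases "u \<in> {0..\<mu>}")
        case True
        then have "0 < \<beta> - u" using elim \<mu> by auto
        then have "filterlim (\<lambda>T. T * (\<beta> - u)) at_top at_top"
          by (intro filterlim_at_top_mult_tendsto_pos[OF tendsto_const]) (auto intro: filterlim_ident)
        from LIM_zero[OF filterlim_compose[OF lim this]]
        have z: "((\<lambda>T. G (T * (\<beta> - u)) - l) \<longlongrightarrow> 0) at_top" .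
        show ?thesis
        proof (rule Lim_null_comparison[OF _ tendsto_rabs_zero[OF z]])
          show "\<forall>\<^sub>F T in at_top. norm (indicator {0..\<mu>} u * (\<theta> (T * u) * (G (T * (\<beta> - u)) - l))) \<le> \<bar>G (T * (\<beta> - u)) - l\<bar>"
            using \<theta>1 True by (intro always_eventually allI) (simp add: abs_mult mult_left_le_one_le)
        qed
      qed simp
    qed
  qed measurable
  have l2: "((\<lambda>T. (1 / T) * (LBINT s:{0..\<mu> * T}. \<theta> s)) \<longlongrightarrow> \<kappa> * \<mu>) at_top"
  proof -
    have "((\<lambda>T. (1 / T) * (LBINT s:{0..\<mu> * T}. \<theta> s) - \<kappa> * \<mu>) \<longlongrightarrow> 0) at_top"
    proof (rule Lim_null_comparison)
      show "((\<lambda>T. c * inverse T) \<longlongrightarrow> 0) at_top"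
        by (intro tendsto_mult_right_zero tendsto_inverse_0_at_top filterlim_ident)
      show "\<forall>\<^sub>F T in at_top. norm ((1 / T) * (LBINT s:{0..\<mu> * T}. \<theta> s) - \<kappa> * \<mu>) \<le> c * inverse T"
        using eventually_gt_at_top[of 0]
      proof eventually_elim
        case (elim T)
        have "(1 / T) * (LBINT s:{0..\<mu> * T}. \<theta> s) - \<kappa> * \<mu> = ((LBINT s:{0..\<mu> * T}. \<theta> s) - \<kappa> * (\<mu> * T)) / T"
          using elim by (simp add: field_simps)
        also have "norm \<dots> \<le> c / T"
          using mean[of "\<mu> * T"] elim \<mu> by (simp add: abs_divide divide_right_mono)
        finally show ?case by (simp add: divide_inverse)
      qed
    qed
    then show ?thesis by (rule LIM_zero_cancel)
  qed
  have "((\<lambda>T. (LBINT u. indicator {0..\<mu>} u * (\<theta> (T * u) * (G (T * (\<beta> - u)) - l))) + l * ((1 / T) * (LBINT s:{0..\<mu> * T}. \<theta> s)))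
      \<longlongrightarrow> (LBINT u::real. 0) + l * (\<kappa> * \<mu>)) at_top"
    by (intro tendsto_add l1 tendsto_mult tendsto_const l2)
  then have "((\<lambda>T. (LBINT u. indicator {0..\<mu>} u * (\<theta> (T * u) * (G (T * (\<beta> - u)) - l))) + l * ((1 / T) * (LBINT s:{0..\<mu> * T}. \<theta> s)))
      \<longlongrightarrow> \<mu> * \<kappa> * l) at_top" by (simp add: mult_ac)
  then show ?thesis
    by (rule Lim_transform_eventually) (rule eventually_mono[OF eventually_gt_at_top[of 0]], rule step[symmetric])
qed

section \<open>Time integrals of stationary Gaussian noise\<close>

locale stationary_noise = prob_space M for M :: "'a measure" +
  fixes v :: "real \<Rightarrow> 'a \<Rightarrow> real"
  assumes noise: "stationary_gaussian_noise M v"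
begin

definition noise_ext :: "real \<Rightarrow> 'a \<Rightarrow> real" where
  "noise_ext t \<omega> = (if 0 \<le> t then v t \<omega> else 0)"

text \<open>Both extensions by zero are deliberate: \<open>noise_ext\<close> is measurable on all of \<open>\<real>\<close>, and
  \<open>covar \<bar>t - s\<bar> = covar (t - s) + covar (s - t)\<close> for \<open>s \<noteq> t\<close>.\<close>

definition covar :: "real \<Rightarrow> real" where
  "covar z = (if 0 \<le> z then autocovariance M v z else 0)"

definition noise_integral :: "(real \<Rightarrow> real) \<Rightarrow> 'a \<Rightarrow> real" where
  "noise_integral f \<omega> = (LBINT s. f s * noise_ext s \<omega>)"

lemma noise_ext_measurable[measurable]:
  "(\<lambda>p. noise_ext (fst p) (snd p)) \<in> borel_measurable (borel \<Otimes>\<^sub>M M)"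
proof -
  have v: "(\<lambda>(t, \<omega>). v t \<omega>) \<in> borel_measurable (restrict_space borel {0..} \<Otimes>\<^sub>M M)"
    using noise by (simp add: stationary_gaussian_noise_def measurable_process_def)
  \<comment> \<open>Clamping time at 0 pulls joint measurability back from the restricted time
    axis.\<close>
  have "(\<lambda>p :: real \<times> 'a. (max 0 (fst p), snd p)) \<in> (borel \<Otimes>\<^sub>M M) \<rightarrow>\<^sub>M (restrict_space borel {0..} \<Otimes>\<^sub>M M)"
    by (intro measurable_Pair measurable_restrict_space2) auto
  from measurable_compose[OF this v]
  have [measurable]: "(\<lambda>p. v (max 0 (fst p)) (snd p)) \<in> borel_measurable (borel \<Otimes>\<^sub>M M)" by simp
  have "(\<lambda>p. noise_ext (fst p) (snd p)) = (\<lambda>p. if 0 \<le> fst p then v (max 0 (fst p)) (snd p) else 0)"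
    by (auto simp: noise_ext_def max_def fun_eq_iff)
  also have "\<dots> \<in> borel_measurable (borel \<Otimes>\<^sub>M M)" by measurable
  finally show ?thesis .
qed

lemma noise_ext_measurable_compose[measurable (raw)]:
  assumes [measurable]: "f \<in> borel_measurable N" "g \<in> N \<rightarrow>\<^sub>M M"
  shows "(\<lambda>x. noise_ext (f x) (g x)) \<in> borel_measurable N"
  using measurable_compose[OF _ noise_ext_measurable, of "\<lambda>x. (f x, g x)"] by simp

lemma noise_span_gaussian:
  assumes J: "finite J" "J \<subseteq> {0..}"
  shows "centred_gaussian M (\<lambda>\<omega>. \<Sum>t\<in>J. c t * v t \<omega>)"
proof -
  have g: "gaussian_rv M (\<lambda>\<omega>. \<Sum>t\<in>J. c t * v t \<omega>)" if "finite J" "J \<subseteq> {0..}" for J and c :: "real \<Rightarrow> real"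
    using noise that by (auto simp: stationary_gaussian_noise_def gaussian_process_def)
  have z: "expectation (v t) = 0" if "0 \<le> t" for t
    using noise that by (simp add: stationary_gaussian_noise_def)
  have "centred_gaussian M (v t)" if "0 \<le> t" for t
    using g[of "{t}" "\<lambda>_. 1"] z[OF that] that by (intro gaussian_rv_centred) auto
  then have i: "integrable M (v t)" if "t \<in> J" for t
    using J that by (intro centred_gaussian_moments(1)) auto
  have "expectation (\<lambda>\<omega>. \<Sum>t\<in>J. c t * v t \<omega>) = (\<Sum>t\<in>J. c t * expectation (v t))"
    using i by (simp add: Bochner_Integration.integral_sum)
  also have "\<dots> = 0" using J z by (intro sum.neutral) auto
  finally show ?thesis by (intro gaussian_rv_centred g J)
qed

lemma noise_gaussian: "0 \<le> t \<Longrightarrow> centred_gaussian M (v t)"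
  using noise_span_gaussian[of "{t}" "\<lambda>_. 1"] by simp

lemma noise_measurable: "0 \<le> t \<Longrightarrow> v t \<in> borel_measurable M"
  using noise_gaussian by (rule centred_gaussian_measurable)

lemma noise_covariance:
  assumes "0 \<le> s" "0 \<le> t"
  shows "expectation (\<lambda>\<omega>. v s \<omega> * v t \<omega>) = covar \<bar>t - s\<bar>"
proof -
  have *: "expectation (\<lambda>\<omega>. v t \<omega> * v s \<omega>) = covar (t - s)" if "0 \<le> s" "s \<le> t" for s t
  proof -
    \<comment> \<open>Stationarity is used for the times 0 and \<open>t - s\<close> with shift
      \<open>s\<close>; for \<open>s = t\<close> the set shrinks to one point.\<close>
    let ?J = "{0, t - s}"
    have "distr M (\<Pi>\<^sub>M t\<in>?J. borel) (\<lambda>\<omega>. \<lambda>t\<in>?J. v (t + s) \<omega>) = distr M (\<Pi>\<^sub>M t\<in>?J. borel) (\<lambda>\<omega>. \<lambda>t\<in>?J. v t \<omega>)"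
    proof -
      have "\<forall>J h. finite J \<and> J \<subseteq> {0..} \<and> 0 \<le> h \<longrightarrow>
        distr M (\<Pi>\<^sub>M t\<in>J. borel) (\<lambda>\<omega>. \<lambda>t\<in>J. v (t + h) \<omega>) =
        distr M (\<Pi>\<^sub>M t\<in>J. borel) (\<lambda>\<omega>. \<lambda>t\<in>J. v t \<omega>)"
        using noise by (simp add: stationary_gaussian_noise_def stationary_process_def)
      moreover have "finite ?J \<and> ?J \<subseteq> {0..} \<and> 0 \<le> s" using that by auto
      ultimately show ?thesis by blast
    qed
    then have "integral\<^sup>L (distr M (\<Pi>\<^sub>M t\<in>?J. borel) (\<lambda>\<omega>. \<lambda>t\<in>?J. v (t + s) \<omega>)) (\<lambda>x. x (t - s) * x 0) =
        integral\<^sup>L (distr M (\<Pi>\<^sub>M t\<in>?J. borel) (\<lambda>\<omega>. \<lambda>t\<in>?J. v t \<omega>)) (\<lambda>x. x (t - s) * x 0)" by simp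
    moreover have f: "(\<lambda>x. x (t - s) * x 0) \<in> borel_measurable (\<Pi>\<^sub>M t\<in>?J. (borel :: real measure))"
      by (intro borel_measurable_times measurable_component_singleton) auto
    moreover have "(\<lambda>\<omega>. \<lambda>t\<in>?J. v (t + s) \<omega>) \<in> M \<rightarrow>\<^sub>M (\<Pi>\<^sub>M t\<in>?J. borel)"
      using that by (intro measurable_restrict noise_measurable) auto
    moreover have "(\<lambda>\<omega>. \<lambda>t\<in>?J. v t \<omega>) \<in> M \<rightarrow>\<^sub>M (\<Pi>\<^sub>M t\<in>?J. borel)"
      using that by (intro measurable_restrict noise_measurable) auto
    ultimately have "expectation (\<lambda>\<omega>. v t \<omega> * v s \<omega>) = expectation (\<lambda>\<omega>. v (t - s) \<omega> * v 0 \<omega>)"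
      by (simp add: integral_distr)
    then show ?thesis using that by (simp add: covar_def autocovariance_def)
  qed
  show ?thesis
  proof (cases "s \<le> t")
    case True
    then show ?thesis using *[of s t] assms by (simp add: mult.commute)
  next
    case False
    then show ?thesis using *[of t s] assms by (simp add: mult.commute)
  qed
qed

lemma noise_variance: "0 \<le> t \<Longrightarrow> expectation (\<lambda>\<omega>. (v t \<omega>)\<^sup>2) = covar 0"
  using noise_covariance[of t t] by (simp add: power2_eq_square)

lemma covar_0_nonneg: "0 \<le> covar 0"
proof -
  have "0 \<le> expectation (\<lambda>\<omega>. (v 0 \<omega>)\<^sup>2)" by simp
  then show ?thesis using noise_variance[of 0] by simp
qed

lemma noise_mult_bound:
  assumes "0 \<le> t" and [measurable]: "e \<in> borel_measurable M" and e2: "integrable M (\<lambda>\<omega>. (e \<omega>)\<^sup>2)"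
  shows "integrable M (\<lambda>\<omega>. v t \<omega> * e \<omega>)"
    and "expectation (\<lambda>\<omega>. \<bar>v t \<omega> * e \<omega>\<bar>) \<le> sqrt (covar 0) * sqrt (expectation (\<lambda>\<omega>. (e \<omega>)\<^sup>2))"
proof -
  have [measurable]: "v t \<in> borel_measurable M" using assms(1) by (rule noise_measurable)
  have v2: "integrable M (\<lambda>\<omega>. (v t \<omega>)\<^sup>2)" using noise_gaussian[OF assms(1)] by (rule centred_gaussian_moments)
  show "integrable M (\<lambda>\<omega>. v t \<omega> * e \<omega>)" by (rule square_integrable_mult) (use v2 e2 in auto)
  have "\<bar>expectation (\<lambda>\<omega>. \<bar>v t \<omega>\<bar> * \<bar>e \<omega>\<bar>)\<bar> \<le>
      sqrt (expectation (\<lambda>\<omega>. \<bar>v t \<omega>\<bar>\<^sup>2)) * sqrt (expectation (\<lambda>\<omega>. \<bar>e \<omega>\<bar>\<^sup>2))"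
    by (rule expectation_Cauchy_Schwarz) (use v2 e2 in auto)
  then show "expectation (\<lambda>\<omega>. \<bar>v t \<omega> * e \<omega>\<bar>) \<le> sqrt (covar 0) * sqrt (expectation (\<lambda>\<omega>. (e \<omega>)\<^sup>2))"
    using noise_variance[OF assms(1)] by (simp add: abs_mult abs_le_iff)
qed

lemma covar_measurable[measurable]: "covar \<in> borel_measurable borel"
proof -
  have [measurable]: "(\<lambda>z. expectation (\<lambda>\<omega>. noise_ext z \<omega> * noise_ext 0 \<omega>)) \<in> borel_measurable borel"
    by (rule borel_measurable_lebesgue_integral) measurable
  have "covar = (\<lambda>z. if 0 \<le> z then expectation (\<lambda>\<omega>. noise_ext z \<omega> * noise_ext 0 \<omega>) else 0)"
    by (auto simp: covar_def autocovariance_def noise_ext_def fun_eq_iff)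
  also have "\<dots> \<in> borel_measurable borel" by measurable
  finally show ?thesis .
qed

lemma covar_bound: "\<bar>covar z\<bar> \<le> covar 0"
proof (cases "0 \<le> z")
  case True
  have v0: "v 0 \<in> borel_measurable M" by (rule noise_measurable) simp
  have "integrable M (\<lambda>\<omega>. (v 0 \<omega>)\<^sup>2)" by (rule centred_gaussian_moments[OF noise_gaussian]) simp
  note b = noise_mult_bound[OF True v0 this]
  have "\<bar>covar z\<bar> = \<bar>expectation (\<lambda>\<omega>. v z \<omega> * v 0 \<omega>)\<bar>"
    using True by (simp add: covar_def autocovariance_def)
  also have "\<dots> \<le> expectation (\<lambda>\<omega>. \<bar>v z \<omega> * v 0 \<omega>\<bar>)" by (rule integral_abs_bound)
  also have "\<dots> \<le> covar 0" using b(2) noise_variance[of 0] covar_0_nonneg by simp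
  finally show ?thesis .
next
  case False
  then have "covar z = 0" by (simp add: covar_def)
  then show ?thesis using covar_0_nonneg by simp
qed

lemma covar_neg: "z < 0 \<Longrightarrow> covar z = 0"
  by (simp add: covar_def)

text \<open>Licence to exchange time integral and expectation. The test variable \<open>e\<close>
  will be a constant, a noise value, another noise integral, or the sampling error.\<close>

lemma noise_pair_integrable:
  assumes f: "admissible f" and [measurable]: "e \<in> borel_measurable M" and e2: "integrable M (\<lambda>\<omega>. (e \<omega>)\<^sup>2)"
  shows "integrable (lborel \<Otimes>\<^sub>M M) (\<lambda>(s, \<omega>). f s * noise_ext s \<omega> * e \<omega>)"
proof -
  interpret P: pair_sigma_finite lborel M by unfold_locales
  obtain B T where B: "0 \<le> B" "\<And>s. \<bar>f s\<bar> \<le> B * indicator {0..T} s" using admissible_bounds[OF f] by blast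
  have [measurable]: "f \<in> borel_measurable borel" using f by (rule admissible_measurable)
  have f0: "f s = 0" if "s < 0" for s using B(2)[of s] that by simp
  show ?thesis
  proof (rule P.Fubini_integrable)
    show "(\<lambda>(s, \<omega>). f s * noise_ext s \<omega> * e \<omega>) \<in> borel_measurable (lborel \<Otimes>\<^sub>M M)" by measurable
    show "AE s in lborel. integrable M (\<lambda>\<omega>. case (s, \<omega>) of (s, \<omega>) \<Rightarrow> f s * noise_ext s \<omega> * e \<omega>)"
    proof (intro AE_I2)
      fix s
      show "integrable M (\<lambda>\<omega>. case (s, \<omega>) of (s, \<omega>) \<Rightarrow> f s * noise_ext s \<omega> * e \<omega>)"
        using noise_mult_bound(1)[OF _ _ e2, of s] f0[of s]
        by (cases "0 \<le> s") (simp_all add: noise_ext_def mult.assoc)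
    qed
    show "integrable lborel (\<lambda>s. LINT \<omega>|M. norm (case (s, \<omega>) of (s, \<omega>) \<Rightarrow> f s * noise_ext s \<omega> * e \<omega>))"
    proof (rule integrable_bounded_support)
      show "(\<lambda>s. LINT \<omega>|M. norm (case (s, \<omega>) of (s, \<omega>) \<Rightarrow> f s * noise_ext s \<omega> * e \<omega>)) \<in> borel_measurable borel"
        by (rule borel_measurable_lebesgue_integral) measurable
      fix s
      let ?c = "sqrt (covar 0) * sqrt (expectation (\<lambda>\<omega>. (e \<omega>)\<^sup>2))"
      have "0 \<le> ?c" using covar_0_nonneg by simp
      show "\<bar>LINT \<omega>|M. norm (case (s, \<omega>) of (s, \<omega>) \<Rightarrow> f s * noise_ext s \<omega> * e \<omega>)\<bar> \<le> (B * ?c) * indicator {0..T} s"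
      proof (cases "0 \<le> s")
        case True
        have "(LINT \<omega>|M. norm (case (s, \<omega>) of (s, \<omega>) \<Rightarrow> f s * noise_ext s \<omega> * e \<omega>)) =
            \<bar>f s\<bar> * expectation (\<lambda>\<omega>. \<bar>v s \<omega> * e \<omega>\<bar>)"
          using True by (simp add: noise_ext_def abs_mult mult.assoc)
        moreover have "\<dots> \<le> (B * indicator {0..T} s) * ?c"
          using noise_mult_bound(2)[OF True _ e2] B by (intro mult_mono) auto
        moreover have "0 \<le> \<bar>f s\<bar> * expectation (\<lambda>\<omega>. \<bar>v s \<omega> * e \<omega>\<bar>)" by simp
        ultimately show ?thesis by (simp add: mult_ac)
      next
        case False
        then show ?thesis using f0[of s] by simp
      qed
    qed
  qed
qed

lemma noise_integral_measurable[measurable]: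
  "admissible f \<Longrightarrow> noise_integral f \<in> borel_measurable M"
proof -
  assume "admissible f"
  then have [measurable]: "f \<in> borel_measurable borel" by (rule admissible_measurable)
  show ?thesis unfolding noise_integral_def[abs_def]
    by (rule lborel.borel_measurable_lebesgue_integral) measurable
qed

lemma noise_path_integrable:
  assumes f: "admissible f"
  shows "AE \<omega> in M. integrable lborel (\<lambda>s. f s * noise_ext s \<omega>)"
proof -
  interpret P: pair_sigma_finite lborel M by unfold_locales
  have "integrable (lborel \<Otimes>\<^sub>M M) (\<lambda>(s, \<omega>). f s * noise_ext s \<omega> * 1)"
    by (rule noise_pair_integrable[OF f]) auto
  from P.AE_integrable_snd[OF this] show ?thesis by simp
qed

lemma noise_integral_expectation:
  assumes f: "admissible f" and e: "e \<in> borel_measurable M" "integrable M (\<lambda>\<omega>. (e \<omega>)\<^sup>2)"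
  shows "expectation (\<lambda>\<omega>. noise_integral f \<omega> * e \<omega>) = (LBINT s. f s * expectation (\<lambda>\<omega>. noise_ext s \<omega> * e \<omega>))"
proof -
  interpret P: pair_sigma_finite lborel M by unfold_locales
  have "expectation (\<lambda>\<omega>. noise_integral f \<omega> * e \<omega>) = (LINT \<omega>|M. (LBINT s. f s * noise_ext s \<omega> * e \<omega>))"
    unfolding noise_integral_def by simp
  also have "\<dots> = (LBINT s. (LINT \<omega>|M. f s * noise_ext s \<omega> * e \<omega>))"
    by (rule P.Fubini_integral[OF noise_pair_integrable[OF f e]])
  finally show ?thesis by (simp add: mult.assoc)
qed

text \<open>Cauchy-Schwarz in time on each path, then Tonelli; the variance of the noise does not
  depend on time.\<close>

lemma noise_integral_square_integrable:
  assumes f: "admissible f"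
  shows "integrable M (\<lambda>\<omega>. (noise_integral f \<omega>)\<^sup>2)"
proof -
  interpret P: pair_sigma_finite lborel M by unfold_locales
  obtain B T where B: "0 \<le> B" "0 \<le> T" "\<And>s. \<bar>f s\<bar> \<le> B * indicator {0..T} s" using admissible_bounds[OF f] by blast
  have [measurable]: "f \<in> borel_measurable borel" using f by (rule admissible_measurable)
  have [measurable]: "noise_integral f \<in> borel_measurable M" using f by (rule noise_integral_measurable)
  let ?k = "\<lambda>s \<omega>. ennreal (indicator {0..T} s * \<bar>noise_ext s \<omega>\<bar>)"
  let ?B = "\<lambda>s. ennreal (B * indicator {0..T} s)"
  have pw: "ennreal ((noise_integral f \<omega>)\<^sup>2) \<le> (\<integral>\<^sup>+s. (?B s)\<^sup>2 \<partial>lborel) * (\<integral>\<^sup>+s. (?k s \<omega>)\<^sup>2 \<partial>lborel)"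
    if [simp]: "\<omega> \<in> space M" for \<omega>
  proof -
    have [measurable]: "(\<lambda>s. noise_ext s \<omega>) \<in> borel_measurable borel"
      by (rule noise_ext_measurable_compose) auto
    have "ennreal \<bar>noise_integral f \<omega>\<bar> \<le> (\<integral>\<^sup>+s. ennreal \<bar>f s * noise_ext s \<omega>\<bar> \<partial>lborel)"
    proof (cases "integrable lborel (\<lambda>s. f s * noise_ext s \<omega>)")
      case True
      from integral_norm_bound_ennreal[OF this] show ?thesis by (simp add: noise_integral_def)
    next
      case False
      \<comment> \<open>On a path without integrability the Bochner integral is 0 by convention, and
        the bound is trivial.\<close>
      then show ?thesis by (simp add: noise_integral_def not_integrable_integral_eq)
    qed
    also have "\<dots> \<le> (\<integral>\<^sup>+s. ?B s * ?k s \<omega> \<partial>lborel)"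
    proof (rule nn_integral_mono)
      fix s
      have "\<bar>f s * noise_ext s \<omega>\<bar> \<le> (B * indicator {0..T} s) * (indicator {0..T} s * \<bar>noise_ext s \<omega>\<bar>)"
        using mult_right_mono[OF B(3)[of s], of "\<bar>noise_ext s \<omega>\<bar>"] by (auto simp: abs_mult indicator_def)
      then show "ennreal \<bar>f s * noise_ext s \<omega>\<bar> \<le> ?B s * ?k s \<omega>"
        using B by (simp add: ennreal_mult[symmetric] ennreal_leI)
    qed
    finally have "(ennreal \<bar>noise_integral f \<omega>\<bar>)\<^sup>2 \<le> (\<integral>\<^sup>+s. ?B s * ?k s \<omega> \<partial>lborel)\<^sup>2"
      by (rule power_mono) simp
    also have "\<dots> \<le> (\<integral>\<^sup>+s. (?B s)\<^sup>2 \<partial>lborel) * (\<integral>\<^sup>+s. (?k s \<omega>)\<^sup>2 \<partial>lborel)"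
      by (rule Cauchy_Schwarz_nn_integral) measurable
    finally show ?thesis by (simp add: ennreal_power)
  qed
  have c1: "(\<integral>\<^sup>+s. (?B s)\<^sup>2 \<partial>lborel) \<le> ennreal (B\<^sup>2 * T)"
  proof -
    have "(\<integral>\<^sup>+s. (?B s)\<^sup>2 \<partial>lborel) = (\<integral>\<^sup>+s. ennreal (B\<^sup>2) * indicator {0..T} s \<partial>lborel)"
      by (rule nn_integral_cong) (use B in \<open>auto simp: indicator_def ennreal_power\<close>)
    also have "\<dots> = ennreal (B\<^sup>2 * T)" using B by (simp add: nn_integral_cmult ennreal_mult)
    finally show ?thesis by simp
  qed
  have "(\<integral>\<^sup>+\<omega>. \<integral>\<^sup>+s. (?k s \<omega>)\<^sup>2 \<partial>lborel \<partial>M) = (\<integral>\<^sup>+s. \<integral>\<^sup>+\<omega>. (?k s \<omega>)\<^sup>2 \<partial>M \<partial>lborel)"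
    by (rule P.Fubini') measurable
  also have "\<dots> \<le> (\<integral>\<^sup>+s. ennreal (covar 0) * indicator {0..T} s \<partial>lborel)"
  proof (rule nn_integral_mono)
    fix s
    show "(\<integral>\<^sup>+\<omega>. (?k s \<omega>)\<^sup>2 \<partial>M) \<le> ennreal (covar 0) * indicator {0..T} s"
    proof (cases "s \<in> {0..T}")
      case True
      then have "(\<integral>\<^sup>+\<omega>. (?k s \<omega>)\<^sup>2 \<partial>M) = (\<integral>\<^sup>+\<omega>. ennreal ((v s \<omega>)\<^sup>2) \<partial>M)"
        by (simp add: noise_ext_def ennreal_power)
      also have "\<dots> = ennreal (covar 0)"
        using True centred_gaussian_moments(3)[OF noise_gaussian[of s]] noise_variance[of s]
        by (subst nn_integral_eq_integral) auto
      finally show ?thesis using True by simp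
    qed simp
  qed
  also have "\<dots> = ennreal (covar 0 * T)"
    using B covar_0_nonneg by (simp add: nn_integral_cmult ennreal_mult)
  finally have c2: "(\<integral>\<^sup>+\<omega>. \<integral>\<^sup>+s. (?k s \<omega>)\<^sup>2 \<partial>lborel \<partial>M) \<le> ennreal (covar 0 * T)" .
  have [measurable]: "(\<lambda>\<omega>. \<integral>\<^sup>+s. (?k s \<omega>)\<^sup>2 \<partial>lborel) \<in> borel_measurable M"
    by (rule lborel.borel_measurable_nn_integral) measurable
  have "(\<integral>\<^sup>+\<omega>. ennreal ((noise_integral f \<omega>)\<^sup>2) \<partial>M) \<le>
      (\<integral>\<^sup>+\<omega>. (\<integral>\<^sup>+s. (?B s)\<^sup>2 \<partial>lborel) * (\<integral>\<^sup>+s. (?k s \<omega>)\<^sup>2 \<partial>lborel) \<partial>M)"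
    by (rule nn_integral_mono) (rule pw)
  also have "\<dots> = (\<integral>\<^sup>+s. (?B s)\<^sup>2 \<partial>lborel) * (\<integral>\<^sup>+\<omega>. \<integral>\<^sup>+s. (?k s \<omega>)\<^sup>2 \<partial>lborel \<partial>M)"
    by (rule nn_integral_cmult) measurable
  also have "\<dots> \<le> ennreal (B\<^sup>2 * T) * ennreal (covar 0 * T)" using c1 c2 by (rule mult_mono) auto
  also have "\<dots> < \<infinity>" by (simp add: ennreal_mult_less_top)
  finally show ?thesis by (intro integrableI_nonneg) auto
qed

text \<open>Two exchanges of time integral and expectation, each with the other factor as the square
  integrable test variable.\<close>

lemma noise_integral_covariance:
  assumes f: "admissible f" and g: "admissible g"
  shows "expectation (\<lambda>\<omega>. noise_integral f \<omega> * noise_integral g \<omega>) = lag_form covar f g + lag_form covar g f"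
proof -
  have z: "h s = 0" if "s < 0" "admissible h" for s h
    using admissible_bounds[OF that(2)] that(1) by (auto dest!: spec[of _ s])
  have inner: "f s * expectation (\<lambda>\<omega>. noise_ext s \<omega> * noise_integral g \<omega>) = f s * (LBINT t. g t * covar \<bar>t - s\<bar>)" for s
  proof (cases "0 \<le> s")
    case True
    have "expectation (\<lambda>\<omega>. noise_ext s \<omega> * noise_integral g \<omega>) = expectation (\<lambda>\<omega>. noise_integral g \<omega> * v s \<omega>)"
      using True by (simp add: noise_ext_def mult.commute)
    also have "\<dots> = (LBINT t. g t * expectation (\<lambda>\<omega>. noise_ext t \<omega> * v s \<omega>))"
      using True by (intro noise_integral_expectation g noise_measurable centred_gaussian_moments(3) noise_gaussian)
    also have "\<dots> = (LBINT t. g t * covar \<bar>t - s\<bar>)"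
    proof (rule Bochner_Integration.integral_cong[OF refl])
      fix t
      show "g t * expectation (\<lambda>\<omega>. noise_ext t \<omega> * v s \<omega>) = g t * covar \<bar>t - s\<bar>"
        using noise_covariance[of t s] True z[OF _ g, of t]
        by (cases "0 \<le> t") (simp_all add: noise_ext_def abs_minus_commute)
    qed
    finally show ?thesis by simp
  qed (use z[OF _ f, of s] in simp)
  have "expectation (\<lambda>\<omega>. noise_integral f \<omega> * noise_integral g \<omega>) =
      (LBINT s. f s * expectation (\<lambda>\<omega>. noise_ext s \<omega> * noise_integral g \<omega>))"
    by (intro noise_integral_expectation f noise_integral_measurable g noise_integral_square_integrable)
  also have "\<dots> = (LBINT s. f s * (LBINT t. g t * covar \<bar>t - s\<bar>))" by (simp only: inner)
  also have "\<dots> = lag_form covar f g + lag_form covar g f"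
    by (rule lag_form_double[OF covar_measurable covar_bound covar_neg f g])
  finally show ?thesis .
qed

section \<open>Gaussianity of time integrals by sampling\<close>

definition noise_span :: "('a \<Rightarrow> real) set" where
  "noise_span = {S. \<exists>J c. finite J \<and> J \<subseteq> {0..} \<and> S = (\<lambda>\<omega>. \<Sum>t\<in>J. c t * v t \<omega>)}"

lemma noise_span_centred_gaussian: "S \<in> noise_span \<Longrightarrow> centred_gaussian M S"
  using noise_span_gaussian by (auto simp: noise_span_def)

lemma noise_span_add:
  assumes "S \<in> noise_span" "0 \<le> r"
  shows "(\<lambda>\<omega>. S \<omega> + a * v r \<omega>) \<in> noise_span"
proof -
  from assms obtain J c where J: "finite J" "J \<subseteq> {0..}" and S: "S = (\<lambda>\<omega>. \<Sum>t\<in>J. c t * v t \<omega>)"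
    by (auto simp: noise_span_def)
  \<comment> \<open>The new time \<open>r\<close> may have been sampled before, so coefficients are
    added.\<close>
  define c' where "c' t = (if t \<in> J then c t else 0) + (if t = r then a else 0)" for t
  have "(\<Sum>t\<in>insert r J. c' t * v t \<omega>) = S \<omega> + a * v r \<omega>" for \<omega>
  proof -
    have "(\<Sum>t\<in>insert r J. c' t * v t \<omega>) =
        (\<Sum>t\<in>insert r J. (if t \<in> J then c t * v t \<omega> else 0)) + (\<Sum>t\<in>insert r J. (if t = r then a * v t \<omega> else 0))"
      unfolding sum.distrib[symmetric] by (intro sum.cong) (auto simp: c'_def distrib_right)
    also have "(\<Sum>t\<in>insert r J. (if t \<in> J then c t * v t \<omega> else 0)) = S \<omega>"
      using J(1) by (auto simp: S sum.inter_restrict[symmetric] intro!: sum.cong)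
    finally show ?thesis using J(1) by simp
  qed
  then show ?thesis using J assms(2) unfolding noise_span_def
    by (auto intro!: exI[of _ "insert r J"] exI[of _ c'])
qed

lemma noise_span_scale: "S \<in> noise_span \<Longrightarrow> (\<lambda>\<omega>. S \<omega> / a) \<in> noise_span"
proof -
  assume "S \<in> noise_span"
  then obtain J c where J: "finite J" "J \<subseteq> {0..}" and S: "S = (\<lambda>\<omega>. \<Sum>t\<in>J. c t * v t \<omega>)"
    by (auto simp: noise_span_def)
  have "(\<lambda>\<omega>. S \<omega> / a) = (\<lambda>\<omega>. \<Sum>t\<in>J. (c t / a) * v t \<omega>)" by (simp add: S sum_divide_distrib)
  then show ?thesis using J unfolding noise_span_def mem_Collect_eq
    by (intro exI[of _ J] exI[of _ "\<lambda>t. c t / a"] conjI)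
qed

text \<open>Greedy sampling: \<open>noise_integral f\<close> is the average over \<open>t \<in> [0, T]\<close> of \<open>T f(t) v(t)\<close>, so some
  sample point keeps the accumulated error \<open>n U - S\<close> from being positively correlated with the new one,
  and its variance grows at most linearly in \<open>n\<close>.\<close>

lemma noise_integral_sampling:
  assumes f: "admissible f"
  shows "\<exists>C. \<forall>n. \<exists>S\<in>noise_span. expectation (\<lambda>\<omega>. (real n * noise_integral f \<omega> - S \<omega>)\<^sup>2) \<le> real n * C"
proof -
  let ?U = "noise_integral f"
  obtain B T0 where B: "0 \<le> B" "0 \<le> T0" "\<And>s. \<bar>f s\<bar> \<le> B * indicator {0..T0} s" using admissible_bounds[OF f] by blast
  have [measurable]: "f \<in> borel_measurable borel" using f by (rule admissible_measurable)
  have [measurable]: "?U \<in> borel_measurable M" using f by (rule noise_integral_measurable)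
  have U2: "integrable M (\<lambda>\<omega>. (?U \<omega>)\<^sup>2)" using f by (rule noise_integral_square_integrable)
  \<comment> \<open>The averaging argument needs an interval of positive length, also when
    \<open>T0 = 0\<close>.\<close>
  define T where "T = T0 + 1"
  have "0 < T" using B by (simp add: T_def)
  have fB: "\<bar>f s\<bar> \<le> B" for s using B(1) B(3)[of s] by (cases "s \<in> {0..T0}") auto
  have fT: "f s = indicator {0..T} s * f s" for s using B(3)[of s] by (cases "s \<in> {0..T0}") (auto simp: T_def)
  define X where "X t \<omega> = T * f t * v t \<omega>" for t \<omega>
  \<comment> \<open>The final 1 pays for the tolerated correlation \<open>1 / 2\<close>, which
    enters the expanded square twice.\<close>
  define C where "C = 2 * expectation (\<lambda>\<omega>. (?U \<omega>)\<^sup>2) + 2 * (T * B)\<^sup>2 * covar 0 + 1"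
  have X: "X t \<in> borel_measurable M" "integrable M (\<lambda>\<omega>. (X t \<omega>)\<^sup>2)"
      "expectation (\<lambda>\<omega>. (X t \<omega>)\<^sup>2) \<le> (T * B)\<^sup>2 * covar 0" if t: "0 \<le> t" for t
  proof -
    have v2: "integrable M (\<lambda>\<omega>. (v t \<omega>)\<^sup>2)" using noise_gaussian[OF t] by (rule centred_gaussian_moments)
    have [measurable]: "v t \<in> borel_measurable M" using t by (rule noise_measurable)
    show "X t \<in> borel_measurable M" unfolding X_def by measurable
    show "integrable M (\<lambda>\<omega>. (X t \<omega>)\<^sup>2)" unfolding X_def power_mult_distrib using v2 by simp
    have "expectation (\<lambda>\<omega>. (X t \<omega>)\<^sup>2) = (T * f t)\<^sup>2 * covar 0"
      unfolding X_def power_mult_distrib[of "T * f t"] using noise_variance[OF t] by simp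
    also have "\<dots> = (T * \<bar>f t\<bar>)\<^sup>2 * covar 0" by (simp add: power_mult_distrib)
    also have "\<dots> \<le> (T * B)\<^sup>2 * covar 0"
      using fB[of t] \<open>0 < T\<close> covar_0_nonneg by (intro mult_right_mono power_mono mult_left_mono) auto
    finally show "expectation (\<lambda>\<omega>. (X t \<omega>)\<^sup>2) \<le> (T * B)\<^sup>2 * covar 0" .
  qed
  have D: "integrable M (\<lambda>\<omega>. (?U \<omega> - X t \<omega>)\<^sup>2)" "expectation (\<lambda>\<omega>. (?U \<omega> - X t \<omega>)\<^sup>2) \<le> C - 1" if t: "0 \<le> t" for t
  proof -
    note [measurable] = X(1)[OF t]
    have iUX: "integrable M (\<lambda>\<omega>. ?U \<omega> * X t \<omega>)" by (rule square_integrable_mult) (use U2 X(2)[OF t] in auto)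
    show i: "integrable M (\<lambda>\<omega>. (?U \<omega> - X t \<omega>)\<^sup>2)"
      using U2 X(2)[OF t] iUX by (simp add: power2_diff mult.assoc)
    have "expectation (\<lambda>\<omega>. (?U \<omega> - X t \<omega>)\<^sup>2) \<le> expectation (\<lambda>\<omega>. 2 * (?U \<omega>)\<^sup>2 + 2 * (X t \<omega>)\<^sup>2)"
    proof (rule integral_mono[OF i])
      show "integrable M (\<lambda>\<omega>. 2 * (?U \<omega>)\<^sup>2 + 2 * (X t \<omega>)\<^sup>2)" using U2 X(2)[OF t] by simp
      show "(?U \<omega> - X t \<omega>)\<^sup>2 \<le> 2 * (?U \<omega>)\<^sup>2 + 2 * (X t \<omega>)\<^sup>2" for \<omega>
        using zero_le_power2[of "?U \<omega> + X t \<omega>"] by (simp add: power2_eq_square algebra_simps)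
    qed
    also have "\<dots> = 2 * expectation (\<lambda>\<omega>. (?U \<omega>)\<^sup>2) + 2 * expectation (\<lambda>\<omega>. (X t \<omega>)\<^sup>2)"
      using U2 X(2)[OF t] by simp
    also have "\<dots> \<le> C - 1" using X(3)[OF t] by (simp add: C_def)
    finally show "expectation (\<lambda>\<omega>. (?U \<omega> - X t \<omega>)\<^sup>2) \<le> C - 1" .
  qed
  have "\<exists>S\<in>noise_span. expectation (\<lambda>\<omega>. (real n * ?U \<omega> - S \<omega>)\<^sup>2) \<le> real n * C" for n
  proof (induction n)
    case 0
    have "(\<lambda>\<omega>. 0) \<in> noise_span" by (auto simp: noise_span_def intro!: exI[of _ "{}"])
    then show ?case by (intro bexI[of _ "\<lambda>\<omega>. 0"]) auto
  next
    case (Suc n)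
    then obtain S where S: "S \<in> noise_span" "expectation (\<lambda>\<omega>. (real n * ?U \<omega> - S \<omega>)\<^sup>2) \<le> real n * C" by blast
    define e where "e \<omega> = real n * ?U \<omega> - S \<omega>" for \<omega>
    have Sg: "centred_gaussian M S" using S(1) by (rule noise_span_centred_gaussian)
    have [measurable]: "S \<in> borel_measurable M" using Sg by (rule centred_gaussian_measurable)
    have S2: "integrable M (\<lambda>\<omega>. (S \<omega>)\<^sup>2)" using Sg by (rule centred_gaussian_moments)
    have em[measurable]: "e \<in> borel_measurable M" unfolding e_def by measurable
    have iUS: "integrable M (\<lambda>\<omega>. ?U \<omega> * S \<omega>)" by (rule square_integrable_mult) (use U2 S2 in auto)
    have e2: "integrable M (\<lambda>\<omega>. (e \<omega>)\<^sup>2)"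
      unfolding e_def using U2 S2 iUS by (simp add: power2_diff power_mult_distrib mult.assoc)
    have eU: "integrable M (\<lambda>\<omega>. e \<omega> * ?U \<omega>)" by (rule square_integrable_mult) (use U2 e2 in auto)
    have eX: "integrable M (\<lambda>\<omega>. e \<omega> * X t \<omega>)" if "0 \<le> t" for t
      by (rule square_integrable_mult) (use X[OF that] e2 in auto)
    \<comment> \<open>The time average of \<open>X t\<close> over \<open>[0, T]\<close> is
      \<open>?U\<close>, so these correlations average to 0 and cannot all exceed
      \<open>1 / 2\<close>.\<close>
    have "\<exists>t\<in>{0..T}. expectation (\<lambda>\<omega>. e \<omega> * (?U \<omega> - X t \<omega>)) \<le> 1 / 2"
    proof (rule ccontr)
      assume "\<not> ?thesis"
      then have less: "1 / 2 < expectation (\<lambda>\<omega>. e \<omega> * (?U \<omega> - X t \<omega>))" if "t \<in> {0..T}" for t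
        using that by (meson not_le)
      let ?k = "\<lambda>t. f t * expectation (\<lambda>\<omega>. noise_ext t \<omega> * e \<omega>)"
      have ik: "integrable lborel ?k"
      proof -
        interpret P: pair_sigma_finite lborel M by unfold_locales
        have "integrable lborel (\<lambda>s. LINT \<omega>|M. f s * noise_ext s \<omega> * e \<omega>)"
          using P.integrable_fst'[OF noise_pair_integrable[OF f em e2]] by simp
        then show ?thesis by (simp add: mult.assoc)
      qed
      have ii: "integrable lborel (indicator {0..T} :: real \<Rightarrow> real)"
        by (rule integrable_real_indicator) (use \<open>0 < T\<close> in auto)
      have "indicator {0..T} t * (1 / 2) \<le> indicator {0..T} t * expectation (\<lambda>\<omega>. e \<omega> * ?U \<omega>) - T * ?k t" for t
      proof (cases "t \<in> {0..T}")
        case True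
        then have "0 \<le> t" by simp
        have "expectation (\<lambda>\<omega>. e \<omega> * (?U \<omega> - X t \<omega>)) = expectation (\<lambda>\<omega>. e \<omega> * ?U \<omega>) - expectation (\<lambda>\<omega>. e \<omega> * X t \<omega>)"
          using eU eX[OF \<open>0 \<le> t\<close>] by (simp add: right_diff_distrib)
        also have "expectation (\<lambda>\<omega>. e \<omega> * X t \<omega>) = T * ?k t"
          unfolding X_def using \<open>0 \<le> t\<close>
          by (simp add: noise_ext_def mult_ac flip: integral_mult_right_zero)
        finally show ?thesis using less[OF True] True by simp
      next
        case False
        then show ?thesis using fT[of t] by simp
      qed
      then have "(LBINT t. indicator {0..T} t * (1 / 2)) \<le>
          (LBINT t. indicator {0..T} t * expectation (\<lambda>\<omega>. e \<omega> * ?U \<omega>) - T * ?k t)"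
        using ik ii by (intro integral_mono Bochner_Integration.integrable_diff integrable_mult_left integrable_mult_right) auto
      also have "\<dots> = T * expectation (\<lambda>\<omega>. e \<omega> * ?U \<omega>) - T * (LBINT t. ?k t)"
        using ik ii \<open>0 < T\<close> by (subst Bochner_Integration.integral_diff) auto
      also have "(LBINT t. ?k t) = expectation (\<lambda>\<omega>. e \<omega> * ?U \<omega>)"
        using noise_integral_expectation[OF f em e2] by (simp add: mult.commute)
      finally show False using \<open>0 < T\<close> by simp
    qed
    then obtain t where t: "0 \<le> t" "expectation (\<lambda>\<omega>. e \<omega> * (?U \<omega> - X t \<omega>)) \<le> 1 / 2" by auto
    have ie: "integrable M (\<lambda>\<omega>. e \<omega> * (?U \<omega> - X t \<omega>))"
      using eU eX[OF t(1)] by (simp add: right_diff_distrib)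
    have "expectation (\<lambda>\<omega>. (real (Suc n) * ?U \<omega> - (S \<omega> + (T * f t) * v t \<omega>))\<^sup>2) =
        expectation (\<lambda>\<omega>. (e \<omega>)\<^sup>2 + 2 * (e \<omega> * (?U \<omega> - X t \<omega>)) + (?U \<omega> - X t \<omega>)\<^sup>2)"
      by (rule Bochner_Integration.integral_cong) (auto simp: e_def X_def power2_eq_square algebra_simps)
    also have "\<dots> = expectation (\<lambda>\<omega>. (e \<omega>)\<^sup>2) + 2 * expectation (\<lambda>\<omega>. e \<omega> * (?U \<omega> - X t \<omega>)) + expectation (\<lambda>\<omega>. (?U \<omega> - X t \<omega>)\<^sup>2)"
      using e2 ie D(1)[OF t(1)] by simp
    also have "\<dots> \<le> real n * C + 2 * (1 / 2) + (C - 1)"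
      using S(2) t(2) D(2)[OF t(1)] unfolding e_def by (intro add_mono mult_left_mono) auto
    also have "\<dots> = real (Suc n) * C" by (simp add: algebra_simps)
    finally show ?case using noise_span_add[OF S(1) t(1), of "T * f t"] by (intro bexI)
  qed
  then show ?thesis by blast
qed

text \<open>After division by \<open>n\<close> squared, the linear bound on the sampling error
  leaves a mean square error of order \<open>1 / n\<close>, and centred Gaussians are closed under
  L2 limits.\<close>

theorem noise_integral_gaussian:
  assumes f: "admissible f"
  shows "centred_gaussian M (noise_integral f)"
proof -
  let ?U = "noise_integral f"
  from noise_integral_sampling[OF f] obtain C S where S: "\<And>n. S n \<in> noise_span"
    "\<And>n. expectation (\<lambda>\<omega>. (real n * ?U \<omega> - S n \<omega>)\<^sup>2) \<le> real n * C" by metis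
  show ?thesis
  proof (rule centred_gaussian_L2_limit)
    show "centred_gaussian M (\<lambda>\<omega>. S (Suc n) \<omega> / real (Suc n))" for n
      by (intro noise_span_centred_gaussian noise_span_scale S)
    show "?U \<in> borel_measurable M" using f by (rule noise_integral_measurable)
    show "integrable M (\<lambda>\<omega>. (?U \<omega>)\<^sup>2)" using f by (rule noise_integral_square_integrable)
    show "(\<lambda>n. expectation (\<lambda>\<omega>. (?U \<omega> - S (Suc n) \<omega> / real (Suc n))\<^sup>2)) \<longlonglongrightarrow> 0"
    proof (rule tendsto_sandwich)
      show "\<forall>\<^sub>F n in sequentially. 0 \<le> expectation (\<lambda>\<omega>. (?U \<omega> - S (Suc n) \<omega> / real (Suc n))\<^sup>2)" by simp
      show "\<forall>\<^sub>F n in sequentially. expectation (\<lambda>\<omega>. (?U \<omega> - S (Suc n) \<omega> / real (Suc n))\<^sup>2) \<le> C * inverse (real (Suc n))"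
      proof (intro always_eventually allI)
        fix n
        have "(?U \<omega> - S (Suc n) \<omega> / real (Suc n))\<^sup>2 = (real (Suc n) * ?U \<omega> - S (Suc n) \<omega>)\<^sup>2 / (real (Suc n))\<^sup>2" for \<omega>
          by (simp add: power_divide[symmetric] diff_divide_distrib)
        then have "expectation (\<lambda>\<omega>. (?U \<omega> - S (Suc n) \<omega> / real (Suc n))\<^sup>2) =
            expectation (\<lambda>\<omega>. (real (Suc n) * ?U \<omega> - S (Suc n) \<omega>)\<^sup>2) / (real (Suc n))\<^sup>2" by simp
        also have "\<dots> \<le> (real (Suc n) * C) / (real (Suc n))\<^sup>2"
          by (intro divide_right_mono S) simp
        also have "\<dots> = C * inverse (real (Suc n))" by (simp add: power2_eq_square divide_inverse)
        finally show "expectation (\<lambda>\<omega>. (?U \<omega> - S (Suc n) \<omega> / real (Suc n))\<^sup>2) \<le> C * inverse (real (Suc n))" .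
      qed
      show "(\<lambda>n. C * inverse (real (Suc n))) \<longlonglongrightarrow> 0"
        by (intro tendsto_mult_right_zero LIMSEQ_inverse_real_of_nat)
    qed simp
  qed
qed

end

section \<open>The resonant components of the noise\<close>

text \<open>The components of the forcing direction \<open>e_2\<close> turned by the angle
  \<open>s\<close>. Its companion \<open>kern'\<close> is the derivative, which appears as the
  coefficient of \<open>sin z\<close> in the addition formula.\<close>

definition kern :: "2 \<Rightarrow> real \<Rightarrow> real" where
  "kern a s = (if a = 1 then - sin s else cos s)"

definition kern' :: "2 \<Rightarrow> real \<Rightarrow> real" where
  "kern' a s = (if a = 1 then - cos s else - sin s)"

lemma kern_add: "kern a (s + z) = kern a s * cos z + kern' a s * sin z"
  by (simp add: kern_def kern'_def sin_add cos_add)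

lemma kern_bound: "\<bar>kern a s\<bar> \<le> 1" "\<bar>kern' a s\<bar> \<le> 1"
  by (auto simp: kern_def kern'_def)

lemma kern_measurable[measurable]: "kern a \<in> borel_measurable borel" "kern' a \<in> borel_measurable borel"
  unfolding kern_def[abs_def] kern'_def[abs_def] by (cases "a = 1"; simp)+

lemma admissible_kern: "0 \<le> x \<Longrightarrow> admissible (\<lambda>s. indicator {x..y} s * kern a s)"
  by (rule admissible_indicator[where b = 1]) (auto simp: kern_bound)

section \<open>Time averages of the rotation kernel\<close>

lemma mean_bound:
  fixes \<theta> \<Theta> :: "real \<Rightarrow> real"
  assumes d: "\<And>s. (\<Theta> has_real_derivative \<theta> s - \<kappa>) (at s)" and \<Theta>: "\<And>s. \<bar>\<Theta> s\<bar> \<le> 1"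
    and c: "continuous_on UNIV \<theta>" and m: "0 \<le> m"
  shows "\<bar>(LBINT s:{0..m}. \<theta> s) - \<kappa> * m\<bar> \<le> 2"
proof -
  have "(LBINT s. (\<theta> s) * indicator {0..m} s) = (\<Theta> m + \<kappa> * m) - (\<Theta> 0 + \<kappa> * 0)"
  proof (rule integral_FTC_Icc_real[OF m])
    show "((\<lambda>s. \<Theta> s + \<kappa> * s) has_real_derivative \<theta> x) (at x)" for x
      by (auto intro!: derivative_eq_intros d)
    show "isCont \<theta> x" for x using c by (simp add: continuous_on_eq_continuous_at)
  qed
  then have "(LBINT s:{0..m}. \<theta> s) - \<kappa> * m = \<Theta> m - \<Theta> 0"
    by (simp add: set_lebesgue_integral_def mult.commute)
  then show ?thesis using \<Theta>[of m] \<Theta>[of 0] by simp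
qed

lemma abs_sin_cos_half: "\<bar>sin s * cos s / 2\<bar> \<le> (1::real)" "\<bar>(sin s)\<^sup>2 / 2\<bar> \<le> (1::real)"
proof -
  have "\<bar>sin s\<bar> * \<bar>cos s\<bar> \<le> 1 * (1::real)" by (intro mult_mono) auto
  then show "\<bar>sin s * cos s / 2\<bar> \<le> (1::real)" by (simp add: abs_mult)
  show "\<bar>(sin s)\<^sup>2 / 2\<bar> \<le> (1::real)" using sin_cos_squared_add[of s] zero_le_power2[of "cos s"] zero_le_power2[of "sin s"] by linarith
qed

lemma trig_means:
  fixes m :: real
  assumes "0 \<le> m"
  shows "\<bar>(LBINT s:{0..m}. (sin s)\<^sup>2) - 1/2 * m\<bar> \<le> 2"
    "\<bar>(LBINT s:{0..m}. (cos s)\<^sup>2) - 1/2 * m\<bar> \<le> 2"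
    "\<bar>(LBINT s:{0..m}. sin s * cos s) - 0 * m\<bar> \<le> 2"
proof -
  have dsc: "((\<lambda>s. sin s * cos s / 2) has_real_derivative (cos s)\<^sup>2 - 1 / 2) (at s)" for s :: real
  proof -
    have "((\<lambda>s. sin s * cos s / 2) has_real_derivative ((cos s)\<^sup>2 - (sin s)\<^sup>2) / 2) (at s)"
      by (rule derivative_eq_intros refl | simp add: power2_eq_square)+
    moreover have "((cos s)\<^sup>2 - (sin s)\<^sup>2) / 2 = (cos s)\<^sup>2 - 1 / 2"
      by (simp add: sin_squared_eq field_simps)
    ultimately show ?thesis by simp
  qed
  show "\<bar>(LBINT s:{0..m}. (sin s)\<^sup>2) - 1/2 * m\<bar> \<le> 2"
  proof (rule mean_bound[where \<Theta> = "\<lambda>s. - (sin s * cos s / 2)", OF _ _ _ assms])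
    show "((\<lambda>s. - (sin s * cos s / 2)) has_real_derivative (sin s)\<^sup>2 - 1 / 2) (at s)" for s :: real
      using DERIV_minus[OF dsc[of s]] by (simp add: sin_squared_eq)
  qed (use abs_sin_cos_half in \<open>auto intro!: continuous_intros\<close>)
  show "\<bar>(LBINT s:{0..m}. (cos s)\<^sup>2) - 1/2 * m\<bar> \<le> 2"
  proof (rule mean_bound[where \<Theta> = "\<lambda>s. sin s * cos s / 2", OF _ _ _ assms])
    show "((\<lambda>s. sin s * cos s / 2) has_real_derivative (cos s)\<^sup>2 - 1 / 2) (at s)" for s :: real
      by (rule dsc)
  qed (use abs_sin_cos_half in \<open>auto intro!: continuous_intros\<close>)
  show "\<bar>(LBINT s:{0..m}. sin s * cos s) - 0 * m\<bar> \<le> 2"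
  proof (rule mean_bound[where \<Theta> = "\<lambda>s. (sin s)\<^sup>2 / 2", OF _ _ _ assms])
    show "((\<lambda>s. (sin s)\<^sup>2 / 2) has_real_derivative sin s * cos s - 0) (at s)" for s :: real
      by (rule derivative_eq_intros refl | simp)+
  qed (use abs_sin_cos_half in \<open>auto intro!: continuous_intros\<close>)
qed

text \<open>The first table of means is symmetric in \<open>a\<close> and \<open>b\<close>, the
  second antisymmetric. The antisymmetry later cancels the limit of the sine integrals.\<close>

lemma kern_means:
  fixes m :: real
  assumes "0 \<le> m"
  shows "\<bar>(LBINT s:{0..m}. kern a s * kern b s) - (if a = b then 1/2 else 0) * m\<bar> \<le> 2"
    "\<bar>(LBINT s:{0..m}. kern a s * kern' b s) - (if a = b then 0 else if a = 1 then 1/2 else - 1/2) * m\<bar> \<le> 2"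
proof -
  note t = trig_means[OF assms, unfolded power2_eq_square]
  have neg: "(LBINT s:{0..m}. - f s) = - (LBINT s:{0..m}. f s)" for f :: "real \<Rightarrow> real"
    by (simp add: set_lebesgue_integral_def)
  have a: "a = 1 \<or> a = 2" and b: "b = 1 \<or> b = 2" using exhaust_2 by auto
  show "\<bar>(LBINT s:{0..m}. kern a s * kern b s) - (if a = b then 1/2 else 0) * m\<bar> \<le> 2"
    using a b t by (elim disjE) (simp_all add: kern_def neg mult.commute[of "cos _" "sin _"])
  show "\<bar>(LBINT s:{0..m}. kern a s * kern' b s) - (if a = b then 0 else if a = 1 then 1/2 else - 1/2) * m\<bar> \<le> 2"
    using a b t by (elim disjE) (simp_all add: kern_def kern'_def neg mult.commute[of "cos _" "sin _"])
qed

text \<open>The limit controls large arguments, the linear bound all others.\<close>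

lemma bounded_of_tendsto_at_top:
  fixes G :: "real \<Rightarrow> real"
  assumes lim: "(G \<longlongrightarrow> l) at_top" and b: "\<And>u. \<bar>G u\<bar> \<le> b * max 0 u" and "0 \<le> b"
  shows "\<exists>C. \<forall>u. \<bar>G u\<bar> \<le> C"
proof -
  have "\<forall>\<^sub>F u in at_top. dist (G u) l < 1" using lim by (rule tendstoD) simp
  then obtain T where T: "\<And>u. T \<le> u \<Longrightarrow> dist (G u) l < 1" unfolding eventually_at_top_linorder by blast
  have "\<bar>G u\<bar> \<le> max (b * max 0 T) (\<bar>l\<bar> + 1)" for u
  proof (cases "T \<le> u")
    case True
    from T[OF this] show ?thesis by (simp add: dist_real_def)
  next
    case False
    then have "b * max 0 u \<le> b * max 0 T" using \<open>0 \<le> b\<close> by (intro mult_left_mono) auto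
    with b[of u] show ?thesis by simp
  qed
  then show ?thesis by blast
qed

context stationary_noise
begin

definition osc_noise :: "2 \<Rightarrow> real \<Rightarrow> 'a \<Rightarrow> real" where
  "osc_noise a x = noise_integral (\<lambda>s. indicator {0..x} s * kern a s)"

lemma trig_integral_linear_bound:
  "\<bar>cosine_integral covar u\<bar> \<le> covar 0 * max 0 u" "\<bar>sine_integral covar u\<bar> \<le> covar 0 * max 0 u"
proof -
  have *: "\<bar>LBINT z:{0..u}. covar z * g z\<bar> \<le> covar 0 * max 0 u" if g: "\<And>z. \<bar>g z\<bar> \<le> 1"
      and [measurable]: "g \<in> borel_measurable borel" for g
  proof -
    have b: "\<bar>indicator {0..u} z *\<^sub>R (covar z * g z)\<bar> \<le> covar 0 * indicator {0..u} z" for z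
      using mult_mono[OF covar_bound[of z] g[of z]] covar_0_nonneg by (auto simp: indicator_def abs_mult)
    have i: "integrable lborel (\<lambda>z. indicator {0..u} z *\<^sub>R (covar z * g z))"
      by (rule integrable_bounded_support[OF _ b]) simp
    have i2: "integrable lborel (\<lambda>z. covar 0 * indicator {0..u} z)"
      by (rule integrable_bounded_support[of _ "covar 0" 0 u]) (auto simp: covar_0_nonneg)
    have "\<bar>LBINT z:{0..u}. covar z * g z\<bar> \<le> (LBINT z. \<bar>indicator {0..u} z *\<^sub>R (covar z * g z)\<bar>)"
      unfolding set_lebesgue_integral_def by (rule integral_abs_bound)
    also have "\<dots> \<le> (LBINT z. covar 0 * indicator {0..u} z)"
      using i i2 b by (intro integral_mono) auto
    also have "\<dots> = covar 0 * max 0 u" by (cases "0 \<le> u") auto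
    finally show ?thesis .
  qed
  show "\<bar>cosine_integral covar u\<bar> \<le> covar 0 * max 0 u"
    using *[of cos] by (simp add: cosine_integral_def[OF covar_measurable covar_bound covar_neg])
  show "\<bar>sine_integral covar u\<bar> \<le> covar 0 * max 0 u"
    using *[of sin] by (simp add: sine_integral_def[OF covar_measurable covar_bound covar_neg])
qed

lemmas trig_integral_measurable[measurable] =
  measurable_trig_integral[OF covar_measurable covar_bound covar_neg]

text \<open>Additivity of the Bochner integral holds on paths where both integrands are integrable,
  hence almost surely.\<close>

lemma osc_noise_increment:
  assumes "0 \<le> x" "x \<le> y"
  shows "AE \<omega> in M. osc_noise a y \<omega> - osc_noise a x \<omega> = noise_integral (\<lambda>s. indicator {x..y} s * kern a s) \<omega>"
proof -
  from assms have "0 \<le> y" by simp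
  from noise_path_integrable[OF admissible_kern[OF order_refl, of y a]]
    noise_path_integrable[OF admissible_kern[OF order_refl, of x a]] AE_space
  show ?thesis
  proof eventually_elim
    case (elim \<omega>)
    then have [measurable]: "(\<lambda>s. noise_ext s \<omega>) \<in> borel_measurable borel"
      by (intro noise_ext_measurable_compose) auto
    have "osc_noise a y \<omega> - osc_noise a x \<omega> =
        (LBINT s. indicator {0..y} s * kern a s * noise_ext s \<omega> - indicator {0..x} s * kern a s * noise_ext s \<omega>)"
      unfolding osc_noise_def noise_integral_def using elim by simp
    also have "\<dots> = (LBINT s. indicator {x..y} s * kern a s * noise_ext s \<omega>)"
    proof (rule integral_cong_AE)
      show "AE s in lborel. indicator {0..y} s * kern a s * noise_ext s \<omega> - indicator {0..x} s * kern a s * noise_ext s \<omega>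
          = indicator {x..y} s * kern a s * noise_ext s \<omega>"
        using AE_lborel_singleton[of x] by eventually_elim (use assms in \<open>auto simp: indicator_def\<close>)
    qed measurable
    finally show ?case by (simp add: noise_integral_def)
  qed
qed

end

text \<open>From here on, slow variation and the exponent enter only through the existence of these
  two limits.\<close>

locale oscillating_noise = stationary_noise +
  fixes D S :: real
  assumes Dlim: "(cosine_integral covar \<longlongrightarrow> D) at_top" and Slim: "(sine_integral covar \<longlongrightarrow> S) at_top"
begin

lemma trig_integral_bounded: "\<exists>C. \<forall>u. \<bar>cosine_integral covar u\<bar> \<le> C \<and> \<bar>sine_integral covar u\<bar> \<le> C"
proof -
  obtain C1 where "\<And>u. \<bar>cosine_integral covar u\<bar> \<le> C1"
    using bounded_of_tendsto_at_top[OF Dlim trig_integral_linear_bound(1) covar_0_nonneg] by blast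
  moreover obtain C2 where "\<And>u. \<bar>sine_integral covar u\<bar> \<le> C2"
    using bounded_of_tendsto_at_top[OF Slim trig_integral_linear_bound(2) covar_0_nonneg] by blast
  ultimately show ?thesis by (intro exI[of _ "max C1 C2"]) (simp add: le_max_iff_disj)
qed

text \<open>The bound is uniform in the starting point because the lag integrals depend on
  \<open>y - s\<close> alone and are bounded by \<open>C\<close>. Each of the two lag forms
  contributes \<open>2 * C\<close> per unit of time, hence the witness \<open>4 * C\<close>.\<close>

lemma osc_noise_variance_bound:
  "\<exists>K\<ge>0. \<forall>a x y. 0 \<le> x \<longrightarrow> x \<le> y \<longrightarrow>
     expectation (\<lambda>\<omega>. (noise_integral (\<lambda>s. indicator {x..y} s * kern a s) \<omega>)\<^sup>2) \<le> K * (y - x)"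
proof -
  obtain C where C: "\<And>u. \<bar>cosine_integral covar u\<bar> \<le> C" "\<And>u. \<bar>sine_integral covar u\<bar> \<le> C"
    using trig_integral_bounded by blast
  have "0 \<le> C" using C(1)[of 0] by simp
  have bound: "expectation (\<lambda>\<omega>. (noise_integral (\<lambda>s. indicator {x..y} s * kern a s) \<omega>)\<^sup>2) \<le> 4 * C * (y - x)"
    if xy: "0 \<le> x" "x \<le> y" for a x y
  proof -
    let ?f = "\<lambda>s. indicator {x..y} s * kern a s"
    let ?k = "\<lambda>s. kern a s * (kern a s * cosine_integral covar (y - s) + kern' a s * sine_integral covar (y - s))"
    have adm: "admissible ?f" using xy by (intro admissible_kern)
    have var: "expectation (\<lambda>\<omega>. (noise_integral ?f \<omega>)\<^sup>2) = 2 * lag_form covar ?f ?f"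
      using noise_integral_covariance[OF adm adm] by (simp add: power2_eq_square)
    have "lag_form covar ?f ?f = (LBINT s:{x..y}. ?k s)"
      using lag_form_trig[OF covar_measurable covar_bound covar_neg kern_add, of x y "kern a" y a] by simp
    also have "\<dots> \<le> (LBINT s. 2 * C * indicator {x..y} s)"
      unfolding set_lebesgue_integral_def
    proof (rule integral_mono)
      have kb: "\<bar>?k s\<bar> \<le> 2 * C" for s
      proof -
        have "\<bar>kern a s * cosine_integral covar (y - s)\<bar> \<le> 1 * C"
          unfolding abs_mult using kern_bound(1)[of a s] C(1)[of "y - s"] by (intro mult_mono) auto
        moreover have "\<bar>kern' a s * sine_integral covar (y - s)\<bar> \<le> 1 * C"
          unfolding abs_mult using kern_bound(2)[of a s] C(2)[of "y - s"] by (intro mult_mono) auto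
        ultimately have "\<bar>kern a s * cosine_integral covar (y - s) + kern' a s * sine_integral covar (y - s)\<bar> \<le> 2 * C"
          by linarith
        then have "\<bar>?k s\<bar> \<le> 1 * (2 * C)"
          unfolding abs_mult[of "kern a s"] using kern_bound(1)[of a s] by (intro mult_mono) auto
        then show ?thesis by simp
      qed
      then have kb': "\<bar>indicator {x..y} s *\<^sub>R ?k s\<bar> \<le> 2 * C * indicator {x..y} s" for s
        by (simp add: indicator_def)
      show "integrable lborel (\<lambda>s. indicator {x..y} s *\<^sub>R ?k s)"
        by (rule integrable_bounded_support[OF _ kb']) measurable
      show "integrable lborel (\<lambda>s. 2 * C * indicator {x..y} s)"
        by (rule integrable_bounded_support[of _ "2 * C" x y]) (use \<open>0 \<le> C\<close> in auto)
      show "indicator {x..y} s *\<^sub>R ?k s \<le> 2 * C * indicator {x..y} s" for s using kb'[of s] by linarith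
    qed
    also have "\<dots> = 2 * C * (y - x)" using xy by simp
    finally show ?thesis unfolding var by simp
  qed
  show ?thesis
  proof (intro exI[of _ "4 * C"] conjI allI impI)
    show "0 \<le> 4 * C" using \<open>0 \<le> C\<close> by simp
  qed (rule bound)
qed

text \<open>The products of kernels average separately, one against the cosine and one against the
  sine integral. This half of the covariance still contains \<open>S\<close>.\<close>

lemma lag_form_limit:
  assumes "0 \<le> \<alpha>" "0 \<le> \<beta>"
  shows "((\<lambda>T. (1 / T) * lag_form covar (\<lambda>s. indicator {0..\<alpha> * T} s * kern a s) (\<lambda>s. indicator {0..\<beta> * T} s * kern b s))
    \<longlongrightarrow> min \<alpha> \<beta> * (if a = b then 1/2 else 0) * D + min \<alpha> \<beta> * (if a = b then 0 else if a = 1 then 1/2 else - 1/2) * S) at_top"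
proof -
  obtain C where C: "\<And>u. \<bar>cosine_integral covar u\<bar> \<le> C" "\<And>u. \<bar>sine_integral covar u\<bar> \<le> C"
    using trig_integral_bounded by blast
  have k1: "\<bar>kern a s * kern b s\<bar> \<le> 1" "\<bar>kern a s * kern' b s\<bar> \<le> 1" for s
    using mult_mono[OF kern_bound(1)[of a s] kern_bound(1)[of b s]] mult_mono[OF kern_bound(1)[of a s] kern_bound(2)[of b s]]
    by (auto simp: abs_mult)
  have l1: "((\<lambda>T. (1 / T) * (LBINT s:{0..min \<alpha> \<beta> * T}. kern a s * kern b s * cosine_integral covar (\<beta> * T - s)))
      \<longlongrightarrow> min \<alpha> \<beta> * (if a = b then 1/2 else 0) * D) at_top"
    by (rule averaging_limit[where C = C and c = 2, OF _ _ k1(1) C(1) Dlim kern_means(1)]) (use assms in auto)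
  have l2: "((\<lambda>T. (1 / T) * (LBINT s:{0..min \<alpha> \<beta> * T}. kern a s * kern' b s * sine_integral covar (\<beta> * T - s)))
      \<longlongrightarrow> min \<alpha> \<beta> * (if a = b then 0 else if a = 1 then 1/2 else - 1/2) * S) at_top"
    by (rule averaging_limit[where C = C and c = 2, OF _ _ k1(2) C(2) Slim kern_means(2)]) (use assms in auto)
  show ?thesis
  proof (rule Lim_transform_eventually[OF tendsto_add[OF l1 l2]], rule eventually_mono[OF eventually_gt_at_top[of 0]])
    fix T :: real assume T: "0 < T"
    have mn: "min (\<alpha> * T) (\<beta> * T) = min \<alpha> \<beta> * T" using T by (simp add: min_def)
    have i: "set_integrable lborel {0..m} (\<lambda>s. k s * G (\<beta> * T - s))"
      if [measurable]: "k \<in> borel_measurable borel" "G \<in> borel_measurable borel"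
        and k: "\<And>s. \<bar>k s\<bar> \<le> 1" and G: "\<And>u. \<bar>G u\<bar> \<le> C" for k G m
    proof -
      have "\<bar>indicator {0..m} s *\<^sub>R (k s * G (\<beta> * T - s))\<bar> \<le> C * indicator {0..m} s" for s
        using mult_mono[OF k[of s] G[of "\<beta> * T - s"]] by (auto simp: indicator_def abs_mult)
      then show ?thesis unfolding set_integrable_def by (rule integrable_bounded_support[rotated]) measurable
    qed
    have "lag_form covar (\<lambda>s. indicator {0..\<alpha> * T} s * kern a s) (\<lambda>s. indicator {0..\<beta> * T} s * kern b s) =
        (LBINT s:{0..min \<alpha> \<beta> * T}. kern a s * (kern b s * cosine_integral covar (\<beta> * T - s) + kern' b s * sine_integral covar (\<beta> * T - s)))"
      using lag_form_trig[OF covar_measurable covar_bound covar_neg kern_add, of 0 "\<alpha> * T" "kern a" "\<beta> * T" b] by (simp add: mn)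
    also have "\<dots> = (LBINT s:{0..min \<alpha> \<beta> * T}. (kern a s * kern b s) * cosine_integral covar (\<beta> * T - s) +
        (kern a s * kern' b s) * sine_integral covar (\<beta> * T - s))"
      by (simp add: distrib_left mult.assoc)
    also have "\<dots> = (LBINT s:{0..min \<alpha> \<beta> * T}. kern a s * kern b s * cosine_integral covar (\<beta> * T - s)) +
        (LBINT s:{0..min \<alpha> \<beta> * T}. kern a s * kern' b s * sine_integral covar (\<beta> * T - s))"
      by (rule set_integral_add(2); rule i) (auto simp: k1 C)
    finally show "1 / T * (LBINT s:{0..min \<alpha> \<beta> * T}. kern a s * kern b s * cosine_integral covar (\<beta> * T - s)) +
         1 / T * (LBINT s:{0..min \<alpha> \<beta> * T}. kern a s * kern' b s * sine_integral covar (\<beta> * T - s)) =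
         1 / T * lag_form covar (\<lambda>s. indicator {0..\<alpha> * T} s * kern a s) (\<lambda>s. indicator {0..\<beta> * T} s * kern b s)"
      by (simp add: distrib_left)
  qed
qed

text \<open>Adding the two halves doubles the cosine part \<open>D / 2\<close> for equal components.
  The sine parts have coefficients antisymmetric in \<open>a\<close> and \<open>b\<close> and
  cancel.\<close>

lemma osc_noise_covariance_limit:
  assumes "0 \<le> \<alpha>" "0 \<le> \<beta>"
  shows "((\<lambda>T. (1 / T) * expectation (\<lambda>\<omega>. osc_noise a (\<alpha> * T) \<omega> * osc_noise b (\<beta> * T) \<omega>))
    \<longlongrightarrow> min \<alpha> \<beta> * (if a = b then D else 0)) at_top"
proof -
  have e: "expectation (\<lambda>\<omega>. osc_noise a (\<alpha> * T) \<omega> * osc_noise b (\<beta> * T) \<omega>) =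
      lag_form covar (\<lambda>s. indicator {0..\<alpha> * T} s * kern a s) (\<lambda>s. indicator {0..\<beta> * T} s * kern b s) +
      lag_form covar (\<lambda>s. indicator {0..\<beta> * T} s * kern b s) (\<lambda>s. indicator {0..\<alpha> * T} s * kern a s)" for T
    unfolding osc_noise_def by (intro noise_integral_covariance admissible_kern) auto
  have ab: "a = 1 \<or> a = 2" "b = 1 \<or> b = 2" using exhaust_2 by auto
  have "(min \<alpha> \<beta> * (if a = b then 1/2 else 0) * D + min \<alpha> \<beta> * (if a = b then 0 else if a = 1 then 1/2 else - 1/2) * S) +
      (min \<beta> \<alpha> * (if b = a then 1/2 else 0) * D + min \<beta> \<alpha> * (if b = a then 0 else if b = 1 then 1/2 else - 1/2) * S) =
      min \<alpha> \<beta> * (if a = b then D else 0)"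
    using ab by (elim disjE) (simp_all add: min.commute)
  with tendsto_add[OF lag_form_limit[OF assms, of a b] lag_form_limit[OF assms(2,1), of b a]]
  show ?thesis unfolding e distrib_left by simp
qed

text \<open>\<open>D\<close> is a limit of rescaled variances.\<close>

lemma diffusivity_nonneg: "0 \<le> D"
proof (rule tendsto_lowerbound)
  show "((\<lambda>T. (1 / T) * expectation (\<lambda>\<omega>. osc_noise 1 (1 * T) \<omega> * osc_noise 1 (1 * T) \<omega>)) \<longlongrightarrow> D) at_top"
    using osc_noise_covariance_limit[of 1 1 1 1] by simp
  show "\<forall>\<^sub>F T in at_top. 0 \<le> (1 / T) * expectation (\<lambda>\<omega>. osc_noise 1 (1 * T) \<omega> * osc_noise 1 (1 * T) \<omega>)"
    using eventually_gt_at_top[of 0] by eventually_elim simp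
qed simp

end

section \<open>The rotated system\<close>

text \<open>\<open>g\<close> is merely integrable, so its primitive need not be differentiable
  everywhere. Fubini on the triangle \<open>r \<le> s \<le> t\<close> leaves the fundamental theorem
  to the smooth factor \<open>A\<close>.\<close>

lemma integral_by_parts_Fubini:
  fixes A A' g :: "real \<Rightarrow> real"
  assumes g: "set_integrable lborel {0..t} g" and t: "0 \<le> t"
    and A: "\<And>s. (A has_real_derivative A' s) (at s)" and A': "continuous_on UNIV A'"
  shows "(LBINT s:{0..t}. A' s * (LBINT r:{0..s}. g r)) = A t * (LBINT r:{0..t}. g r) - (LBINT r:{0..t}. A r * g r)"
    and "set_integrable lborel {0..t} (\<lambda>r. A r * g r)"
proof -
  let ?g = "\<lambda>r. indicator {0..t} r * g r"
  have gi: "integrable lborel ?g" using g by (simp add: set_integrable_def)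
  then have [measurable]: "?g \<in> borel_measurable borel" using borel_measurable_integrable by force
  have [measurable]: "A' \<in> borel_measurable borel" using A' by (rule borel_measurable_continuous_onI)
  have Ac: "continuous_on UNIV A" using A by (auto intro!: continuous_at_imp_continuous_on DERIV_isCont)
  then have [measurable]: "A \<in> borel_measurable borel" by (rule borel_measurable_continuous_onI)
  have bounded: "\<exists>B. \<forall>s\<in>{0..t}. \<bar>f s\<bar> \<le> B" if "continuous_on UNIV f" for f :: "real \<Rightarrow> real"
  proof -
    have "bounded (f ` {0..t})"
      by (intro compact_imp_bounded compact_continuous_image continuous_on_subset[OF that]) auto
    then show ?thesis by (auto simp: bounded_iff)
  qed
  obtain B where B: "\<And>s. s \<in> {0..t} \<Longrightarrow> \<bar>A' s\<bar> \<le> B" using bounded[OF A'] by blast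
  obtain B2 where B2: "\<And>s. s \<in> {0..t} \<Longrightarrow> \<bar>A s\<bar> \<le> B2" using bounded[OF Ac] by blast
  have "0 \<le> B" using B[of 0] t by simp
  have "0 \<le> B2" using B2[of 0] t by simp
  have Ag: "integrable lborel (\<lambda>r. A r * ?g r)"
  proof (rule Bochner_Integration.integrable_bound)
    show "integrable lborel (\<lambda>r. B2 * ?g r)" using gi by simp
    show "AE r in lborel. norm (A r * ?g r) \<le> norm (B2 * ?g r)"
      using B2 \<open>0 \<le> B2\<close> by (intro AE_I2) (auto simp: indicator_def abs_mult intro: mult_right_mono)
  qed measurable
  then show "set_integrable lborel {0..t} (\<lambda>r. A r * g r)"
    unfolding set_integrable_def by (simp add: mult.left_commute)
  let ?k = "\<lambda>s r. indicator {0..t} s * A' s * (if r \<le> s then ?g r else 0)"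
  have int: "integrable (lborel \<Otimes>\<^sub>M lborel) (\<lambda>(s, r). ?k s r)"
  proof (rule lborel_pair.Fubini_integrable)
    show "(\<lambda>(s, r). ?k s r) \<in> borel_measurable (lborel \<Otimes>\<^sub>M lborel)" by measurable
    have ik: "integrable lborel (\<lambda>r. if r \<le> s then ?g r else 0)" for s
      by (rule Bochner_Integration.integrable_bound[OF gi]) (auto intro!: AE_I2)
    show "AE s in lborel. integrable lborel (\<lambda>r. case (s, r) of (s, r) \<Rightarrow> ?k s r)"
      using ik by (intro AE_I2) simp
    show "integrable lborel (\<lambda>s. LBINT r. norm (case (s, r) of (s, r) \<Rightarrow> ?k s r))"
    proof (rule Bochner_Integration.integrable_bound)
      show "integrable lborel (\<lambda>s. indicator {0..t} s * (B * (LBINT r. \<bar>?g r\<bar>)))"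
        using t by (intro integrable_mult_left integrable_real_indicator) auto
      show "(\<lambda>s. LBINT r. norm (case (s, r) of (s, r) \<Rightarrow> ?k s r)) \<in> borel_measurable lborel"
        by (rule lborel.borel_measurable_lebesgue_integral) measurable
      show "AE s in lborel. norm (LBINT r. norm (case (s, r) of (s, r) \<Rightarrow> ?k s r)) \<le> norm (indicator {0..t} s * (B * (LBINT r. \<bar>?g r\<bar>)))"
      proof (intro AE_I2)
        fix s
        show "norm (LBINT r. norm (case (s, r) of (s, r) \<Rightarrow> ?k s r)) \<le> norm (indicator {0..t} s * (B * (LBINT r. \<bar>?g r\<bar>)))"
        proof (cases "s \<in> {0..t}")
          case True
          have "(LBINT r. norm (case (s, r) of (s, r) \<Rightarrow> ?k s r)) = \<bar>A' s\<bar> * (LBINT r. \<bar>if r \<le> s then ?g r else 0\<bar>)"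
            using True by (simp add: abs_mult)
          also have "\<dots> \<le> B * (LBINT r. \<bar>?g r\<bar>)"
            using B[OF True] ik[of s] gi \<open>0 \<le> B\<close> by (intro mult_mono integral_mono integrable_abs integral_nonneg_AE) auto
          finally show ?thesis using True \<open>0 \<le> B\<close> by simp
        qed simp
      qed
    qed
  qed
  have "(LBINT s:{0..t}. A' s * (LBINT r:{0..s}. g r)) = (LBINT s. (LBINT r. ?k s r))"
    unfolding set_lebesgue_integral_def
  proof (rule Bochner_Integration.integral_cong[OF refl])
    fix s
    show "indicator {0..t} s *\<^sub>R (A' s * (LBINT r. indicator {0..s} r *\<^sub>R g r)) = (LBINT r. ?k s r)"
    proof (cases "s \<in> {0..t}")
      case True
      then have "(\<lambda>r. indicator {0..s} r *\<^sub>R g r) = (\<lambda>r. if r \<le> s then ?g r else 0)"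
        by (auto simp: fun_eq_iff indicator_def)
      then show ?thesis using True by simp
    qed simp
  qed
  also have "\<dots> = (LBINT r. (LBINT s. ?k s r))"
    using lborel_pair.Fubini_integral[OF int] by simp
  also have "\<dots> = (LBINT r. A t * ?g r - A r * ?g r)"
  proof (rule Bochner_Integration.integral_cong[OF refl])
    fix r
    show "(LBINT s. ?k s r) = A t * ?g r - A r * ?g r"
    proof (cases "r \<in> {0..t}")
      case True
      have "(LBINT s. ?k s r) = (LBINT s. (A' s * indicator {r..t} s) * g r)"
        using True by (intro Bochner_Integration.integral_cong) (auto simp: indicator_def)
      also have "\<dots> = (LBINT s. A' s * indicator {r..t} s) * g r" by simp
      also have "(LBINT s. A' s * indicator {r..t} s) = A t - A r"
        using True A' by (intro integral_FTC_Icc_real A) (auto simp: continuous_on_eq_continuous_at)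
      finally show ?thesis using True by (simp add: algebra_simps)
    next
      case False
      then have z: "indicator {0..t} r = (0 :: real)" by (auto simp: indicator_def)
      show ?thesis unfolding z by (simp cong: if_cong)
    qed
  qed
  also have "\<dots> = A t * (LBINT r. ?g r) - (LBINT r. A r * ?g r)" using gi Ag by simp
  finally show "(LBINT s:{0..t}. A' s * (LBINT r:{0..s}. g r)) = A t * (LBINT r:{0..t}. g r) - (LBINT r:{0..t}. A r * g r)"
    by (simp add: set_lebesgue_integral_def mult.left_commute)
qed

text \<open>The noise enters only through its primitive \<open>V\<close>: \<open>x2 - V\<close> is continuously differentiable, so the
  rotated solution can be differentiated once \<open>V\<close> has been split off.\<close>

lemma rotated_solution:
  fixes x1 x2 g :: "real \<Rightarrow> real"
  assumes c: "continuous_on {0..} x1" "continuous_on {0..} x2"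
    and g: "\<And>t. 0 \<le> t \<Longrightarrow> set_integrable lborel {0..t} g"
    and e1: "\<And>t. 0 \<le> t \<Longrightarrow> ((\<lambda>s. k * x2 s) has_integral x1 t - x1 0) {0..t}"
    and e2: "\<And>t. 0 \<le> t \<Longrightarrow> ((\<lambda>s. - (k * x1 s) + g s) has_integral x2 t - x2 0) {0..t}"
    and t: "0 \<le> t"
  shows "cos (k * t) * x1 t - sin (k * t) * x2 t = x1 0 - (LBINT s:{0..t}. sin (k * s) * g s)"
    and "sin (k * t) * x1 t + cos (k * t) * x2 t = x2 0 + (LBINT s:{0..t}. cos (k * s) * g s)"
proof -
  define V where "V s = (LBINT r:{0..s}. g r)" for s
  have gV: "(g has_integral V s) {0..s}" if "0 \<le> s" for s
    unfolding V_def using set_borel_integral_eq_integral[OF g[OF that]] by (metis integrable_integral)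
  have "(g has_integral V 0) {0}" using gV[of 0] by simp
  then have V0: "V 0 = 0" by (rule has_integral_unique) (rule has_integral_refl)
  define \<xi> where "\<xi> s = x2 s - V s" for s
  have i\<xi>: "((\<lambda>s. - (k * x1 s)) has_integral \<xi> s - \<xi> 0) {0..s}" if "0 \<le> s" for s
    using has_integral_diff[OF e2[OF that] gV[OF that]] by (simp add: \<xi>_def V0 algebra_simps)
  have deriv: "(f has_real_derivative f' s) (at s within {0..t})"
    if f': "continuous_on {0..} f'" and fi: "\<And>s. 0 \<le> s \<Longrightarrow> (f' has_integral f s - f 0) {0..s}" and s: "s \<in> {0..t}"
    for f f' :: "real \<Rightarrow> real" and s
  proof -
    have "((\<lambda>u. integral {0..u} f') has_vector_derivative f' s) (at s within {0..t})"
      by (rule integral_has_vector_derivative[OF continuous_on_subset[OF f']]) (use s in auto)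
    then have "((\<lambda>u. f 0 + integral {0..u} f') has_vector_derivative f' s) (at s within {0..t})"
      by (auto intro!: derivative_eq_intros)
    then have "(f has_vector_derivative f' s) (at s within {0..t})"
    proof (rule has_vector_derivative_transform[OF s, rotated])
      show "f u = f 0 + integral {0..u} f'" if "u \<in> {0..t}" for u
        using integral_unique[OF fi[of u]] that by simp
    qed
    then show ?thesis by (simp add: has_real_derivative_iff_has_vector_derivative)
  qed
  have d1: "(x1 has_real_derivative k * x2 s) (at s within {0..t})" if "s \<in> {0..t}" for s
    by (rule deriv[OF _ e1 that]) (auto intro!: continuous_intros c)
  have d2: "(\<xi> has_real_derivative - (k * x1 s)) (at s within {0..t})" if "s \<in> {0..t}" for s
    by (rule deriv[OF _ i\<xi> that]) (auto intro!: continuous_intros c)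
  have ic: "(h has_integral (LBINT s:{0..t}. h s)) {0..t}" if "set_integrable lborel {0..t} h" for h :: "real \<Rightarrow> real"
    using set_borel_integral_eq_integral[OF that] by (metis integrable_integral)
  \<comment> \<open>Rotation cancels the linear drift; what remains is \<open>V\<close>, now a
    continuous forcing, because \<open>x2 - \<xi> = V\<close>.\<close>
  have y1: "((\<lambda>s. k * cos (k * s) * V s) has_integral (cos (k * t) * x1 t - sin (k * t) * \<xi> t) - (cos (k * 0) * x1 0 - sin (k * 0) * \<xi> 0)) {0..t}"
  proof (rule fundamental_theorem_of_calculus[OF t])
    fix s assume s: "s \<in> {0..t}"
    have "((\<lambda>s. cos (k * s) * x1 s - sin (k * s) * \<xi> s) has_real_derivative
        (- sin (k * s) * k * x1 s + cos (k * s) * (k * x2 s)) - (cos (k * s) * k * \<xi> s + sin (k * s) * - (k * x1 s))) (at s within {0..t})"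
      by (auto intro!: derivative_eq_intros d1[OF s] d2[OF s] simp: algebra_simps)
    moreover have "(- sin (k * s) * k * x1 s + cos (k * s) * (k * x2 s)) - (cos (k * s) * k * \<xi> s + sin (k * s) * - (k * x1 s)) =
        k * cos (k * s) * V s" by (simp add: \<xi>_def algebra_simps)
    ultimately show "((\<lambda>s. cos (k * s) * x1 s - sin (k * s) * \<xi> s) has_vector_derivative k * cos (k * s) * V s) (at s within {0..t})"
      by (simp add: has_real_derivative_iff_has_vector_derivative)
  qed
  have y2: "((\<lambda>s. k * sin (k * s) * V s) has_integral (sin (k * t) * x1 t + cos (k * t) * \<xi> t) - (sin (k * 0) * x1 0 + cos (k * 0) * \<xi> 0)) {0..t}"
  proof (rule fundamental_theorem_of_calculus[OF t])
    fix s assume s: "s \<in> {0..t}"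
    have "((\<lambda>s. sin (k * s) * x1 s + cos (k * s) * \<xi> s) has_real_derivative
        (cos (k * s) * k * x1 s + sin (k * s) * (k * x2 s)) + (- sin (k * s) * k * \<xi> s + cos (k * s) * - (k * x1 s))) (at s within {0..t})"
      by (auto intro!: derivative_eq_intros d1[OF s] d2[OF s] simp: algebra_simps)
    moreover have "(cos (k * s) * k * x1 s + sin (k * s) * (k * x2 s)) + (- sin (k * s) * k * \<xi> s + cos (k * s) * - (k * x1 s)) =
        k * sin (k * s) * V s" by (simp add: \<xi>_def algebra_simps)
    ultimately show "((\<lambda>s. sin (k * s) * x1 s + cos (k * s) * \<xi> s) has_vector_derivative k * sin (k * s) * V s) (at s within {0..t})"
      by (simp add: has_real_derivative_iff_has_vector_derivative)
  qed
  have Vc: "continuous_on {0..t} V"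
  proof -
    have "continuous_on {0..t} \<xi>" by (rule DERIV_continuous_on[OF d2])
    then have "continuous_on {0..t} (\<lambda>s. x2 s - \<xi> s)"
      by (intro continuous_intros continuous_on_subset[OF c(2)]) auto
    then show ?thesis by (simp add: \<xi>_def)
  qed
  have si: "set_integrable lborel {0..t} (\<lambda>s. h s * V s)" if "continuous_on {0..t} h" for h
    by (rule borel_integrable_atLeastAtMost') (intro continuous_intros that Vc)
  \<comment> \<open>Integration by parts turns \<open>V\<close> back into an integral against
    \<open>g\<close>; the boundary term restores \<open>x2\<close> from
    \<open>\<xi>\<close>.\<close>
  have p1: "(LBINT s:{0..t}. k * cos (k * s) * V s) = sin (k * t) * V t - (LBINT s:{0..t}. sin (k * s) * g s)"
    unfolding V_def by (rule integral_by_parts_Fubini(1)[OF g[OF t] t])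
      (auto intro!: derivative_eq_intros continuous_intros)
  have p2: "(LBINT s:{0..t}. - (k * sin (k * s)) * V s) = cos (k * t) * V t - (LBINT s:{0..t}. cos (k * s) * g s)"
    unfolding V_def by (rule integral_by_parts_Fubini(1)[OF g[OF t] t])
      (auto intro!: derivative_eq_intros continuous_intros)
  have "(LBINT s:{0..t}. k * cos (k * s) * V s) = (cos (k * t) * x1 t - sin (k * t) * \<xi> t) - (cos (k * 0) * x1 0 - sin (k * 0) * \<xi> 0)"
    by (rule has_integral_unique[OF ic[OF si] y1]) (auto intro!: continuous_intros)
  with p1 show "cos (k * t) * x1 t - sin (k * t) * x2 t = x1 0 - (LBINT s:{0..t}. sin (k * s) * g s)"
    by (simp add: \<xi>_def algebra_simps)
  have "(LBINT s:{0..t}. k * sin (k * s) * V s) = (sin (k * t) * x1 t + cos (k * t) * \<xi> t) - (sin (k * 0) * x1 0 + cos (k * 0) * \<xi> 0)"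
    by (rule has_integral_unique[OF ic[OF si] y2]) (auto intro!: continuous_intros)
  moreover have "(LBINT s:{0..t}. - (k * sin (k * s)) * V s) = - (LBINT s:{0..t}. k * sin (k * s) * V s)"
    by (simp add: set_lebesgue_integral_def)
  ultimately show "sin (k * t) * x1 t + cos (k * t) * x2 t = x2 0 + (LBINT s:{0..t}. cos (k * s) * g s)"
    using p2 by (simp add: \<xi>_def V0 algebra_simps)
qed

section \<open>Brownian motion\<close>

lemma inner_vec_sum: "(u :: real ^ 'n) \<bullet> w = (\<Sum>a\<in>UNIV. u $ a * w $ a)"
  by (simp add: inner_vec_def)

lemma (in prob_space) centred_gaussian_vector_inner:
  assumes "centered_gaussian_vector M Y C"
  shows "centred_gaussian M (\<lambda>\<omega>. u \<bullet> Y \<omega>)" "centred_gaussian M (\<lambda>\<omega>. Y \<omega> $ a)"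
    "expectation (\<lambda>\<omega>. Y \<omega> $ a * Y \<omega> $ b) = C $ a $ b"
proof -
  have g: "gaussian_rv M (\<lambda>\<omega>. u \<bullet> Y \<omega>)" for u
    using assms by (auto simp: centered_gaussian_vector_def)
  have z: "expectation (\<lambda>\<omega>. Y \<omega> $ i) = 0" for i
    using assms by (auto simp: centered_gaussian_vector_def)
  show c: "centred_gaussian M (\<lambda>\<omega>. Y \<omega> $ a)" for a
    using g[of "axis a 1"] z[of a] by (intro gaussian_rv_centred) (simp_all add: inner_axis inner_commute)
  have "expectation (\<lambda>\<omega>. u \<bullet> Y \<omega>) = (\<Sum>a\<in>UNIV. u $ a * expectation (\<lambda>\<omega>. Y \<omega> $ a))"
    unfolding inner_vec_sum using centred_gaussian_moments(1)[OF c]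
    by (simp add: Bochner_Integration.integral_sum)
  then show "centred_gaussian M (\<lambda>\<omega>. u \<bullet> Y \<omega>)" using g z by (intro gaussian_rv_centred) simp_all
  show "expectation (\<lambda>\<omega>. Y \<omega> $ a * Y \<omega> $ b) = C $ a $ b"
    using assms by (simp add: centered_gaussian_vector_def)
qed

context
  fixes N :: "'b measure" and D :: "real ^ 'n ^ 'n" and x :: "real ^ 'n" and W :: "real \<Rightarrow> 'b \<Rightarrow> real ^ 'n"
  assumes bm: "brownian_motion N D x W"
begin

lemma bm_prob: "prob_space N" and bm_cont: "continuous_process N W" and bm_start: "AE \<omega> in N. W 0 \<omega> = x"
  and bm_vec: "0 \<le> t \<Longrightarrow> centered_gaussian_vector N (\<lambda>\<omega>. W t \<omega> - W 0 \<omega>) (t *\<^sub>R D)"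
  and bm_stat: "0 \<le> t \<Longrightarrow> 0 \<le> h \<Longrightarrow> distr N borel (\<lambda>\<omega>. W (t + h) \<omega> - W t \<omega>) = distr N borel (\<lambda>\<omega>. W h \<omega> - W 0 \<omega>)"
  and bm_indep: "0 \<le> \<tau> 0 \<Longrightarrow> (\<And>i. i < n \<Longrightarrow> \<tau> i \<le> \<tau> (Suc i)) \<Longrightarrow>
     prob_space.indep_vars N (\<lambda>_. borel) (\<lambda>i \<omega>. W (\<tau> (Suc i)) \<omega> - W (\<tau> i) \<omega>) {..<n}"
  using bm by (simp_all add: brownian_motion_def)

lemma bm_measurable: "0 \<le> t \<Longrightarrow> W t \<in> borel_measurable N"
  using bm_cont by (simp add: continuous_process_def)

text \<open>For \<open>s \<le> t\<close> the increment after \<open>s\<close> is centred and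
  independent of the one before, so only the covariance at time \<open>s\<close> remains.\<close>

lemma bm_covariance:
  assumes "0 \<le> s" "0 \<le> t"
  shows "(LINT \<omega>|N. (W s \<omega> - W 0 \<omega>) $ a * (W t \<omega> - W 0 \<omega>) $ b) = min s t * D $ a $ b"
proof -
  interpret N: prob_space N by (rule bm_prob)
  have le: "(LINT \<omega>|N. (W s \<omega> - W 0 \<omega>) $ a * (W t \<omega> - W 0 \<omega>) $ b) = s * D $ a $ b" if st: "0 \<le> s" "s \<le> t" for s t a b
  proof -
    have t: "0 \<le> t" using st by simp
    note gs = N.centred_gaussian_vector_inner[OF bm_vec[OF st(1)]]
    note gt = N.centred_gaussian_vector_inner[OF bm_vec[OF t]]
    define \<tau> where "\<tau> i = (if i = 0 then 0 else if i = Suc 0 then s else t)" for i :: nat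
    have "N.indep_vars (\<lambda>_. borel) (\<lambda>i \<omega>. W (\<tau> (Suc i)) \<omega> - W (\<tau> i) \<omega>) {..<2}"
      by (rule bm_indep) (use st in \<open>auto simp: \<tau>_def\<close>)
    from N.indep_vars_compose2[OF this, of "\<lambda>i y. if i = 0 then y $ a else y $ b" "\<lambda>_. borel"]
    have iv: "N.indep_vars (\<lambda>_. borel) (\<lambda>i \<omega>. if i = 0 then (W (\<tau> (Suc i)) \<omega> - W (\<tau> i) \<omega>) $ a else (W (\<tau> (Suc i)) \<omega> - W (\<tau> i) \<omega>) $ b) {..<2}"
      by simp
    have ia: "integrable N (\<lambda>\<omega>. (W s \<omega> - W 0 \<omega>) $ a)" for a by (rule N.centred_gaussian_moments(1)[OF gs(2)])
    have ib: "integrable N (\<lambda>\<omega>. (W t \<omega> - W 0 \<omega>) $ b)" for b by (rule N.centred_gaussian_moments(1)[OF gt(2)])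
    have id: "integrable N (\<lambda>\<omega>. (W t \<omega> - W s \<omega>) $ b)"
      using Bochner_Integration.integrable_diff[OF ib ia, of b b] by simp
    have d0: "(LINT \<omega>|N. (W t \<omega> - W s \<omega>) $ b) = 0"
    proof -
      have "(LINT \<omega>|N. (W t \<omega> - W s \<omega>) $ b) = (LINT \<omega>|N. (W t \<omega> - W 0 \<omega>) $ b - (W s \<omega> - W 0 \<omega>) $ b)" by simp
      also have "\<dots> = 0"
        unfolding Bochner_Integration.integral_diff[OF ib ia]
        using N.centred_gaussian_moments(2)[OF gs(2)] N.centred_gaussian_moments(2)[OF gt(2)] by simp
      finally show ?thesis .
    qed
    have two: "{..<2::nat} = {0, 1}" by auto
    have ii: "integrable N (\<lambda>\<omega>. if i = 0 then (W (\<tau> (Suc i)) \<omega> - W (\<tau> i) \<omega>) $ a else (W (\<tau> (Suc i)) \<omega> - W (\<tau> i) \<omega>) $ b)"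
      if "i \<in> {..<2}" for i :: nat
      using that ia[of a] id unfolding two by (auto simp: \<tau>_def)
    have prod: "(LINT \<omega>|N. (W s \<omega> - W 0 \<omega>) $ a * (W t \<omega> - W s \<omega>) $ b) = 0"
      and iprod: "integrable N (\<lambda>\<omega>. (W s \<omega> - W 0 \<omega>) $ a * (W t \<omega> - W s \<omega>) $ b)"
      using N.indep_vars_lebesgue_integral[OF _ iv ii] N.indep_vars_integrable[OF _ iv ii] d0
      by (auto simp: two \<tau>_def)
    have i0: "integrable N (\<lambda>\<omega>. (W s \<omega> - W 0 \<omega>) $ a * (W s \<omega> - W 0 \<omega>) $ b)"
      by (rule N.square_integrable_mult)
        (use gs(2) in \<open>auto intro: centred_gaussian_measurable N.centred_gaussian_moments(3)\<close>)
    have "(LINT \<omega>|N. (W s \<omega> - W 0 \<omega>) $ a * (W t \<omega> - W 0 \<omega>) $ b) =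
        (LINT \<omega>|N. (W s \<omega> - W 0 \<omega>) $ a * (W s \<omega> - W 0 \<omega>) $ b + (W s \<omega> - W 0 \<omega>) $ a * (W t \<omega> - W s \<omega>) $ b)"
      by (simp add: algebra_simps)
    also have "\<dots> = s * D $ a $ b"
      unfolding Bochner_Integration.integral_add[OF i0 iprod] prod gs(3) by simp
    finally show ?thesis .
  qed
  show ?thesis
  proof (cases "s \<le> t")
    case True
    then show ?thesis using le[OF assms(1) True] by simp
  next
    case False
    \<comment> \<open>Symmetry of \<open>D\<close> is a consequence: \<open>D\<close> is the
      covariance matrix of the increment over unit time.\<close>
    have sym: "D $ a $ b = D $ b $ a"
    proof -
      have "1 * D $ a $ b = (LINT \<omega>|N. (W 1 \<omega> - W 0 \<omega>) $ a * (W 1 \<omega> - W 0 \<omega>) $ b)" by (rule le[symmetric]) auto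
      also have "\<dots> = (LINT \<omega>|N. (W 1 \<omega> - W 0 \<omega>) $ b * (W 1 \<omega> - W 0 \<omega>) $ a)" by (simp only: mult.commute)
      also have "\<dots> = 1 * D $ b $ a" by (rule le) auto
      finally show ?thesis by simp
    qed
    from False have "(LINT \<omega>|N. (W t \<omega> - W 0 \<omega>) $ b * (W s \<omega> - W 0 \<omega>) $ a) = t * D $ b $ a"
      using le[of t s b a] assms by simp
    then show ?thesis using False sym by (simp add: mult.commute)
  qed
qed

text \<open>Joint Gaussianity across times is derived, since the definition gives it only at each
  single time. Summation by parts rewrites the combination in independent Gaussian increments, whose
  characteristic functions multiply.\<close>

lemma bm_linear_combination_gaussian:
  assumes "0 \<le> h"
  shows "centred_gaussian N (\<lambda>\<omega>. \<Sum>j\<le>m. c j \<bullet> (W (real j * h) \<omega> - W 0 \<omega>))"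
proof -
  interpret N: prob_space N by (rule bm_prob)
  define \<Delta> where "\<Delta> i \<omega> = W (real (Suc i) * h) \<omega> - W (real i * h) \<omega>" for i \<omega>
  \<comment> \<open>The increment from grid point \<open>i\<close> to \<open>i + 1\<close> is
    contained in every \<open>W (real j * h) - W 0\<close> with \<open>j > i\<close>.\<close>
  define u where "u i = (\<Sum>j\<le>m. if i < j then c j else 0)" for i
  have tele: "W (real j * h) \<omega> - W 0 \<omega> = (\<Sum>i<j. \<Delta> i \<omega>)" for j \<omega>
    using sum_lessThan_telescope[of "\<lambda>i. W (real i * h) \<omega>" j] by (simp add: \<Delta>_def)
  have eq: "(\<Sum>j\<le>m. c j \<bullet> (W (real j * h) \<omega> - W 0 \<omega>)) = (\<Sum>i<m. u i \<bullet> \<Delta> i \<omega>)" for \<omega>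
  proof -
    have "(\<Sum>j\<le>m. c j \<bullet> (W (real j * h) \<omega> - W 0 \<omega>)) = (\<Sum>j\<le>m. \<Sum>i<m. (if i < j then c j else 0) \<bullet> \<Delta> i \<omega>)"
    proof (rule sum.cong[OF refl])
      fix j assume j: "j \<in> {..m}"
      have "c j \<bullet> (W (real j * h) \<omega> - W 0 \<omega>) = (\<Sum>i<j. c j \<bullet> \<Delta> i \<omega>)" by (simp add: tele inner_sum_right)
      also have "\<dots> = (\<Sum>i<m. (if i < j then c j else 0) \<bullet> \<Delta> i \<omega>)"
        using j by (intro sum.mono_neutral_cong_left) auto
      finally show "c j \<bullet> (W (real j * h) \<omega> - W 0 \<omega>) = (\<Sum>i<m. (if i < j then c j else 0) \<bullet> \<Delta> i \<omega>)" .
    qed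
    also have "\<dots> = (\<Sum>i<m. \<Sum>j\<le>m. (if i < j then c j else 0) \<bullet> \<Delta> i \<omega>)" by (rule sum.swap)
    also have "\<dots> = (\<Sum>i<m. u i \<bullet> \<Delta> i \<omega>)" by (simp add: u_def inner_sum_left)
    finally show ?thesis .
  qed
  have [measurable]: "W t \<in> borel_measurable N" if "0 \<le> t" for t using that by (rule bm_measurable)
  have \<Delta>m[measurable]: "\<Delta> i \<in> borel_measurable N" for i
    unfolding \<Delta>_def[abs_def] by (intro borel_measurable_diff bm_measurable) (auto simp: assms)
  have ind: "N.indep_vars (\<lambda>_. borel) \<Delta> {..<m}"
    using bm_indep[of "\<lambda>i. real i * h" m] assms by (simp add: \<Delta>_def[abs_def] mult_right_mono)
  have ind2: "N.indep_vars (\<lambda>_. borel) (\<lambda>i \<omega>. u i \<bullet> \<Delta> i \<omega>) {..<m}"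
    by (rule N.indep_vars_compose2[OF ind]) measurable
  have g: "centred_gaussian N (\<lambda>\<omega>. u i \<bullet> \<Delta> i \<omega>)" for i
  proof -
    have "distr N borel (\<Delta> i) = distr N borel (\<lambda>\<omega>. W h \<omega> - W 0 \<omega>)"
      using bm_stat[of "real i * h" h] assms by (simp add: \<Delta>_def[abs_def] algebra_simps)
    then have "distr (distr N borel (\<Delta> i)) borel (\<lambda>y. u i \<bullet> y) = distr (distr N borel (\<lambda>\<omega>. W h \<omega> - W 0 \<omega>)) borel (\<lambda>y. u i \<bullet> y)"
      by simp
    then have "distr N borel (\<lambda>\<omega>. u i \<bullet> \<Delta> i \<omega>) = distr N borel (\<lambda>\<omega>. u i \<bullet> (W h \<omega> - W 0 \<omega>))"
      using assms by (simp add: distr_distr comp_def)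
    moreover have "centred_gaussian N (\<lambda>\<omega>. u i \<bullet> (W h \<omega> - W 0 \<omega>))"
      by (rule N.centred_gaussian_vector_inner(1)[OF bm_vec[OF assms]])
    ultimately show ?thesis by (simp add: centred_gaussian_def)
  qed
  define S where "S = (\<Sum>i<m. N.expectation (\<lambda>\<omega>. (u i \<bullet> \<Delta> i \<omega>)\<^sup>2))"
  show ?thesis unfolding eq
  proof (rule N.centred_gaussianI_char)
    show "(\<lambda>\<omega>. \<Sum>i<m. u i \<bullet> \<Delta> i \<omega>) \<in> borel_measurable N" by measurable
    show "0 \<le> S" by (simp add: S_def sum_nonneg)
    fix r
    have "char (distr N borel (\<lambda>\<omega>. \<Sum>i<m. u i \<bullet> \<Delta> i \<omega>)) r = (\<Prod>i<m. char (distr N borel (\<lambda>\<omega>. u i \<bullet> \<Delta> i \<omega>)) r)"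
      by (rule N.char_distr_sum[OF ind2])
    also have "\<dots> = (\<Prod>i<m. complex_of_real (exp (- (r\<^sup>2 * N.expectation (\<lambda>\<omega>. (u i \<bullet> \<Delta> i \<omega>)\<^sup>2)) / 2)))"
      by (simp only: N.centred_gaussian_char[OF g])
    also have "\<dots> = complex_of_real (exp (\<Sum>i<m. - (r\<^sup>2 * N.expectation (\<lambda>\<omega>. (u i \<bullet> \<Delta> i \<omega>)\<^sup>2)) / 2))"
      by (simp only: of_real_prod[symmetric] exp_sum finite_lessThan)
    also have "(\<Sum>i<m. - (r\<^sup>2 * N.expectation (\<lambda>\<omega>. (u i \<bullet> \<Delta> i \<omega>)\<^sup>2)) / 2) = - (r\<^sup>2 * S) / 2"
      by (simp add: S_def sum_negf sum_divide_distrib sum_distrib_left)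
    finally show "char (distr N borel (\<lambda>\<omega>. \<Sum>i<m. u i \<bullet> \<Delta> i \<omega>)) r = complex_of_real (exp (- (r\<^sup>2 * S) / 2))" .
  qed
qed

end

section \<open>Convergence of the energy\<close>

definition rotate :: "real \<Rightarrow> real ^ 2 \<Rightarrow> real ^ 2" where
  "rotate \<theta> x = (\<chi> i. if i = 1 then cos \<theta> * x $ 1 - sin \<theta> * x $ 2 else sin \<theta> * x $ 1 + cos \<theta> * x $ 2)"

lemma H_components: "H x = ((x $ 1)\<^sup>2 + (x $ 2)\<^sup>2) / 2"
  unfolding H_def power2_norm_eq_inner inner_vec_def by (simp add: sum_2 power2_eq_square)

lemma H_rotate: "H (rotate \<theta> x) = H x"
proof -
  have "(c * a - s * b)\<^sup>2 + (s * a + c * b)\<^sup>2 = (s\<^sup>2 + c\<^sup>2) * (a\<^sup>2 + b\<^sup>2)" for a b c s :: real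
    by (simp add: power2_eq_square algebra_simps)
  then show ?thesis by (simp add: H_components rotate_def)
qed

lemma perp_grad_H: "perp_grad H x $ 1 = x $ 2" "perp_grad H x $ 2 = - x $ 1"
proof -
  have "partial_deriv i H x = x $ i" for i
    unfolding partial_deriv_def
  proof (rule DERIV_imp_deriv)
    have e: "H (x + s *\<^sub>R axis i 1) = H x + s * x $ i + s\<^sup>2 / 2" for s
      unfolding H_def power2_norm_eq_inner
      by (simp add: inner_add_left inner_add_right inner_axis inner_axis' inner_commute power2_eq_square field_simps)
    show "((\<lambda>s. H (x + s *\<^sub>R axis i 1)) has_real_derivative x $ i) (at 0)"
      unfolding e by (auto intro!: derivative_eq_intros)
  qed
  then show "perp_grad H x $ 1 = x $ 2" "perp_grad H x $ 2 = - x $ 1"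
    by (simp_all add: perp_grad_def)
qed

lemma rotate_continuous:
  fixes f :: "'a::t2_space \<Rightarrow> real"
  assumes "continuous_on A f" "continuous_on A g"
  shows "continuous_on A (\<lambda>t. rotate (f t) (g t))"
proof -
  have "continuous_on A (\<lambda>t. rotate (f t) (g t) $ i)" for i
    using assms by (cases "i = 1") (auto simp: rotate_def intro!: continuous_intros)
  then have "continuous_on A (\<lambda>t. \<chi> i. rotate (f t) (g t) $ i)" by (rule continuous_on_vec_lambda)
  then show ?thesis by simp
qed

lemma norm_vec2_power4: "norm (x :: real ^ 2) ^ 4 \<le> 2 * ((x $ 1) ^ 4 + (x $ 2) ^ 4)"
proof -
  have "norm x ^ 4 = ((norm x)\<^sup>2)\<^sup>2" by (simp add: power_mult[symmetric])
  also have "(norm x)\<^sup>2 = (x $ 1)\<^sup>2 + (x $ 2)\<^sup>2"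
    unfolding power2_norm_eq_inner inner_vec_def by (simp add: sum_2 power2_eq_square)
  also have "(a\<^sup>2 + b\<^sup>2)\<^sup>2 \<le> 2 * (a ^ 4 + b ^ 4)" for a b :: real
    using zero_le_power2[of "a\<^sup>2 - b\<^sup>2"] by (simp add: power2_eq_square power4_eq_xxxx algebra_simps)
  finally show ?thesis by simp
qed

lemma centred_gaussian_cong_AE:
  assumes "AE \<omega> in M. U \<omega> = V \<omega>" "V \<in> borel_measurable M" "centred_gaussian M U"
  shows "centred_gaussian M V"
proof -
  have "distr M borel V = distr M borel U"
    using assms by (intro distr_cong_AE) (auto simp: centred_gaussian_def)
  then show ?thesis using assms by (auto simp: centred_gaussian_def)
qed

text \<open>\<open>H\<close> is not uniformly continuous on the plane, but a single path is bounded
  on \<open>[0, T]\<close>, so paths uniformly near it have uniformly near energies.\<close>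

lemma path_functional_energy:
  assumes "bounded_continuous_functional \<Phi>"
  shows "path_functional (\<lambda>f :: real \<Rightarrow> real ^ 2. \<Phi> (\<lambda>t. H (f t)))"
proof -
  have cont: "(\<lambda>t. H (f t)) \<in> continuous_paths" if "f \<in> paths" for f
    using that unfolding paths_def continuous_paths_def H_def by (auto intro!: continuous_intros)
  from assms obtain b where b: "\<And>f. f \<in> continuous_paths \<Longrightarrow> \<bar>\<Phi> f\<bar> \<le> b"
    unfolding bounded_continuous_functional_def by blast
  show ?thesis
  proof (rule path_functionalI)
    show "\<bar>\<Phi> (\<lambda>t. H (f t))\<bar> \<le> b" if "f \<in> paths" for f by (rule b[OF cont[OF that]])
    fix f :: "real \<Rightarrow> real ^ 2" and e :: real assume f: "f \<in> paths" and "0 < e"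
    from assms[unfolded bounded_continuous_functional_def, THEN conjunct2, THEN bspec, OF cont[OF f], THEN spec, THEN mp, OF \<open>0 < e\<close>]
    obtain T \<delta> where \<delta>: "0 < \<delta>"
      and \<Phi>: "\<And>g. g \<in> continuous_paths \<Longrightarrow> (\<forall>t\<in>{0..T}. \<bar>g t - H (f t)\<bar> < \<delta>) \<Longrightarrow> \<bar>\<Phi> g - \<Phi> (\<lambda>t. H (f t))\<bar> < e"
      by blast
    have "compact (f ` {0..T})"
      using f by (intro compact_continuous_image) (auto simp: paths_def intro: continuous_on_subset)
    then obtain B where B: "\<And>t. t \<in> {0..T} \<Longrightarrow> norm (f t) \<le> B"
      using compact_imp_bounded by (force simp: bounded_iff)
    define B' where "B' = \<bar>B\<bar> + 1"
    have "0 < B'" by (simp add: B'_def)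
    \<comment> \<open>The cap 1 keeps the nearby path within the bound \<open>B'\<close>; the
      quotient makes the energy difference smaller than \<open>\<delta>\<close>.\<close>
    define d where "d = min 1 (\<delta> / B')"
    have "0 < d" using \<delta> \<open>0 < B'\<close> by (simp add: d_def)
    have "\<bar>\<Phi> (\<lambda>t. H (g t)) - \<Phi> (\<lambda>t. H (f t))\<bar> < e"
      if g: "g \<in> paths" and near: "\<forall>t\<in>{0..T}. norm (g t - f t) < d" for g :: "real \<Rightarrow> real ^ 2"
      using cont[OF g]
    proof (rule \<Phi>, intro ballI)
      fix t assume t: "t \<in> {0..T}"
      have n: "norm (g t - f t) < d" using near t by blast
      have nf: "norm (f t) \<le> \<bar>B\<bar>" using B[OF t] by simp
      have diff: "\<bar>norm (g t) - norm (f t)\<bar> \<le> norm (g t - f t)" by (rule norm_triangle_ineq3)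
      have "norm (g t - f t) < 1" using n by (simp add: d_def)
      then have "norm (g t) + norm (f t) \<le> 2 * B'"
        using norm_triangle_sub[of "g t" "f t"] nf by (simp add: B'_def)
      have "\<bar>H (g t) - H (f t)\<bar> = \<bar>norm (g t) - norm (f t)\<bar> * (norm (g t) + norm (f t)) / 2"
      proof -
        have "H (g t) - H (f t) = (norm (g t) - norm (f t)) * (norm (g t) + norm (f t)) / 2"
          by (simp add: H_def power2_eq_square algebra_simps diff_divide_distrib)
        then show ?thesis
          by (simp only: abs_mult abs_divide abs_numeral abs_of_nonneg[OF add_nonneg_nonneg[OF norm_ge_zero norm_ge_zero]])
      qed
      also have "\<dots> \<le> norm (g t - f t) * (2 * B') / 2"
        using diff \<open>norm (g t) + norm (f t) \<le> 2 * B'\<close> by (intro divide_right_mono mult_mono) auto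
      also have "\<dots> < \<delta>"
        using n \<open>0 < B'\<close> by (simp add: d_def pos_less_divide_eq)
      finally show "\<bar>H (g t) - H (f t)\<bar> < \<delta>" .
    qed
    then show "\<exists>T \<delta>. 0 < \<delta> \<and> (\<forall>g\<in>paths. (\<forall>t\<in>{0..T}. norm (g t - f t) < \<delta>) \<longrightarrow>
        \<bar>\<Phi> (\<lambda>t. H (g t)) - \<Phi> (\<lambda>t. H (f t))\<bar> < e)"
      using \<open>0 < d\<close> by blast
  qed
qed

section \<open>The rotated system in terms of the noise\<close>

context stationary_noise
begin

lemma noise_integral_sum:
  assumes J: "finite J" and f: "\<And>i. i \<in> J \<Longrightarrow> admissible (f i)"
  shows "AE \<omega> in M. noise_integral (\<lambda>s. \<Sum>i\<in>J. c i * f i s) \<omega> = (\<Sum>i\<in>J. c i * noise_integral (f i) \<omega>)"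
proof -
  have "AE \<omega> in M. \<forall>i\<in>J. integrable lborel (\<lambda>s. f i s * noise_ext s \<omega>)"
    using J noise_path_integrable[OF f] by (intro AE_finite_allI) auto
  then show ?thesis
  proof eventually_elim
    case (elim \<omega>)
    have "noise_integral (\<lambda>s. \<Sum>i\<in>J. c i * f i s) \<omega> = (LBINT s. \<Sum>i\<in>J. c i * (f i s * noise_ext s \<omega>))"
      unfolding noise_integral_def by (simp add: sum_distrib_right mult.assoc)
    also have "\<dots> = (\<Sum>i\<in>J. c i * noise_integral (f i) \<omega>)"
      unfolding noise_integral_def using elim by (subst Bochner_Integration.integral_sum) auto
    finally show ?case .
  qed
qed

lemma osc_noise_measurable[measurable]: "osc_noise a x \<in> borel_measurable M"
  unfolding osc_noise_def by (intro noise_integral_measurable admissible_kern) simp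

text \<open>A linear combination over several times and components is almost surely the noise
  integral of one admissible function, so joint Gaussianity comes from the scalar result.\<close>

lemma osc_noise_combination_gaussian:
  assumes J: "finite J"
  shows "centred_gaussian M (\<lambda>\<omega>. \<Sum>i\<in>J. c i * osc_noise (a i) (x i) \<omega>)"
proof (rule centred_gaussian_cong_AE)
  let ?f = "\<lambda>i s. indicator {0..x i} s * kern (a i) s"
  have adm: "admissible (?f i)" for i by (intro admissible_kern) simp
  show "AE \<omega> in M. noise_integral (\<lambda>s. \<Sum>i\<in>J. c i * ?f i s) \<omega> = (\<Sum>i\<in>J. c i * osc_noise (a i) (x i) \<omega>)"
    unfolding osc_noise_def by (rule noise_integral_sum[OF J adm])
  show "centred_gaussian M (noise_integral (\<lambda>s. \<Sum>i\<in>J. c i * ?f i s))"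
    by (intro noise_integral_gaussian admissible_sum J admissible_cmult adm)
qed measurable

text \<open>Integer endpoints give a single null set, outside which all real endpoints are
  covered.\<close>

lemma noise_paths_locally_integrable:
  "AE \<omega> in M. \<forall>x. integrable lborel (\<lambda>s. indicator {0..x} s * noise_ext s \<omega>)"
proof -
  have "AE \<omega> in M. \<forall>n::nat. integrable lborel (\<lambda>s. (indicator {0..real n} s * 1) * noise_ext s \<omega>)"
    unfolding AE_all_countable
    by (intro allI noise_path_integrable admissible_indicator[where b = 1]) auto
  with AE_space show ?thesis
  proof eventually_elim
    case (elim \<omega>)
    have [measurable]: "(\<lambda>s. noise_ext s \<omega>) \<in> borel_measurable borel"
      using elim(1) by (intro noise_ext_measurable_compose) auto
    show ?case
    proof
      fix x
      obtain n :: nat where n: "x \<le> real n" using real_arch_simple by blast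
      show "integrable lborel (\<lambda>s. indicator {0..x} s * noise_ext s \<omega>)"
      proof (rule Bochner_Integration.integrable_bound)
        show "integrable lborel (\<lambda>s. (indicator {0..real n} s * 1) * noise_ext s \<omega>)" using elim(2) by blast
        show "AE s in lborel. norm (indicator {0..x} s * noise_ext s \<omega>) \<le> norm ((indicator {0..real n} s * 1) * noise_ext s \<omega>)"
          using n by (intro AE_I2) (auto simp: indicator_def)
      qed measurable
    qed
  qed
qed

text \<open>The exceptional null set does not depend on \<open>t\<close>, since the equation is
  solved path by path. In the time \<open>u = s / \<epsilon>\<^sup>2\<close> the rotation has unit
  speed.\<close>

lemma rotated_representation:
  assumes e: "0 < \<epsilon>" and X: "solves_perturbed_system M v x0 \<epsilon> X"
  shows "AE \<omega> in M. \<forall>t\<ge>0. \<forall>a. rotate (t / \<epsilon>\<^sup>2) (X t \<omega>) $ a = x0 $ a + \<epsilon> * osc_noise a (t / \<epsilon>\<^sup>2) \<omega>"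
proof -
  let ?h = "\<lambda>\<omega> s. (1 / \<epsilon>\<^sup>2) *\<^sub>R perp_grad H (X s \<omega>) + ((1 / \<epsilon>) * v (s / \<epsilon>\<^sup>2) \<omega>) *\<^sub>R axis 2 1 :: real ^ 2"
  have cp: "continuous_process M X"
    and sol: "AE \<omega> in M. X 0 \<omega> = x0 \<and> (\<forall>t\<ge>0. (?h \<omega> has_integral (X t \<omega> - X 0 \<omega>)) {0..t})"
    using X by (auto simp: solves_perturbed_system_def)
  from sol noise_paths_locally_integrable AE_space show ?thesis
  proof eventually_elim
    case (elim \<omega>)
    define k where "k = 1 / \<epsilon>\<^sup>2"
    have "0 < k" using e by (simp add: k_def)
    define g where "g s = (1 / \<epsilon>) * v (k * s) \<omega>" for s
    have hi: "(?h \<omega> has_integral (X t \<omega> - X 0 \<omega>)) {0..t}" if "0 \<le> t" for t using elim(1) that by blast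
    have h1: "((\<lambda>s. ?h \<omega> s $ a) has_integral (X t \<omega> - X 0 \<omega>) $ a) {0..t}" if "0 \<le> t" for t a
      using has_integral_linear[OF hi[OF that] bounded_linear_vec_nth[of a]] by (simp add: comp_def)
    have e1: "((\<lambda>s. k * X s \<omega> $ 2) has_integral X t \<omega> $ 1 - X 0 \<omega> $ 1) {0..t}" if "0 \<le> t" for t
      using h1[OF that, of 1] by (simp add: perp_grad_H k_def axis_def)
    have e2: "((\<lambda>s. - (k * X s \<omega> $ 1) + g s) has_integral X t \<omega> $ 2 - X 0 \<omega> $ 2) {0..t}" if "0 \<le> t" for t
      using h1[OF that, of 2] by (simp add: perp_grad_H k_def g_def axis_def)
    have cX: "continuous_on {0..} (\<lambda>t. X t \<omega>)"
      using cp elim(3) by (simp add: continuous_process_def)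
    have c: "continuous_on {0..} (\<lambda>t. X t \<omega> $ a)" for a
      using bounded_linear.continuous_on[OF bounded_linear_vec_nth cX] .
    have gk: "indicator {0..t} s * (\<phi> (k * s) * g s) = (1 / \<epsilon>) * (indicator {0..k * t} (0 + k * s) * \<phi> (0 + k * s) * noise_ext (0 + k * s) \<omega>)"
      for \<phi> :: "real \<Rightarrow> real" and s t
      using \<open>0 < k\<close> by (auto simp: g_def noise_ext_def indicator_def zero_le_mult_iff)
    have gi: "set_integrable lborel {0..t} g" for t
    proof -
      have "integrable lborel (\<lambda>s. indicator {0..k * t} (0 + k * s) * noise_ext (0 + k * s) \<omega>)"
        using elim(2) \<open>0 < k\<close> by (intro lborel_integrable_real_affine) auto
      then have "integrable lborel (\<lambda>s. (1 / \<epsilon>) * (indicator {0..k * t} (0 + k * s) * 1 * noise_ext (0 + k * s) \<omega>))"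
        by simp
      then show ?thesis unfolding set_integrable_def using gk[of t _ "\<lambda>_. 1"] by simp
    qed
    \<comment> \<open>The substitution contributes \<open>\<epsilon>\<^sup>2\<close> against the
      prefactor \<open>1 / \<epsilon>\<close>, leaving \<open>\<epsilon>\<close>.\<close>
    have chg: "(LBINT s:{0..t}. \<phi> (k * s) * g s) = \<epsilon> * (LBINT u. indicator {0..k * t} u * \<phi> u * noise_ext u \<omega>)"
      for \<phi> :: "real \<Rightarrow> real" and t
    proof -
      have "(LBINT s:{0..t}. \<phi> (k * s) * g s) =
          (1 / \<epsilon>) * (LBINT s. indicator {0..k * t} (0 + k * s) * \<phi> (0 + k * s) * noise_ext (0 + k * s) \<omega>)"
        unfolding set_lebesgue_integral_def using gk[of t _ \<phi>] by simp
      moreover have "(LBINT u. indicator {0..k * t} u * \<phi> u * noise_ext u \<omega>) =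
          k * (LBINT s. indicator {0..k * t} (0 + k * s) * \<phi> (0 + k * s) * noise_ext (0 + k * s) \<omega>)"
        using lborel_integral_real_affine[of k "\<lambda>u. indicator {0..k * t} u * \<phi> u * noise_ext u \<omega>" 0] \<open>0 < k\<close> by simp
      ultimately show ?thesis using e by (simp add: k_def power2_eq_square)
    qed
    show ?case
    proof (intro allI impI)
      fix t :: real and a :: 2 assume t: "0 \<le> t"
      have tk: "t / \<epsilon>\<^sup>2 = k * t" by (simp add: k_def)
      note r = rotated_solution[OF c c gi e1 e2 t]
      have x0: "X 0 \<omega> = x0" using elim(1) by blast
      consider "a = 1" | "a = 2" using exhaust_2 by blast
      then show "rotate (t / \<epsilon>\<^sup>2) (X t \<omega>) $ a = x0 $ a + \<epsilon> * osc_noise a (t / \<epsilon>\<^sup>2) \<omega>"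
      proof cases
        case 1
        show ?thesis unfolding tk
          using r(1) chg[of t sin] 1 x0 by (simp add: rotate_def osc_noise_def noise_integral_def kern_def)
      next
        case 2
        show ?thesis unfolding tk
          using r(2) chg[of t cos] 2 x0 by (simp add: rotate_def osc_noise_def noise_integral_def kern_def)
      qed
    qed
  qed
qed

end

section \<open>Diffusive scaling\<close>

context oscillating_noise
begin

text \<open>With \<open>T = 1 / e\<^sup>2\<close> the two factors \<open>e\<close> form exactly the
  \<open>1 / T\<close> of the unscaled limit.\<close>

lemma scaled_covariance_limit:
  assumes "0 \<le> \<alpha>" "0 \<le> \<beta>"
  shows "((\<lambda>e. expectation (\<lambda>\<omega>. (e * osc_noise a (\<alpha> / e\<^sup>2) \<omega>) * (e * osc_noise b (\<beta> / e\<^sup>2) \<omega>)))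
    \<longlongrightarrow> min \<alpha> \<beta> * (if a = b then D else 0)) (at_right 0)"
proof -
  have "filterlim (\<lambda>e::real. inverse (e\<^sup>2)) at_top (at_right 0)"
  proof (rule filterlim_compose[OF filterlim_inverse_at_top_right])
    have "((\<lambda>e::real. e\<^sup>2) \<longlongrightarrow> 0) (at_right 0)" by (auto intro!: tendsto_eq_intros)
    then show "filterlim (\<lambda>e::real. e\<^sup>2) (at_right 0) (at_right 0)"
      unfolding filterlim_at by (auto simp: eventually_at_filter)
  qed
  from filterlim_compose[OF osc_noise_covariance_limit[OF assms, of a b] this]
  have "((\<lambda>e. e\<^sup>2 * expectation (\<lambda>\<omega>. osc_noise a (\<alpha> / e\<^sup>2) \<omega> * osc_noise b (\<beta> / e\<^sup>2) \<omega>))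
    \<longlongrightarrow> min \<alpha> \<beta> * (if a = b then D else 0)) (at_right 0)"
    by (simp add: divide_inverse)
  moreover have "expectation (\<lambda>\<omega>. (e * osc_noise a (\<alpha> / e\<^sup>2) \<omega>) * (e * osc_noise b (\<beta> / e\<^sup>2) \<omega>)) =
      e\<^sup>2 * expectation (\<lambda>\<omega>. osc_noise a (\<alpha> / e\<^sup>2) \<omega> * osc_noise b (\<beta> / e\<^sup>2) \<omega>)" for e
    by (subst integral_mult_right_zero[symmetric]) (simp add: power2_eq_square mult_ac)
  ultimately show ?thesis by simp
qed

text \<open>The Gaussian fourth moment is three times the squared variance, and the variance is at
  most \<open>K * (t - s) / e\<^sup>2\<close>. The factor \<open>e ^ 4\<close> cancels the scaling,
  so the bound does not depend on \<open>e\<close>.\<close>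

lemma increment_fourth_moment:
  "\<exists>K\<ge>0. \<forall>e s t a. 0 < e \<longrightarrow> 0 \<le> s \<longrightarrow> s \<le> t \<longrightarrow>
     integrable M (\<lambda>\<omega>. (e * (osc_noise a (t / e\<^sup>2) \<omega> - osc_noise a (s / e\<^sup>2) \<omega>)) ^ 4) \<and>
     expectation (\<lambda>\<omega>. (e * (osc_noise a (t / e\<^sup>2) \<omega> - osc_noise a (s / e\<^sup>2) \<omega>)) ^ 4) \<le> K * (t - s)\<^sup>2"
proof -
  obtain K where K: "0 \<le> K" "\<And>a x y. 0 \<le> x \<Longrightarrow> x \<le> y \<Longrightarrow>
     expectation (\<lambda>\<omega>. (noise_integral (\<lambda>s. indicator {x..y} s * kern a s) \<omega>)\<^sup>2) \<le> K * (y - x)"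
    using osc_noise_variance_bound by blast
  show ?thesis
  proof (intro exI[of _ "3 * K\<^sup>2"] conjI[of "0 \<le> 3 * K\<^sup>2"] allI impI)
    show "0 \<le> 3 * K\<^sup>2" by simp
    fix e s t :: real and a :: 2 assume e: "0 < e" and st: "0 \<le> s" "s \<le> t"
    have xy: "0 \<le> s / e\<^sup>2" "s / e\<^sup>2 \<le> t / e\<^sup>2" using st by (auto intro: divide_right_mono)
    let ?U = "noise_integral (\<lambda>r. indicator {s / e\<^sup>2..t / e\<^sup>2} r * kern a r)"
    let ?d = "\<lambda>\<omega>. (e * (osc_noise a (t / e\<^sup>2) \<omega> - osc_noise a (s / e\<^sup>2) \<omega>)) ^ 4"
    have g: "centred_gaussian M ?U" by (intro noise_integral_gaussian admissible_kern xy)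
    have [measurable]: "?U \<in> borel_measurable M" using g by (rule centred_gaussian_measurable)
    have ae: "AE \<omega> in M. ?d \<omega> = e ^ 4 * (?U \<omega>) ^ 4"
      using osc_noise_increment[OF xy, of a] by eventually_elim (simp add: power_mult_distrib)
    have iU: "integrable M (\<lambda>\<omega>. e ^ 4 * (?U \<omega>) ^ 4)" using centred_gaussian_moments(4)[OF g] by simp
    have i: "integrable M ?d"
      by (rule integrable_cong_AE_imp[OF iU]) (use ae in \<open>auto simp: eq_commute\<close>)
    have "expectation ?d = expectation (\<lambda>\<omega>. e ^ 4 * (?U \<omega>) ^ 4)"
      by (rule integral_cong_AE) (use ae in auto)
    also have "\<dots> = e ^ 4 * (3 * (expectation (\<lambda>\<omega>. (?U \<omega>)\<^sup>2))\<^sup>2)"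
      using centred_gaussian_moments(5)[OF g] by simp
    also have "\<dots> \<le> e ^ 4 * (3 * (K * (t / e\<^sup>2 - s / e\<^sup>2))\<^sup>2)"
      using K(2)[OF xy, of a] by (intro mult_left_mono power_mono) auto
    also have "\<dots> = 3 * K\<^sup>2 * (t - s)\<^sup>2"
      using e by (simp add: diff_divide_distrib[symmetric] power_mult_distrib power_divide power_mult[symmetric])
    finally show "integrable M ?d \<and> expectation ?d \<le> 3 * K\<^sup>2 * (t - s)\<^sup>2" using i by simp
  qed
qed

text \<open>Convergence is proved in the plane for the rotated process, which is Gaussian, while
  \<open>X\<close> itself turns ever faster. \<open>H\<close> is applied last, as it does not notice
  the rotation.\<close>

theorem energy_converges:
  fixes N :: "'b measure" and Dm :: "real ^ 2 ^ 2"
  assumes X: "\<And>\<epsilon>. 0 < \<epsilon> \<Longrightarrow> solves_perturbed_system M v x0 \<epsilon> (X \<epsilon>)"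
    and Dm: "\<And>a b. Dm $ a $ b = (if a = b then D else 0)"
    and bm: "brownian_motion N Dm x0 W"
  shows "converges_in_law_at_zero M (\<lambda>\<epsilon> t \<omega>. H (X \<epsilon> t \<omega>)) N (\<lambda>t \<omega>. H (W t \<omega>))"
proof -
  note bmp = bm_prob[OF bm]
  interpret N: prob_space N by (rule bmp)
  have cX: "continuous_process M (X e)" if "0 < e" for e
    using X[OF that] by (simp add: solves_perturbed_system_def)
  \<comment> \<open>For \<open>e \<le> 0\<close> a constant dummy: the criterion asks for continuity
    and moment bounds at every index, while the limit concerns only \<open>e > 0\<close>.\<close>
  define Y where "Y e t \<omega> = (if 0 < e then rotate (t / e\<^sup>2) (X e t \<omega>) else x0)" for e t \<omega>
  have Yc: "continuous_process M (Y e)" for e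
  proof (cases "0 < e")
    case True
    show ?thesis unfolding continuous_process_def
    proof (intro conjI allI impI ballI)
      fix t :: real assume "0 \<le> t"
      then have [measurable]: "X e t \<in> borel_measurable M" using cX[OF True] by (simp add: continuous_process_def)
      have [measurable]: "rotate (t / e\<^sup>2) \<in> borel_measurable borel"
        by (intro borel_measurable_continuous_onI rotate_continuous continuous_intros)
      show "Y e t \<in> borel_measurable M" unfolding Y_def[abs_def] using True by simp
    next
      fix \<omega> assume "\<omega> \<in> space M"
      then have "continuous_on {0..} (\<lambda>t. X e t \<omega>)" using cX[OF True] by (simp add: continuous_process_def)
      then show "continuous_on {0..} (\<lambda>t. Y e t \<omega>)"
        unfolding Y_def using True by (simp add: rotate_continuous continuous_intros)
    qed
  next
    case False
    then show ?thesis by (simp add: continuous_process_def Y_def[abs_def])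
  qed
  have rep: "AE \<omega> in M. \<forall>t\<ge>0. \<forall>a. Y e t \<omega> $ a = x0 $ a + e * osc_noise a (t / e\<^sup>2) \<omega>" if "0 < e" for e
    using rotated_representation[OF that X[OF that]] that by (simp add: Y_def)
  obtain K where K: "0 \<le> K" "\<And>e s t a. 0 < e \<Longrightarrow> 0 \<le> s \<Longrightarrow> s \<le> t \<Longrightarrow>
     integrable M (\<lambda>\<omega>. (e * (osc_noise a (t / e\<^sup>2) \<omega> - osc_noise a (s / e\<^sup>2) \<omega>)) ^ 4) \<and>
     expectation (\<lambda>\<omega>. (e * (osc_noise a (t / e\<^sup>2) \<omega> - osc_noise a (s / e\<^sup>2) \<omega>)) ^ 4) \<le> K * (t - s)\<^sup>2"
    using increment_fourth_moment by blast
  have Ym[measurable]: "Y e t \<in> borel_measurable M" if "0 \<le> t" for e t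
    using Yc[of e] that by (simp add: continuous_process_def)
  have mom: "integrable M (\<lambda>\<omega>. norm (Y e t \<omega> - Y e s \<omega>) ^ 4) \<and>
      expectation (\<lambda>\<omega>. norm (Y e t \<omega> - Y e s \<omega>) ^ 4) \<le> (4 * K) * (t - s)\<^sup>2" if st: "0 \<le> s" "s \<le> t" for e s t
  proof (cases "0 < e")
    case True
    let ?d = "\<lambda>a \<omega>. (e * (osc_noise a (t / e\<^sup>2) \<omega> - osc_noise a (s / e\<^sup>2) \<omega>)) ^ 4"
    note k = K(2)[OF True st]
    have [measurable]: "Y e t \<in> borel_measurable M" "Y e s \<in> borel_measurable M" using st by (auto intro: Ym)
    have ae: "AE \<omega> in M. norm (Y e t \<omega> - Y e s \<omega>) ^ 4 \<le> 2 * (?d 1 \<omega> + ?d 2 \<omega>)"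
      using rep[OF True]
    proof eventually_elim
      case (elim \<omega>)
      have "(Y e t \<omega> - Y e s \<omega>) $ a = e * (osc_noise a (t / e\<^sup>2) \<omega> - osc_noise a (s / e\<^sup>2) \<omega>)" for a
        using elim st by (simp add: right_diff_distrib)
      then show ?case using norm_vec2_power4[of "Y e t \<omega> - Y e s \<omega>"] by simp
    qed
    have i2: "integrable M (\<lambda>\<omega>. 2 * (?d 1 \<omega> + ?d 2 \<omega>))" using k[of 1] k[of 2] by simp
    have i: "integrable M (\<lambda>\<omega>. norm (Y e t \<omega> - Y e s \<omega>) ^ 4)"
      by (rule Bochner_Integration.integrable_bound[OF i2]) (use ae in \<open>auto elim!: eventually_mono intro: order_trans[OF _ abs_ge_self]\<close>)
    have "expectation (\<lambda>\<omega>. norm (Y e t \<omega> - Y e s \<omega>) ^ 4) \<le> expectation (\<lambda>\<omega>. 2 * (?d 1 \<omega> + ?d 2 \<omega>))"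
      by (rule integral_mono_AE[OF i i2 ae])
    also have "\<dots> = 2 * (expectation (?d 1) + expectation (?d 2))" using k[of 1] k[of 2] by simp
    also have "\<dots> \<le> 2 * (K * (t - s)\<^sup>2 + K * (t - s)\<^sup>2)" using k[of 1] k[of 2] by (intro mult_left_mono add_mono) auto
    finally show ?thesis using i by simp
  next
    case False
    then show ?thesis using K(1) by (simp add: Y_def)
  qed
  have fd: "((\<lambda>e. LINT \<omega>|M. \<Psi> (interp n (\<lambda>t. Y e t \<omega>))) \<longlongrightarrow> (LINT \<omega>|N. \<Psi> (interp n (\<lambda>t. W t \<omega>)))) (at_right 0)"
    if \<Psi>: "path_functional \<Psi>" for n \<Psi>
  proof -
    define m where "m = n * 2 ^ n"
    define h :: real where "h = 1 / 2 ^ n"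
    have h: "0 \<le> h" by (simp add: h_def)
    define J where "J = {..m} \<times> (UNIV :: 2 set)"
    have J: "finite J" by (simp add: J_def)
    \<comment> \<open>Indexed by pairs of grid time and component, with zero outside the finite set
      \<open>J\<close>, as \<open>gaussian_family_converges\<close> expects.\<close>
    define A where "A e p \<omega> = (if p \<in> J then e * osc_noise (snd p) (real (fst p) * h / e\<^sup>2) \<omega> else 0)" for e p \<omega>
    define B where "B p \<omega> = (if p \<in> J then (W (real (fst p) * h) \<omega> - W 0 \<omega>) $ snd p else 0)" for p \<omega>
    \<comment> \<open>The starting point is moved into \<open>F\<close>, so that the families
      \<open>A\<close> and \<open>B\<close> are centred.\<close>
    define F where "F x = \<Psi> (interp_of n (\<lambda>j. x0 + (\<chi> a. x (j, a))))" for x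
    have Fc: "continuous_on UNIV F"
      unfolding F_def
    proof (rule continuous_on_compose2[OF interp_functional_continuous[OF \<Psi>]])
      show "continuous_on UNIV (\<lambda>x j. x0 + (\<chi> a. x (j, a)))"
        by (intro continuous_on_coordinatewise_then_product continuous_on_add continuous_on_const
            continuous_on_vec_lambda continuous_on_product_coordinates)
    qed simp
    obtain b where b: "\<And>f. f \<in> paths \<Longrightarrow> \<bar>\<Psi> f\<bar> \<le> b" using \<Psi> unfolding path_functional_def by blast
    have Fb: "\<bar>F x\<bar> \<le> b" for x unfolding F_def by (rule b[OF interp_of_paths])
    have gA: "centred_gaussian M (\<lambda>\<omega>. \<Sum>p\<in>J. c p * A e p \<omega>)" for c e
    proof -
      have "(\<Sum>p\<in>J. c p * A e p \<omega>) = (\<Sum>p\<in>J. (c p * e) * osc_noise (snd p) (real (fst p) * h / e\<^sup>2) \<omega>)" for \<omega>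
        by (rule sum.cong) (auto simp: A_def)
      then show ?thesis using osc_noise_combination_gaussian[OF J] by simp
    qed
    have gB: "centred_gaussian N (\<lambda>\<omega>. \<Sum>p\<in>J. c p * B p \<omega>)" for c
    proof -
      have "(\<Sum>p\<in>J. c p * B p \<omega>) = (\<Sum>j\<le>m. (\<chi> a. c (j, a)) \<bullet> (W (real j * h) \<omega> - W 0 \<omega>))" for \<omega>
      proof -
        have "(\<Sum>p\<in>J. c p * B p \<omega>) = (\<Sum>j\<le>m. \<Sum>a\<in>UNIV. c (j, a) * B (j, a) \<omega>)"
          unfolding J_def by (simp add: sum.cartesian_product)
        also have "\<dots> = (\<Sum>j\<le>m. (\<chi> a. c (j, a)) \<bullet> (W (real j * h) \<omega> - W 0 \<omega>))"
          by (rule sum.cong[OF refl]) (simp add: inner_vec_sum B_def J_def)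
        finally show ?thesis .
      qed
      then show ?thesis using bm_linear_combination_gaussian[OF bm h] by simp
    qed
    have cov: "((\<lambda>e. LINT \<omega>|M. A e p \<omega> * A e q \<omega>) \<longlongrightarrow> (LINT \<omega>|N. B p \<omega> * B q \<omega>)) (at_right 0)"
      if pq: "p \<in> J" "q \<in> J" for p q
    proof -
      have "(LINT \<omega>|N. B p \<omega> * B q \<omega>) = min (real (fst p) * h) (real (fst q) * h) * (if snd p = snd q then D else 0)"
        using bm_covariance[OF bm, of "real (fst p) * h" "real (fst q) * h" "snd p" "snd q"] pq h
        unfolding B_def Dm by simp
      then show ?thesis
        using scaled_covariance_limit[of "real (fst p) * h" "real (fst q) * h" "snd p" "snd q"] pq h
        unfolding A_def by simp
    qed
    have lim: "((\<lambda>e. LINT \<omega>|M. F (\<lambda>p. A e p \<omega>)) \<longlongrightarrow> (LINT \<omega>|N. F (\<lambda>p. B p \<omega>))) (at_right 0)"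
      by (rule gaussian_family_converges[OF prob_space_axioms bmp J gA gB _ _ cov Fc Fb]) (auto simp: A_def B_def)
    have [measurable]: "F \<in> borel_measurable borel" using Fc by (rule borel_measurable_continuous_onI)
    have interp_eq: "interp n f = interp_of n (\<lambda>j. x0 + (\<chi> a. y (j, a)))"
      if "\<And>j a. j \<le> m \<Longrightarrow> f (real j * h) $ a = x0 $ a + y (j, a)" for f :: "real \<Rightarrow> real ^ 2" and y
    proof -
      have "f (real j / 2 ^ n) = x0 + (\<chi> a. y (j, a))" if "j \<le> m" for j
        using \<open>\<And>j a. j \<le> m \<Longrightarrow> f (real j * h) $ a = x0 $ a + y (j, a)\<close>[OF that]
        by (simp add: vec_eq_iff h_def)
      then show ?thesis unfolding interp_def interp_of_def m_def[symmetric] by (intro ext sum.cong) auto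
    qed
    have eqN: "(LINT \<omega>|N. F (\<lambda>p. B p \<omega>)) = (LINT \<omega>|N. \<Psi> (interp n (\<lambda>t. W t \<omega>)))"
    proof (rule integral_cong_AE)
      have Bm: "B p \<in> borel_measurable N" for p
      proof -
        have "(\<lambda>x :: real ^ 2. x $ a) \<in> borel_measurable borel" for a
          by (intro borel_measurable_continuous_onI continuous_intros)
        then have [measurable]: "(\<lambda>\<omega>. W t \<omega> $ a) \<in> borel_measurable N" if "0 \<le> t" for t a
          by (rule measurable_compose[OF bm_measurable[OF bm that]])
        show ?thesis unfolding B_def[abs_def] using h by (cases "p \<in> J") simp_all
      qed
      have "(\<lambda>\<omega> p. B p \<omega>) \<in> borel_measurable N"
        by (rule measurable_coordinatewise_then_product) (rule Bm)
      then show "(\<lambda>\<omega>. F (\<lambda>p. B p \<omega>)) \<in> borel_measurable N" by measurable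
      show "(\<lambda>\<omega>. \<Psi> (interp n (\<lambda>t. W t \<omega>))) \<in> borel_measurable N"
        by (rule measurable_path_functional_interp[OF \<Psi> bm_cont[OF bm]])
      show "AE \<omega> in N. F (\<lambda>p. B p \<omega>) = \<Psi> (interp n (\<lambda>t. W t \<omega>))"
        using bm_start[OF bm]
      proof eventually_elim
        case (elim \<omega>)
        have "interp n (\<lambda>t. W t \<omega>) = interp_of n (\<lambda>j. x0 + (\<chi> a. B (j, a) \<omega>))"
          by (rule interp_eq) (simp add: B_def J_def elim)
        then show ?case by (simp add: F_def)
      qed
    qed
    have eqM: "(LINT \<omega>|M. F (\<lambda>p. A e p \<omega>)) = (LINT \<omega>|M. \<Psi> (interp n (\<lambda>t. Y e t \<omega>)))" if "0 < e" for e
    proof (rule integral_cong_AE)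
      have Am: "A e p \<in> borel_measurable M" for p unfolding A_def[abs_def] by (cases "p \<in> J") simp_all
      have "(\<lambda>\<omega> p. A e p \<omega>) \<in> borel_measurable M"
        by (rule measurable_coordinatewise_then_product) (rule Am)
      then show "(\<lambda>\<omega>. F (\<lambda>p. A e p \<omega>)) \<in> borel_measurable M" by measurable
      show "(\<lambda>\<omega>. \<Psi> (interp n (\<lambda>t. Y e t \<omega>))) \<in> borel_measurable M"
        by (rule measurable_path_functional_interp[OF \<Psi> Yc])
      show "AE \<omega> in M. F (\<lambda>p. A e p \<omega>) = \<Psi> (interp n (\<lambda>t. Y e t \<omega>))"
        using rep[OF that]
      proof eventually_elim
        case (elim \<omega>)
        have "interp n (\<lambda>t. Y e t \<omega>) = interp_of n (\<lambda>j. x0 + (\<chi> a. A e (j, a) \<omega>))"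
          by (rule interp_eq) (use elim h in \<open>simp add: A_def J_def\<close>)
        then show ?case by (simp add: F_def)
      qed
    qed
    show ?thesis using lim unfolding eqN
    proof (rule Lim_transform_eventually)
      show "\<forall>\<^sub>F e in at_right 0. (LINT \<omega>|M. F (\<lambda>p. A e p \<omega>)) = (LINT \<omega>|M. \<Psi> (interp n (\<lambda>t. Y e t \<omega>)))"
        using eventually_at_right_less[of 0] by eventually_elim (rule eqM)
    qed
  qed
  show ?thesis unfolding converges_in_law_at_zero_def
  proof (intro allI impI)
    fix \<Phi> assume \<Phi>: "bounded_continuous_functional \<Phi>"
    have "((\<lambda>e. LINT \<omega>|M. \<Phi> (\<lambda>t. H (Y e t \<omega>))) \<longlongrightarrow> (LINT \<omega>|N. \<Phi> (\<lambda>t. H (W t \<omega>)))) (at_right 0)"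
      using mom by (intro weak_convergence_criterion[OF prob_space_axioms bmp Yc bm_cont[OF bm] _ _ fd path_functional_energy[OF \<Phi>], of "4 * K"]) auto
    then show "((\<lambda>\<epsilon>. expectation (\<lambda>\<omega>. \<Phi> (\<lambda>t. H (X \<epsilon> t \<omega>)))) \<longlongrightarrow> (LINT \<omega>|N. \<Phi> (\<lambda>t. H (W t \<omega>)))) (at_right 0)"
    proof (rule Lim_transform_eventually)
      show "\<forall>\<^sub>F e in at_right 0. (LINT \<omega>|M. \<Phi> (\<lambda>t. H (Y e t \<omega>))) = expectation (\<lambda>\<omega>. \<Phi> (\<lambda>t. H (X e t \<omega>)))"
        using eventually_at_right_less[of 0] by eventually_elim (simp add: Y_def H_rotate)
    qed
  qed
qed

end

text \<open>Existence of the limit and its nonnegativity belong to the claim, so that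
  \<open>D\<close> is a genuine covariance matrix.\<close>

theorem proposition1p1:
  fixes M :: "'a measure" and v :: "real \<Rightarrow> 'a \<Rightarrow> real" and L :: "real \<Rightarrow> real" and \<gamma> :: real
    and X\<^sub>0 :: "real ^ 2" and X :: "real \<Rightarrow> real \<Rightarrow> 'a \<Rightarrow> real ^ 2"
  assumes "prob_space M"
    and "stationary_gaussian_noise M v"
    and "0 < \<gamma>" and "\<gamma> < 2"
    and "slowly_varying L"
    and "\<And>t. 0 < t \<Longrightarrow> autocovariance M v t = L t / t powr \<gamma>"
    and "\<gamma> \<le> 1 \<Longrightarrow> slow_increase L"
    and "\<And>\<epsilon>. 0 < \<epsilon> \<Longrightarrow> solves_perturbed_system M v X\<^sub>0 \<epsilon> (X \<epsilon>)"
  shows "\<exists>D :: real ^ 2 ^ 2.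
           ((\<lambda>x. LBINT z:{0..x}. autocovariance M v z * cos z) \<longlongrightarrow> D $ 1 $ 1) at_top \<and>
           D $ 2 $ 2 = D $ 1 $ 1 \<and> D $ 1 $ 2 = 0 \<and> D $ 2 $ 1 = 0 \<and> 0 \<le> D $ 1 $ 1 \<and>
           (\<forall>(N :: 'b measure) W. brownian_motion N D X\<^sub>0 W \<longrightarrow>
              converges_in_law_at_zero M (\<lambda>\<epsilon> t \<omega>. H (X \<epsilon> t \<omega>)) N (\<lambda>t \<omega>. H (W t \<omega>)))"
proof -
  interpret stationary_noise M v
    using assms(1,2) by (simp add: stationary_noise_def stationary_noise_axioms_def)
  have RL: "covar t = L t / t powr \<gamma>" if "0 < t" for t
    using assms(6)[OF that] that by (simp add: covar_def)
  \<comment> \<open>Cosine and sine have integrals of absolute value at most 2 over every interval,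
    so one convergence result serves both.\<close>
  note osc = oscillating_integral_converges[OF covar_measurable covar_bound assms(5) RL assms(3) assms(7)]
  obtain d where d: "((\<lambda>x. LBINT z:{0..x}. covar z * cos z) \<longlongrightarrow> d) at_top"
    using osc[OF _ _ continuous_on_cos[OF continuous_on_id] abs_cos_le_one integral_sin_cos_bounded(1)] by blast
  obtain s where s: "((\<lambda>x. LBINT z:{0..x}. covar z * sin z) \<longlongrightarrow> s) at_top"
    using osc[OF _ _ continuous_on_sin[OF continuous_on_id] abs_sin_le_one integral_sin_cos_bounded(2)] by blast
  have "cosine_integral covar = (\<lambda>x. LBINT z:{0..x}. covar z * cos z)"
    "sine_integral covar = (\<lambda>x. LBINT z:{0..x}. covar z * sin z)"
    by (rule ext, rule cosine_integral_def[OF covar_measurable covar_bound covar_neg], assumption)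
      (rule ext, rule sine_integral_def[OF covar_measurable covar_bound covar_neg], assumption)
  with d s interpret oscillating_noise M v d s
    by unfold_locales simp_all
  define D :: "real ^ 2 ^ 2" where "D = (\<chi> a b. if a = b then d else 0)"
  have D: "D $ a $ b = (if a = b then d else 0)" for a b by (simp add: D_def)
  have "(LBINT z:{0..x}. covar z * cos z) = (LBINT z:{0..x}. autocovariance M v z * cos z)" for x
    unfolding set_lebesgue_integral_def
    by (rule Bochner_Integration.integral_cong) (auto simp: covar_def indicator_def)
  with d have lim: "((\<lambda>x. LBINT z:{0..x}. autocovariance M v z * cos z) \<longlongrightarrow> D $ 1 $ 1) at_top"
    by (simp add: D)
  show ?thesis
  proof (intro exI[of _ D] conjI allI impI lim)
    show "D $ 2 $ 2 = D $ 1 $ 1" "D $ 1 $ 2 = 0" "D $ 2 $ 1 = 0" by (simp_all add: D)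
    show "0 \<le> D $ 1 $ 1" using diffusivity_nonneg by (simp add: D)
    fix N :: "'b measure" and W assume bm: "brownian_motion N D X\<^sub>0 W"
    show "converges_in_law_at_zero M (\<lambda>\<epsilon> t \<omega>. H (X \<epsilon> t \<omega>)) N (\<lambda>t \<omega>. H (W t \<omega>))"
      by (rule energy_converges[OF _ D bm]) (rule assms(8))
  qed
qed

end
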